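(* Let $(M^n,g,f)$ be a complete noncompact expanding gradient Ricci soliton with bounded scalar curvature and proper potential function $f$. Then $M$ has at most polynomial volume growth, i.e. for any $p\in M$ there exist constants $C,k>0$ such that $|B_r(p)|\le C r^{k}$ for all sufficiently large $r$.
   Context: An expanding gradient Ricci soliton is a triple $(M^n,g,f)$ consisting of a (connected, smooth) Riemannian manifold $(M^n,g)$ and a function $f\in C^\infty(M)$ (the potential function) satisfying $\operatorname{Ric}+\nabla^2 f=-\tfrac12 g$; it is complete if $(M,g)$ is complete. It is known that $|\nabla f|^2+R+f$ is constant, and by adding a constant to $f$ one normalizes so that $|\nabla f|^2+R=-f$, where $R$ is the scalar curvature. The function $f:M\to\mathbb{R}$ is proper if preimages of compact sets are compact. $B_r(p)$ is the geodesic ball of radius $r$ centered at $p$, and $|\cdot|$ denotes Riemannian volume. *)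

theory Defs
  imports "HOL-Analysis.Analysis"
begin

section \<open>Smooth functions on open subsets of Euclidean space\<close>

(* C^k on an open set, by iterating directional derivatives. *)
fun Ck_on :: "nat \<Rightarrow> 'a::euclidean_space set \<Rightarrow> ('a \<Rightarrow> 'b::real_normed_vector) \<Rightarrow> bool" where
  "Ck_on 0 S h \<longleftrightarrow> continuous_on S h"
| "Ck_on (Suc k) S h \<longleftrightarrow>
     (\<forall>x\<in>S. h differentiable (at x)) \<and> (\<forall>v. Ck_on k S (\<lambda>x. frechet_derivative h (at x) v))"

definition smooth_on :: "'a::euclidean_space set \<Rightarrow> ('a \<Rightarrow> 'b::real_normed_vector) \<Rightarrow> bool" where
  "smooth_on S h \<longleftrightarrow> (\<forall>k. Ck_on k S h)"

definition partial :: "'n \<Rightarrow> (real ^ 'n::finite \<Rightarrow> 'b::real_normed_vector) \<Rightarrow> real ^ 'n \<Rightarrow> 'b" where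
  "partial i h x = frechet_derivative h (at x) (axis i 1)"


section \<open>Smooth manifolds and smooth functions\<close>

(* A chart (U, phi): the values of phi outside its domain U are irrelevant. *)
type_synonym ('m, 'n) chart = "'m set \<times> ('m \<Rightarrow> real ^ 'n)"

definition chart_image :: "('m, 'n) chart \<Rightarrow> (real ^ 'n) set" where
  "chart_image c = snd c ` fst c"

definition chart_inv :: "('m, 'n) chart \<Rightarrow> real ^ 'n \<Rightarrow> 'm" where
  "chart_inv c = inv_into (fst c) (snd c)"

definition transition :: "('m, 'n) chart \<Rightarrow> ('m, 'n) chart \<Rightarrow> real ^ 'n \<Rightarrow> real ^ 'n" where
  "transition c d = snd d \<circ> chart_inv c"

(* The manifold is the whole (Hausdorff, second countable) type 'm, its dimension is CARD('n), and
   its smooth structure is the one generated by A, which need not be a maximal atlas. *)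
locale smooth_manifold =
  fixes A :: "('m::{t2_space, second_countable_topology}, 'n::finite) chart set"
  assumes charts_cover: "(\<Union>c\<in>A. fst c) = UNIV"
    and open_domain: "c \<in> A \<Longrightarrow> open (fst c)"
    and open_image: "c \<in> A \<Longrightarrow> open (chart_image c)"
    and chart_homeomorphism:
      "c \<in> A \<Longrightarrow> homeomorphism (fst c) (chart_image c) (snd c) (chart_inv c)"
    and smooth_transition:
      "c \<in> A \<Longrightarrow> d \<in> A \<Longrightarrow> smooth_on (snd c ` (fst c \<inter> fst d)) (transition c d)"

definition smooth_function :: "('m, 'n::finite) chart set \<Rightarrow> ('m \<Rightarrow> real) \<Rightarrow> bool" where
  "smooth_function A f \<longleftrightarrow> (\<forall>c\<in>A. smooth_on (chart_image c) (f \<circ> chart_inv c))"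


section \<open>Riemannian manifolds\<close>

(* A symmetric (0,2)-tensor field g is given by its component matrices: g c x is the matrix
   (g_ij) in the chart c at the point with coordinates x, subject to the transformation law. *)
locale riemannian_manifold = smooth_manifold A
  for A :: "('m::{t2_space, second_countable_topology}, 'n::finite) chart set" +
  fixes g :: "('m, 'n) chart \<Rightarrow> real ^ 'n \<Rightarrow> real ^ 'n ^ 'n"
  assumes connected_manifold: "connected (UNIV :: 'm set)"
    and metric_smooth: "c \<in> A \<Longrightarrow> smooth_on (chart_image c) (g c)"
    and metric_symmetric: "c \<in> A \<Longrightarrow> x \<in> chart_image c \<Longrightarrow> transpose (g c x) = g c x"
    and metric_positive:
      "c \<in> A \<Longrightarrow> x \<in> chart_image c \<Longrightarrow> v \<noteq> 0 \<Longrightarrow> v \<bullet> (g c x *v v) > 0"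
    and metric_transformation:
      "c \<in> A \<Longrightarrow> d \<in> A \<Longrightarrow> x \<in> snd c ` (fst c \<inter> fst d) \<Longrightarrow>
        g c x = transpose (jacobian (transition c d) (at x)) **
                  g d (transition c d x) ** jacobian (transition c d) (at x)"

subsection \<open>Curvature and Hessian in local coordinates\<close>

text \<open>Here \<open>G\<close> is the component matrix of the metric in one fixed chart.\<close>

(* Gamma^k_ij *)
definition christoffel ::
  "(real ^ 'n \<Rightarrow> real ^ 'n ^ 'n) \<Rightarrow> 'n::finite \<Rightarrow> 'n \<Rightarrow> 'n \<Rightarrow> real ^ 'n \<Rightarrow> real" where
  "christoffel G k i j x =
     1/2 * (\<Sum>l\<in>UNIV. matrix_inv (G x) $ k $ l *
       (partial i (\<lambda>y. G y $ j $ l) x + partial j (\<lambda>y. G y $ i $ l) x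
         - partial l (\<lambda>y. G y $ i $ j) x))"

(* The l-th component of R(e_i, e_j) e_k, with
   R(X,Y)Z = nabla_X nabla_Y Z - nabla_Y nabla_X Z - nabla_[X,Y] Z. *)
definition riemann ::
  "(real ^ 'n \<Rightarrow> real ^ 'n ^ 'n) \<Rightarrow> 'n::finite \<Rightarrow> 'n \<Rightarrow> 'n \<Rightarrow> 'n \<Rightarrow> real ^ 'n \<Rightarrow> real" where
  "riemann G l i j k x =
     partial i (christoffel G l j k) x - partial j (christoffel G l i k) x
     + (\<Sum>m\<in>UNIV. christoffel G l i m x * christoffel G m j k x
                  - christoffel G l j m x * christoffel G m i k x)"

(* Ric(Y,Z) is the trace of X |-> R(X,Y)Z, which is positive on round spheres. *)
definition ricci ::
  "(real ^ 'n \<Rightarrow> real ^ 'n ^ 'n) \<Rightarrow> 'n::finite \<Rightarrow> 'n \<Rightarrow> real ^ 'n \<Rightarrow> real" where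
  "ricci G j k x = (\<Sum>i\<in>UNIV. riemann G i i j k x)"

definition scalar_curvature :: "(real ^ 'n \<Rightarrow> real ^ 'n ^ 'n) \<Rightarrow> real ^ 'n::finite \<Rightarrow> real" where
  "scalar_curvature G x = (\<Sum>j\<in>UNIV. \<Sum>k\<in>UNIV. matrix_inv (G x) $ j $ k * ricci G j k x)"

definition hessian ::
  "(real ^ 'n \<Rightarrow> real ^ 'n ^ 'n) \<Rightarrow> (real ^ 'n \<Rightarrow> real) \<Rightarrow> 'n::finite \<Rightarrow> 'n \<Rightarrow> real ^ 'n \<Rightarrow> real" where
  "hessian G h i j x =
     partial i (partial j h) x - (\<Sum>k\<in>UNIV. christoffel G k i j x * partial k h x)"

(* Scalar curvature is invariant under change of coordinates, so bounding its coordinate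
   expressions in all charts by one constant means bounding it as a function on the manifold. *)
definition bounded_scalar_curvature ::
  "('m, 'n::finite) chart set \<Rightarrow> (('m, 'n) chart \<Rightarrow> real ^ 'n \<Rightarrow> real ^ 'n ^ 'n) \<Rightarrow> bool" where
  "bounded_scalar_curvature A g \<longleftrightarrow>
     (\<exists>B. \<forall>c\<in>A. \<forall>x\<in>chart_image c. \<bar>scalar_curvature (g c) x\<bar> \<le> B)"

subsection \<open>Riemannian distance\<close>

(* curve_length A g gamma a b L: the restriction of gamma to [a,b] is a piecewise C^1 curve of
   length L.  The interval is subdivided so that on each piece gamma runs inside one chart domain
   and is C^1 there up to the end points (with one-sided derivatives at these). *)
inductive curve_length ::
  "('m, 'n::finite) chart set \<Rightarrow> (('m, 'n) chart \<Rightarrow> real ^ 'n \<Rightarrow> real ^ 'n ^ 'n) \<Rightarrow>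
   (real \<Rightarrow> 'm) \<Rightarrow> real \<Rightarrow> real \<Rightarrow> real \<Rightarrow> bool"
  for A g \<gamma> where
  point: "curve_length A g \<gamma> a a 0"
| append: "curve_length A g \<gamma> a b L \<Longrightarrow> b < b' \<Longrightarrow> c \<in> A \<Longrightarrow> \<gamma> ` {b..b'} \<subseteq> fst c \<Longrightarrow>
    (\<And>t. t \<in> {b..b'} \<Longrightarrow> ((snd c \<circ> \<gamma>) has_vector_derivative v t) (at t within {b..b'})) \<Longrightarrow>
    continuous_on {b..b'} v \<Longrightarrow>
    curve_length A g \<gamma> a b'
      (L + integral {b..b'} (\<lambda>t. sqrt (v t \<bullet> (g c (snd c (\<gamma> t)) *v v t))))"

definition riemannian_dist ::
  "('m, 'n::finite) chart set \<Rightarrow> (('m, 'n) chart \<Rightarrow> real ^ 'n \<Rightarrow> real ^ 'n ^ 'n) \<Rightarrow>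
   'm \<Rightarrow> 'm \<Rightarrow> real" where
  "riemannian_dist A g p q =
     Inf {L. \<exists>\<gamma> a b. \<gamma> a = p \<and> \<gamma> b = q \<and> curve_length A g \<gamma> a b L}"

definition geodesic_ball ::
  "('m, 'n::finite) chart set \<Rightarrow> (('m, 'n) chart \<Rightarrow> real ^ 'n \<Rightarrow> real ^ 'n ^ 'n) \<Rightarrow>
   'm \<Rightarrow> real \<Rightarrow> 'm set" where
  "geodesic_ball A g p r = Metric_space.mball UNIV (riemannian_dist A g) p r"

definition complete_metric ::
  "('m, 'n::finite) chart set \<Rightarrow> (('m, 'n) chart \<Rightarrow> real ^ 'n \<Rightarrow> real ^ 'n ^ 'n) \<Rightarrow> bool" where
  "complete_metric A g \<longleftrightarrow> Metric_space.mcomplete UNIV (riemannian_dist A g)"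

subsection \<open>Riemannian volume\<close>

(* The unique Borel measure equal to sqrt (det g) dx in every chart. *)
definition riemannian_volume ::
  "('m::topological_space, 'n::finite) chart set \<Rightarrow>
   (('m, 'n) chart \<Rightarrow> real ^ 'n \<Rightarrow> real ^ 'n ^ 'n) \<Rightarrow> 'm measure" where
  "riemannian_volume A g =
     (THE \<mu>. sets \<mu> = sets borel \<and>
       (\<forall>c\<in>A. \<forall>E\<in>sets borel. E \<subseteq> fst c \<longrightarrow>
          emeasure \<mu> E = (\<integral>\<^sup>+x\<in>snd c ` E. ennreal (sqrt (det (g c x))) \<partial>lborel)))"


section \<open>Expanding gradient Ricci solitons\<close>

locale expanding_gradient_ricci_soliton = riemannian_manifold A g
  for A :: "('m::{t2_space, second_countable_topology}, 'n::finite) chart set"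
    and g :: "('m, 'n) chart \<Rightarrow> real ^ 'n \<Rightarrow> real ^ 'n ^ 'n" +
  fixes f :: "'m \<Rightarrow> real"
  assumes potential_smooth: "smooth_function A f"
    and soliton_equation:
      "c \<in> A \<Longrightarrow> x \<in> chart_image c \<Longrightarrow>
        ricci (g c) i j x + hessian (g c) (f \<circ> chart_inv c) i j x = - (1/2) * g c x $ i $ j"

definition proper_function :: "('m::topological_space \<Rightarrow> real) \<Rightarrow> bool" where
  "proper_function f \<longleftrightarrow> (\<forall>K. compact K \<longrightarrow> compact (f -` K))"

end

(* Write |grad f|^2 + R + f = c (Hamilton's identity, a consequence of the contracted second Bianchi
   identity) and u = c - f, so that |grad u|^2 = u - R and Delta u = R + n/2.  With |R| <= B, the
   function u is bounded below and its sublevel sets are compact because f is proper.  For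
   I(s) = integral of (max 0 (s - u))^2, integrating div ((max 0 (s - u))^2 grad u) gives
   (s - B) I'(s) <= (B + n/2 + 2) I(s), so I, and with it the volume of {u <= s}, grows at most
   polynomially in s.  Moreover sqrt (u + B + 1) is 1-Lipschitz, so the ball of radius r about p lies
   in {u <= (a + r)^2}, where a = sqrt (u p + B + 1). *)
theory Submission
  imports Defs
begin

section \<open>Calculus of smooth functions\<close>

text \<open>Squaring the positive part shapes the analysis. The test function is C1 whatever the
  level sets of \<open>u\<close> look like, its integral is differentiable in \<open>s\<close> at
  every \<open>s\<close>, and the factor \<open>2 * max 0 (s - u)\<close> that the chain rule puts
  in front of its gradient is the integrand of that derivative. The summand 2 in the constant is the
  price of replacing \<open>u\<close> by \<open>s - (s - u)\<close> in the gradient term.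

  The geometry is given as coordinate matrices, one field per chart, related by the first order
  transformation law of the metric. Curvature identities are therefore computed inside a single
  chart, with the connection as matrices, and only scalar consequences are globalized. Second order
  quantities are never transformed: two coordinate Laplacians agree because they have the same
  integrals against bump functions.

  Two defined objects give information only after an existence proof. The volume is a definite
  description, so a measure with the chart formula must be constructed and shown to be unique; balls
  are those of a metric space, so the infimum of lengths must first be shown to be a
  distance.\<close>

lemma has_derivative_bilinear_frechet:
  assumes "bounded_bilinear op" "h differentiable (at x)" "k differentiable (at x)"
  shows "((\<lambda>y. op (h y) (k y)) has_derivative
     (\<lambda>v. op (h x) (frechet_derivative k (at x) v) + op (frechet_derivative h (at x) v) (k x))) (at x)"
  by (intro bounded_bilinear.FDERIV[OF assms(1)] frechet_derivative_works[THEN iffD1] assms)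

text \<open>On an open set, agreement on \<open>S\<close> is agreement near each of its points, so
  the two functions have the same Frechet derivatives there and the induction passes to the
  directional derivatives.\<close>

lemma Ck_on_cong:
  assumes "open S" "\<And>x. x \<in> S \<Longrightarrow> h x = k x" "Ck_on n S h"
  shows "Ck_on n S k"
  using assms(2,3)
proof (induction n arbitrary: h k)
  case 0
  then show ?case by (simp cong: continuous_on_cong)
next
  case (Suc n)
  have der: "(k has_derivative frechet_derivative h (at x)) (at x)" if "x \<in> S" for x
  proof (rule has_derivative_transform_within_open[OF _ assms(1) that])
    show "(h has_derivative frechet_derivative h (at x)) (at x)"
      using Suc.prems(2) that frechet_derivative_works by auto
  qed (use Suc.prems in auto)
  have eq: "frechet_derivative h (at x) = frechet_derivative k (at x)" if "x \<in> S" for x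
    using frechet_derivative_at[OF der[OF that]] .
  show ?case
    unfolding Ck_on.simps
  proof (intro conjI ballI allI)
    show "k differentiable at x" if "x \<in> S" for x
      using der[OF that] differentiableI by blast
    show "Ck_on n S (\<lambda>x. frechet_derivative k (at x) v)" for v
      by (rule Suc.IH[of "\<lambda>x. frechet_derivative h (at x) v"]) (use eq Suc.prems in auto)
  qed
qed

text \<open>Calculus rules deliver some derivative \<open>h'\<close>, whereas \<open>Ck_on\<close>
  speaks of the chosen \<open>frechet_derivative\<close>; uniqueness of derivatives identifies the
  two.\<close>

lemma Ck_on_SucI:
  assumes "open S" "\<And>x. x \<in> S \<Longrightarrow> (h has_derivative h' x) (at x)" "\<And>v. Ck_on n S (\<lambda>x. h' x v)"
  shows "Ck_on (Suc n) S h"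
  unfolding Ck_on.simps
proof (intro conjI ballI allI)
  show "h differentiable at x" if "x \<in> S" for x using assms(2) that differentiableI by blast
  show "Ck_on n S (\<lambda>x. frechet_derivative h (at x) v)" for v
    by (rule Ck_on_cong[OF assms(1) _ assms(3)]) (simp add: frechet_derivative_at[OF assms(2), symmetric])
qed

text \<open>The product rule multiplies a derivative of one factor by the other factor itself, which
  must then be usable at the lower order.\<close>

lemma Ck_on_SucD: "Ck_on (Suc n) S h \<Longrightarrow> Ck_on n S h"
proof (induction n arbitrary: h)
  case 0
  then have "\<forall>x\<in>S. isCont h x"
    unfolding Ck_on.simps using differentiable_imp_continuous_within by blast
  then show ?case
    by (simp add: continuous_at_imp_continuous_on)
next
  case (Suc n)
  have 1: "\<And>x. x \<in> S \<Longrightarrow> h differentiable at x"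
    and 2: "\<And>v. Ck_on (Suc n) S (\<lambda>x. frechet_derivative h (at x) v)"
    using Suc.prems by (auto simp only: Ck_on.simps(2)[of "Suc n" S h])
  show ?case
    unfolding Ck_on.simps(2)[of n S h] using 1 Suc.IH[OF 2] by blast
qed

lemma Ck_on_const: "open S \<Longrightarrow> Ck_on n S (\<lambda>x. c)"
proof (induction n arbitrary: c)
  case (Suc n)
  show ?case
    by (rule Ck_on_SucI[where h' = "\<lambda>x v. 0"]) (use Suc in auto)
qed auto

lemma Ck_on_linear:
  assumes "open S" "bounded_linear L" "Ck_on n S h"
  shows "Ck_on n S (\<lambda>x. L (h x))"
  using assms(3)
proof (induction n arbitrary: h)
  case 0
  then show ?case using bounded_linear.continuous_on[OF assms(2)] by auto
next
  case (Suc n)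
  have der: "(h has_derivative frechet_derivative h (at x)) (at x)" if "x \<in> S" for x
    using Suc.prems that frechet_derivative_works by auto
  show ?case
    by (rule Ck_on_SucI[OF assms(1) bounded_linear.has_derivative[OF assms(2) der]])
      (use Suc in auto)
qed

lemma Ck_on_add:
  assumes "open S" "Ck_on n S h" "Ck_on n S k"
  shows "Ck_on n S (\<lambda>x. h x + k x)"
  using assms(2,3)
proof (induction n arbitrary: h k)
  case (Suc n)
  show ?case
    by (rule Ck_on_SucI[OF assms(1) has_derivative_add[OF
          frechet_derivative_works[THEN iffD1] frechet_derivative_works[THEN iffD1]]])
      (use Suc in auto)
qed (auto intro: continuous_intros)

text \<open>One induction serves every bilinear product that occurs: numbers, matrices, a matrix
  applied to a vector, inner products.\<close>

lemma Ck_on_bilinear: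
  assumes "open S" "bounded_bilinear op" "Ck_on n S h" "Ck_on n S k"
  shows "Ck_on n S (\<lambda>x. op (h x) (k x))"
  using assms(3,4)
proof (induction n arbitrary: h k)
  case 0
  then show ?case using bounded_bilinear.continuous_on[OF assms(2)] by auto
next
  case (Suc n)
  show ?case
  proof (rule Ck_on_SucI[OF assms(1) has_derivative_bilinear_frechet[OF assms(2)]])
    show "Ck_on n S (\<lambda>x. op (h x) (frechet_derivative k (at x) v) + op (frechet_derivative h (at x) v) (k x))" for v
      by (intro Ck_on_add Suc.IH assms(1)) (use Suc.prems Ck_on_SucD in auto)
  qed (use Suc.prems in auto)
qed

text \<open>The derivative of the inverse contains the inverse itself, but only with one order of
  differentiability less, which the induction already provides.\<close>

lemma Ck_on_inverse:
  fixes h :: "'a::euclidean_space \<Rightarrow> real"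
  assumes "open S" "\<And>x. x \<in> S \<Longrightarrow> h x \<noteq> 0" "Ck_on n S h"
  shows "Ck_on n S (\<lambda>x. inverse (h x))"
  using assms(3)
proof (induction n)
  case 0
  then show ?case using assms(2) by (auto intro: continuous_on_inverse)
next
  case (Suc n)
  have der: "(h has_derivative frechet_derivative h (at x)) (at x)" if "x \<in> S" for x
    using Suc.prems that frechet_derivative_works by auto
  show ?case
  proof (rule Ck_on_SucI[OF assms(1) Deriv.has_derivative_inverse[OF assms(2) der]])
    have inv: "Ck_on n S (\<lambda>x. inverse (h x))" using Suc Ck_on_SucD by blast
    show "Ck_on n S (\<lambda>x. - (inverse (h x) * frechet_derivative h (at x) v * inverse (h x)))" for v
      by (intro Ck_on_linear[OF assms(1) bounded_linear_minus[OF bounded_linear_ident]]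
          Ck_on_bilinear[OF assms(1) bounded_bilinear_mult] inv) (use Suc.prems in auto)
  qed auto
qed

lemma smooth_on_cong:
  "open S \<Longrightarrow> smooth_on S h \<Longrightarrow> (\<And>x. x \<in> S \<Longrightarrow> h x = k x) \<Longrightarrow> smooth_on S k"
  unfolding smooth_on_def by (blast intro: Ck_on_cong[of S h k])

lemma smooth_on_const: "open S \<Longrightarrow> smooth_on S (\<lambda>x. c)"
  by (simp add: smooth_on_def Ck_on_const)

lemma smooth_on_linear: "open S \<Longrightarrow> bounded_linear L \<Longrightarrow> smooth_on S h \<Longrightarrow> smooth_on S (\<lambda>x. L (h x))"
  by (simp add: smooth_on_def Ck_on_linear)

lemma smooth_on_add: "open S \<Longrightarrow> smooth_on S h \<Longrightarrow> smooth_on S k \<Longrightarrow> smooth_on S (\<lambda>x. h x + k x)"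
  by (simp add: smooth_on_def Ck_on_add)

lemma smooth_on_uminus: "open S \<Longrightarrow> smooth_on S h \<Longrightarrow> smooth_on S (\<lambda>x. - h x)"
  by (rule smooth_on_linear[OF _ bounded_linear_minus[OF bounded_linear_ident]])

lemma smooth_on_diff: "open S \<Longrightarrow> smooth_on S h \<Longrightarrow> smooth_on S k \<Longrightarrow> smooth_on S (\<lambda>x. h x - k x)"
  unfolding diff_conv_add_uminus by (intro smooth_on_add smooth_on_uminus)

lemma smooth_on_bilinear:
  "open S \<Longrightarrow> bounded_bilinear op \<Longrightarrow> smooth_on S h \<Longrightarrow> smooth_on S k \<Longrightarrow> smooth_on S (\<lambda>x. op (h x) (k x))"
  by (simp add: smooth_on_def Ck_on_bilinear)

lemma smooth_on_mult:
  fixes h k :: "'a::euclidean_space \<Rightarrow> real"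
  shows "open S \<Longrightarrow> smooth_on S h \<Longrightarrow> smooth_on S k \<Longrightarrow> smooth_on S (\<lambda>x. h x * k x)"
  by (rule smooth_on_bilinear[OF _ bounded_bilinear_mult])

lemma smooth_on_inverse:
  fixes h :: "'a::euclidean_space \<Rightarrow> real"
  shows "open S \<Longrightarrow> smooth_on S h \<Longrightarrow> (\<And>x. x \<in> S \<Longrightarrow> h x \<noteq> 0) \<Longrightarrow> smooth_on S (\<lambda>x. inverse (h x))"
  by (simp add: smooth_on_def Ck_on_inverse)

lemma smooth_on_sum:
  "open S \<Longrightarrow> (\<And>i. i \<in> I \<Longrightarrow> smooth_on S (h i)) \<Longrightarrow> smooth_on S (\<lambda>x. \<Sum>i\<in>I. h i x)"
  by (induction I rule: infinite_finite_induct) (auto intro: smooth_on_const smooth_on_add)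

lemma smooth_on_prod:
  fixes h :: "'i \<Rightarrow> 'a::euclidean_space \<Rightarrow> real"
  shows "open S \<Longrightarrow> (\<And>i. i \<in> I \<Longrightarrow> smooth_on S (h i)) \<Longrightarrow> smooth_on S (\<lambda>x. \<Prod>i\<in>I. h i x)"
  by (induction I rule: infinite_finite_induct) (auto intro: smooth_on_const smooth_on_mult)

lemma smooth_on_nth: "open S \<Longrightarrow> smooth_on S h \<Longrightarrow> smooth_on S (\<lambda>x. h x $ i)"
  by (rule smooth_on_linear[OF _ bounded_linear_vec_nth])

lemma bounded_linear_axis: "bounded_linear (axis i :: 'b::real_normed_vector \<Rightarrow> 'b ^ 'n::finite)"
  by (rule bounded_linear_intro[where K=1]) (auto simp: vec_eq_iff axis_def norm_vec_def L2_set_def if_distrib[where f=norm] if_distrib[where f="\<lambda>x. x ^ 2"] cong: if_cong)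

lemma vec_eq_sum_axis: "v = (\<Sum>i\<in>UNIV. axis i (v $ i))" for v :: "'b::real_normed_vector ^ 'n::finite"
  by (simp add: vec_eq_iff axis_def)

lemma smooth_on_vec:
  fixes h :: "'a::euclidean_space \<Rightarrow> 'b::real_normed_vector ^ 'n::finite"
  assumes "open S" "\<And>i. smooth_on S (\<lambda>x. h x $ i)"
  shows "smooth_on S h"
proof -
  have "smooth_on S (\<lambda>x. \<Sum>i\<in>UNIV. axis i (h x $ i) :: 'b ^ 'n)"
    by (intro smooth_on_sum smooth_on_linear[OF _ bounded_linear_axis] assms)
  then show ?thesis by (rule smooth_on_cong[OF assms(1)]) (rule vec_eq_sum_axis[symmetric])
qed

lemma smooth_on_differentiable: "smooth_on S h \<Longrightarrow> x \<in> S \<Longrightarrow> h differentiable (at x)"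
  unfolding smooth_on_def using Ck_on.simps(2) by blast

lemma smooth_on_continuous_on: "smooth_on S h \<Longrightarrow> continuous_on S h"
  unfolding smooth_on_def using Ck_on.simps(1) by blast

lemma smooth_on_frechet_derivative:
  "smooth_on S h \<Longrightarrow> smooth_on S (\<lambda>x. frechet_derivative h (at x) v)"
  unfolding smooth_on_def using Ck_on.simps(2) by blast

lemma smooth_on_partial: "smooth_on S h \<Longrightarrow> smooth_on S (partial i h)"
  unfolding partial_def by (rule smooth_on_frechet_derivative)

section \<open>Determinants and inverses of matrix fields\<close>

lemma smooth_on_det:
  fixes M :: "'a::euclidean_space \<Rightarrow> real ^ 'n ^ 'n"
  assumes "open S" "\<And>i j. smooth_on S (\<lambda>x. M x $ i $ j)"
  shows "smooth_on S (\<lambda>x. det (M x))"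
  unfolding det_def by (intro smooth_on_sum smooth_on_mult smooth_on_const smooth_on_prod assms)

lemma matrix_inv_inverse:
  fixes M :: "real ^ 'n ^ 'n"
  assumes "invertible M"
  shows "M ** matrix_inv M = mat 1" and "matrix_inv M ** M = mat 1"
  using someI_ex[of "\<lambda>A'. M ** A' = mat 1 \<and> A' ** M = mat 1"] assms
  unfolding matrix_inv_def invertible_def by blast+

text \<open>Cramer's rule for the equation whose solution is column \<open>l\<close> of the inverse.
  It exhibits the entries of the inverse as rational functions of the entries of \<open>M\<close>,
  whence their smoothness.\<close>

lemma matrix_inv_cramer:
  fixes M :: "real ^ 'n ^ 'n"
  assumes "det M \<noteq> 0"
  shows "matrix_inv M $ k $ l = det (\<chi> i j. if j = k then axis l 1 $ i else M $ i $ j) * inverse (det M)"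
proof -
  have inv: "invertible M" using assms by (simp add: invertible_det_nz)
  have "M *v (matrix_inv M *v axis l 1) = axis l 1"
    by (simp add: matrix_vector_mul_assoc matrix_inv_inverse(1)[OF inv])
  then have "matrix_inv M *v axis l 1 = (\<chi> k. det (\<chi> i j. if j = k then axis l 1 $ i else M $ i $ j) / det M)"
    using cramer[OF assms] by blast
  moreover have "(matrix_inv M *v axis l 1) $ k = matrix_inv M $ k $ l"
    by (simp add: matrix_vector_mult_basis column_def)
  ultimately show ?thesis by (simp add: divide_inverse)
qed

lemma smooth_on_matrix_inv:
  fixes M :: "'a::euclidean_space \<Rightarrow> real ^ 'n ^ 'n"
  assumes "open S" "\<And>i j. smooth_on S (\<lambda>x. M x $ i $ j)" "\<And>x. x \<in> S \<Longrightarrow> det (M x) \<noteq> 0"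
  shows "smooth_on S (\<lambda>x. matrix_inv (M x) $ k $ l)"
proof (rule smooth_on_cong[OF assms(1)])
  show "smooth_on S (\<lambda>x. det (\<chi> i j. if j = k then axis l 1 $ i else M x $ i $ j) * inverse (det (M x)))"
  proof (intro smooth_on_mult smooth_on_inverse smooth_on_det assms(1,3))
    show "smooth_on S (\<lambda>x. (\<chi> i j. if j = k then axis l 1 $ i else M x $ i $ j) $ i $ j)" for i j
      by (cases "j = k") (auto intro: assms smooth_on_const)
  qed (use assms in auto)
qed (simp add: matrix_inv_cramer assms)

section \<open>Rules for partial derivatives\<close>

lemma has_derivative_partial_sum:
  fixes h :: "real ^ 'n::finite \<Rightarrow> 'b::real_normed_vector"
  assumes "h differentiable (at x)"
  shows "(h has_derivative (\<lambda>v. \<Sum>i\<in>UNIV. v $ i *\<^sub>R partial i h x)) (at x)"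
proof -
  have D: "(h has_derivative frechet_derivative h (at x)) (at x)"
    using assms frechet_derivative_works by blast
  then interpret bounded_linear "frechet_derivative h (at x)" using has_derivative_bounded_linear by blast
  have "frechet_derivative h (at x) v = (\<Sum>i\<in>UNIV. v $ i *\<^sub>R partial i h x)" for v
  proof -
    have "frechet_derivative h (at x) v = frechet_derivative h (at x) (\<Sum>i\<in>UNIV. v $ i *\<^sub>R axis i 1)"
      by (simp add: basis_expansion scalar_mult_eq_scaleR[symmetric])
    then show ?thesis by (simp add: sum scaleR partial_def)
  qed
  then show ?thesis by (intro has_derivative_eq_rhs[OF D]) (rule ext)
qed

lemma partial_eqI: "(h has_derivative h') (at x) \<Longrightarrow> partial i h x = h' (axis i 1)"
  by (simp add: partial_def frechet_derivative_at[symmetric])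

text \<open>Functions that agree near \<open>x\<close> have the same set of Frechet derivatives at
  \<open>x\<close>, and \<open>frechet_derivative\<close> chooses from that set; hence this holds
  even where nothing is differentiable.\<close>

lemma partial_cong:
  assumes "open S" "x \<in> S" "\<And>y. y \<in> S \<Longrightarrow> h y = k y"
  shows "partial i h x = partial i k x"
proof -
  have "(h has_derivative D) (at x) \<longleftrightarrow> (k has_derivative D) (at x)" for D
    using assms has_derivative_transform_within_open[of h D x UNIV S k]
      has_derivative_transform_within_open[of k D x UNIV S h] by auto
  then show ?thesis by (simp add: partial_def frechet_derivative_def)
qed

lemma partial_bilinear:
  assumes "bounded_bilinear op" "h differentiable (at x)" "k differentiable (at x)"
  shows "partial i (\<lambda>y. op (h y) (k y)) x = op (h x) (partial i k x) + op (partial i h x) (k x)"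
  unfolding partial_eqI[OF has_derivative_bilinear_frechet[OF assms]] by (simp add: partial_def)

lemma partial_mult:
  fixes h k :: "_ \<Rightarrow> real"
  assumes "h differentiable (at x)" "k differentiable (at x)"
  shows "partial i (\<lambda>y. h y * k y) x = h x * partial i k x + partial i h x * k x"
  by (rule partial_bilinear[OF bounded_bilinear_mult assms])

lemma partial_linear:
  assumes "bounded_linear L" "h differentiable (at x)"
  shows "partial i (\<lambda>y. L (h y)) x = L (partial i h x)"
  using partial_eqI[OF bounded_linear.has_derivative[OF assms(1) frechet_derivative_works[THEN iffD1, OF assms(2)]]]
  by (simp add: partial_def[of i h])

lemma partial_nth: "h differentiable (at x) \<Longrightarrow> partial i (\<lambda>y. h y $ j) x = partial i h x $ j"
  by (rule partial_linear[OF bounded_linear_vec_nth])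

lemma partial_uminus: "h differentiable (at x) \<Longrightarrow> partial i (\<lambda>y. - h y) x = - partial i h x"
  by (rule partial_linear[OF bounded_linear_minus[OF bounded_linear_ident]])

lemma partial_const: "partial i (\<lambda>y. c) x = 0"
  by (rule partial_eqI[where h' = "\<lambda>_. 0", simplified]) simp

lemma partial_add:
  assumes "h differentiable (at x)" "k differentiable (at x)"
  shows "partial i (\<lambda>y. h y + k y) x = partial i h x + partial i k x"
  using partial_eqI[OF has_derivative_add[OF assms[THEN frechet_derivative_works[THEN iffD1]]]]
  by (simp add: partial_def[of i h] partial_def[of i k])

lemma partial_diff:
  assumes "h differentiable (at x)" "k differentiable (at x)"
  shows "partial i (\<lambda>y. h y - k y) x = partial i h x - partial i k x"
  using partial_eqI[OF has_derivative_diff[OF assms[THEN frechet_derivative_works[THEN iffD1]]]]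
  by (simp add: partial_def[of i h] partial_def[of i k])

lemma partial_sum:
  assumes "\<And>j. j \<in> J \<Longrightarrow> h j differentiable (at x)"
  shows "partial i (\<lambda>y. \<Sum>j\<in>J. h j y) x = (\<Sum>j\<in>J. partial i (h j) x)"
proof -
  have "((\<lambda>y. \<Sum>j\<in>J. h j y) has_derivative (\<lambda>v. \<Sum>j\<in>J. frechet_derivative (h j) (at x) v)) (at x)"
    by (intro has_derivative_sum frechet_derivative_works[THEN iffD1] assms)
  from partial_eqI[OF this] show ?thesis by (simp add: partial_def)
qed

section \<open>Mixed partial derivatives and matrix algebra\<close>

lemma has_real_derivative_along_axis:
  fixes k :: "real ^ 'n::finite \<Rightarrow> real"
  assumes "k differentiable (at (p + a *\<^sub>R axis i 1))"
  shows "((\<lambda>a. k (p + a *\<^sub>R axis i 1)) has_real_derivative partial i k (p + a *\<^sub>R axis i 1)) (at a)"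
proof -
  let ?K = "frechet_derivative k (at (p + a *\<^sub>R axis i 1))"
  have "((\<lambda>a. p + a *\<^sub>R axis i (1::real)) has_derivative (\<lambda>h. h *\<^sub>R axis i 1)) (at a)"
    by (auto intro!: derivative_eq_intros)
  then have "((\<lambda>a. k (p + a *\<^sub>R axis i 1)) has_derivative (\<lambda>h. ?K (h *\<^sub>R axis i 1))) (at a)"
    using frechet_derivative_works[THEN iffD1, OF assms] by (rule has_derivative_compose)
  moreover have "?K (h *\<^sub>R axis i 1) = partial i k (p + a *\<^sub>R axis i 1) * h" for h
    using linear_frechet_derivative[OF assms] by (simp add: linear_cmul partial_def)
  ultimately show ?thesis by (simp add: has_field_derivative_def fun_eq_iff)
qed

text \<open>The mean value theorem is applied twice: along axis \<open>i\<close> to a difference of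
  \<open>h\<close> in direction \<open>j\<close>, then along axis \<open>j\<close> to the derivative
  so obtained. The left side is symmetric in \<open>i\<close> and \<open>j\<close>, the form of the
  right side is not.\<close>

lemma second_difference_mean_value:
  fixes h :: "real ^ 'n::finite \<Rightarrow> real"
  assumes "smooth_on S h" "ball x (3 * s) \<subseteq> S" "s > 0"
  obtains y where "y \<in> ball x (3 * s)"
    "h (x + s *\<^sub>R axis i 1 + s *\<^sub>R axis j 1) - h (x + s *\<^sub>R axis i 1) - h (x + s *\<^sub>R axis j 1) + h x
       = s * s * partial j (partial i h) y"
proof -
  \<comment> \<open>All points used lie within \<open>2 * s\<close> of \<open>x\<close>; the radius
    \<open>3 * s\<close> makes the inequality strict.\<close>
  have inb: "x + a *\<^sub>R axis i 1 + b *\<^sub>R axis j 1 \<in> ball x (3 * s)" if "0 \<le> a" "a \<le> s" "0 \<le> b" "b \<le> s" for a b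
  proof -
    have "norm (a *\<^sub>R axis i (1::real) + b *\<^sub>R axis j 1) \<le> a + b"
      using that by (intro norm_triangle_le) simp
    then have "norm (a *\<^sub>R axis i (1::real) + b *\<^sub>R axis j 1) < 3 * s" using that assms(3) by linarith
    moreover have "dist x (x + a *\<^sub>R axis i 1 + b *\<^sub>R axis j 1) = norm (a *\<^sub>R axis i (1::real) + b *\<^sub>R axis j 1)"
      by (simp add: dist_norm norm_minus_commute add.assoc add.commute)
    ultimately show ?thesis by simp
  qed
  have diff: "k differentiable (at (x + a *\<^sub>R axis i 1 + b *\<^sub>R axis j 1))"
    if "smooth_on S k" "0 \<le> a" "a \<le> s" "0 \<le> b" "b \<le> s" for a b and k :: "real ^ 'n \<Rightarrow> real"
    using smooth_on_differentiable[OF that(1)] inb that assms(2) by blast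
  define \<phi> where "\<phi> a = h (x + s *\<^sub>R axis j 1 + a *\<^sub>R axis i 1) - h (x + a *\<^sub>R axis i 1)" for a
  have "(\<phi> has_real_derivative partial i h (x + s *\<^sub>R axis j 1 + a *\<^sub>R axis i 1) - partial i h (x + a *\<^sub>R axis i 1)) (at a)"
    if "0 \<le> a" "a \<le> s" for a
    unfolding \<phi>_def
    using diff[OF assms(1), of a s] diff[OF assms(1), of a 0] that
    by (intro DERIV_diff has_real_derivative_along_axis) (auto simp: algebra_simps)
  then obtain a where a: "0 < a" "a < s"
    "\<phi> s - \<phi> 0 = (s - 0) * (partial i h (x + s *\<^sub>R axis j 1 + a *\<^sub>R axis i 1) - partial i h (x + a *\<^sub>R axis i 1))"
    using MVT2[OF assms(3), of \<phi> "\<lambda>a. partial i h (x + s *\<^sub>R axis j 1 + a *\<^sub>R axis i 1) - partial i h (x + a *\<^sub>R axis i 1)"]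
    by metis
  have "((\<lambda>b. partial i h (x + a *\<^sub>R axis i 1 + b *\<^sub>R axis j 1)) has_real_derivative
      partial j (partial i h) (x + a *\<^sub>R axis i 1 + b *\<^sub>R axis j 1)) (at b)" if "0 \<le> b" "b \<le> s" for b
    by (intro has_real_derivative_along_axis diff smooth_on_partial assms(1)) (use that a in auto)
  then obtain b where b: "0 < b" "b < s"
    "partial i h (x + a *\<^sub>R axis i 1 + s *\<^sub>R axis j 1) - partial i h (x + a *\<^sub>R axis i 1 + 0 *\<^sub>R axis j 1)
      = (s - 0) * partial j (partial i h) (x + a *\<^sub>R axis i 1 + b *\<^sub>R axis j 1)"
    using MVT2[OF assms(3), of "\<lambda>b. partial i h (x + a *\<^sub>R axis i 1 + b *\<^sub>R axis j 1)"
        "\<lambda>b. partial j (partial i h) (x + a *\<^sub>R axis i 1 + b *\<^sub>R axis j 1)"] by metis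
  show thesis
  proof (rule that)
    show "x + a *\<^sub>R axis i 1 + b *\<^sub>R axis j 1 \<in> ball x (3 * s)" using inb a b by auto
  qed (use a(3) b(3) in \<open>simp add: \<phi>_def algebra_simps\<close>)
qed

text \<open>The second difference does not depend on the order of the two directions, so arbitrarily
  close to \<open>x\<close> each mixed derivative takes a value that the other takes as well;
  continuity then forces equality at \<open>x\<close>.\<close>

lemma partial_commute_real:
  fixes h :: "real ^ 'n::finite \<Rightarrow> real"
  assumes "open S" "smooth_on S h" "x \<in> S"
  shows "partial i (partial j h) x = partial j (partial i h) x"
proof (rule ccontr)
  let ?C = "partial i (partial j h)" and ?D = "partial j (partial i h)"
  assume "?C x \<noteq> ?D x"
  define e where "e = \<bar>?C x - ?D x\<bar> / 2"
  have e: "e > 0" using \<open>?C x \<noteq> ?D x\<close> by (simp add: e_def)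
  have cont: "continuous_on S (partial i' (partial j' h))" for i' j'
    by (intro smooth_on_continuous_on smooth_on_partial assms)
  obtain r where r: "r > 0" "ball x r \<subseteq> S" using assms(1,3) openE by blast
  obtain d1 where d1: "d1 > 0" "\<And>y. y \<in> S \<Longrightarrow> dist y x < d1 \<Longrightarrow> dist (?C y) (?C x) < e"
    using cont[unfolded continuous_on_iff] assms(3) e by metis
  obtain d2 where d2: "d2 > 0" "\<And>y. y \<in> S \<Longrightarrow> dist y x < d2 \<Longrightarrow> dist (?D y) (?D x) < e"
    using cont[unfolded continuous_on_iff] assms(3) e by metis
  \<comment> \<open>A third of the smallest radius, since the mean value points are found in the
    ball of radius \<open>3 * s\<close>.\<close>
  define s where "s = Min {r, d1, d2} / 3"
  have s: "s > 0" "3 * s \<le> r" "3 * s \<le> d1" "3 * s \<le> d2" using r d1 d2 by (auto simp: s_def)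
  have sub: "ball x (3 * s) \<subseteq> S" using r s by force
  obtain y where y: "y \<in> ball x (3 * s)"
    "h (x + s *\<^sub>R axis i 1 + s *\<^sub>R axis j 1) - h (x + s *\<^sub>R axis i 1) - h (x + s *\<^sub>R axis j 1) + h x = s * s * ?D y"
    using second_difference_mean_value[OF assms(2) sub s(1)] .
  obtain z where z: "z \<in> ball x (3 * s)"
    "h (x + s *\<^sub>R axis j 1 + s *\<^sub>R axis i 1) - h (x + s *\<^sub>R axis j 1) - h (x + s *\<^sub>R axis i 1) + h x = s * s * ?C z"
    using second_difference_mean_value[OF assms(2) sub s(1)] .
  have "s * s * ?D y = s * s * ?C z" using y(2) z(2) by (simp add: algebra_simps)
  then have "?D y = ?C z" using s by simp
  moreover have "dist (?C z) (?C x) < e" "dist (?D y) (?D x) < e"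
    using y(1) z(1) d1(2)[of z] d2(2)[of y] s sub by (auto simp: dist_commute subset_iff)
  ultimately have "\<bar>?C x - ?D x\<bar> < 2 * e" unfolding dist_real_def by linarith
  then show False by (simp add: e_def)
qed

text \<open>Testing against basis vectors reduces vector and matrix valued functions, such as
  \<open>N\<close> and the connection, to the real case.\<close>

lemma partial_commute:
  fixes h :: "real ^ 'n::finite \<Rightarrow> 'b::euclidean_space"
  assumes "open S" "smooth_on S h" "x \<in> S"
  shows "partial i (partial j h) x = partial j (partial i h) x"
proof (rule euclidean_eqI)
  fix b :: 'b
  have lin: "bounded_linear (\<lambda>v. v \<bullet> b)" by (rule bounded_linear_inner_left)
  have eq: "partial i (partial j h) x \<bullet> b = partial i (partial j (\<lambda>y. h y \<bullet> b)) x" for i j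
  proof -
    have "partial i (partial j (\<lambda>y. h y \<bullet> b)) x = partial i (\<lambda>y. partial j h y \<bullet> b) x"
      by (rule partial_cong[OF assms(1,3)]) (rule partial_linear[OF lin smooth_on_differentiable[OF assms(2)]])
    also have "\<dots> = partial i (partial j h) x \<bullet> b"
      by (rule partial_linear[OF lin smooth_on_differentiable[OF smooth_on_partial[OF assms(2)] assms(3)]])
    finally show ?thesis by simp
  qed
  show "partial i (partial j h) x \<bullet> b = partial j (partial i h) x \<bullet> b"
    unfolding eq by (rule partial_commute_real[OF assms(1) smooth_on_linear[OF assms(1) lin assms(2)] assms(3)])
qed

section \<open>Matrix algebra and positive definite matrices\<close>

lemma matrix_add_rdistrib: "(B + C) ** A = B ** A + C ** A" for A :: "'a::comm_ring_1 ^ 'n ^ 'm"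
  by (simp add: matrix_matrix_mult_def vec_eq_iff distrib_right sum.distrib)

lemma matrix_diff_ldistrib: "A ** (B - C) = A ** B - A ** C" for A :: "'a::comm_ring_1 ^ 'n ^ 'm"
  by (simp add: matrix_matrix_mult_def vec_eq_iff right_diff_distrib sum_subtractf)

lemma matrix_diff_rdistrib: "(B - C) ** A = B ** A - C ** A" for A :: "'a::comm_ring_1 ^ 'n ^ 'm"
  by (simp add: matrix_matrix_mult_def vec_eq_iff left_diff_distrib sum_subtractf)

lemma matrix_minus_left: "(- B) ** A = - (B ** A)" for A :: "'a::comm_ring_1 ^ 'n ^ 'm"
  by (simp add: matrix_matrix_mult_def vec_eq_iff sum_negf)

lemma matrix_minus_right: "A ** (- B) = - (A ** B)" for A :: "'a::comm_ring_1 ^ 'n ^ 'm"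
  by (simp add: matrix_matrix_mult_def vec_eq_iff sum_negf)

lemma matrix_zero_left: "0 ** A = 0" for A :: "'a::comm_ring_1 ^ 'n ^ 'm"
  by (simp add: matrix_matrix_mult_def vec_eq_iff)

lemma matrix_zero_right: "A ** 0 = 0" for A :: "'a::comm_ring_1 ^ 'n ^ 'm"
  by (simp add: matrix_matrix_mult_def vec_eq_iff)

lemma transpose_arith:
  fixes A B :: "'a::comm_ring_1 ^ 'n ^ 'm"
  shows "transpose (A + B) = transpose A + transpose B"
    "transpose (A - B) = transpose A - transpose B"
    "transpose (- A) = - transpose A"
  by (simp_all add: Finite_Cartesian_Product.transpose_def vec_eq_iff)

lemmas matrix_ring_simps = matrix_add_ldistrib matrix_add_rdistrib matrix_diff_ldistrib matrix_diff_rdistrib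
  matrix_minus_left matrix_minus_right matrix_zero_left matrix_zero_right matrix_mul_assoc
  transpose_arith matrix_transpose_mul

lemma bounded_bilinear_matrix_mult:
  "bounded_bilinear ((**) :: real ^ 'n ^ 'm \<Rightarrow> real ^ 'k ^ 'n \<Rightarrow> real ^ 'k ^ 'm)"
  unfolding bilinear_conv_bounded_bilinear[symmetric] bilinear_def
  by (auto intro!: linearI simp: matrix_add_ldistrib matrix_matrix_mult_def vec_eq_iff
      sum.distrib sum_distrib_left algebra_simps)

lemma bounded_bilinear_matrix_vector_mult:
  "bounded_bilinear ((*v) :: real ^ 'n ^ 'm \<Rightarrow> real ^ 'n \<Rightarrow> real ^ 'm)"
  unfolding bilinear_conv_bounded_bilinear[symmetric] bilinear_def
  by (auto intro!: linearI simp: matrix_vector_mult_def vec_eq_iff sum.distrib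
      sum_distrib_left algebra_simps)

lemma bounded_linear_transpose: "bounded_linear (transpose :: real ^ 'n ^ 'm \<Rightarrow> real ^ 'm ^ 'n)"
  by (auto intro!: linearI simp: linear_conv_bounded_linear[symmetric] Finite_Cartesian_Product.transpose_def vec_eq_iff)

lemma transpose_matrix_inv:
  fixes M :: "real ^ 'n ^ 'n"
  assumes "invertible M" "transpose M = M"
  shows "transpose (matrix_inv M) = matrix_inv M"
proof -
  have "transpose (matrix_inv M) ** M = mat 1"
    using arg_cong[OF matrix_inv_inverse(1)[OF assms(1)], of transpose] assms(2)
    by (simp add: matrix_transpose_mul)
  then have "transpose (matrix_inv M) ** M ** matrix_inv M = matrix_inv M" by simp
  then show ?thesis by (simp add: matrix_mul_assoc[symmetric] matrix_inv_inverse[OF assms(1)])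
qed

lemma positive_definite_invertible:
  fixes M :: "real ^ 'n ^ 'n"
  assumes "\<And>v. v \<noteq> 0 \<Longrightarrow> v \<bullet> (M *v v) > 0"
  shows "invertible M"
proof -
  have "v = 0" if "M *v v = 0" for v using assms[of v] that by force
  then show ?thesis
    by (simp add: invertible_left_inverse matrix_left_invertible_ker)
qed

text \<open>The segment from the identity to \<open>M\<close> consists of positive definite, hence
  invertible, matrices; the determinant has no zero along it and keeps the sign it has at the
  identity.\<close>

lemma positive_definite_det_pos:
  fixes M :: "real ^ 'n ^ 'n"
  assumes "\<And>v. v \<noteq> 0 \<Longrightarrow> v \<bullet> (M *v v) > 0"
  shows "det M > 0"
proof (rule ccontr)
  assume neg: "\<not> det M > 0"
  define q where "q t = det ((1 - t) *\<^sub>R mat 1 + t *\<^sub>R M)" for t :: real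
  have "continuous_on {0..1} q" unfolding q_def det_def by (auto intro!: continuous_intros)
  then obtain t where t: "0 \<le> t" "t \<le> 1" "q t = 0"
    using IVT2'[of q 1 0 0] neg by (auto simp: q_def det_I)
  have "v \<bullet> (((1 - t) *\<^sub>R mat 1 + t *\<^sub>R M) *v v) > 0" if "v \<noteq> 0" for v
  proof -
    have eq: "((1 - t) *\<^sub>R mat 1 + t *\<^sub>R M) *v v = (1 - t) *\<^sub>R v + t *\<^sub>R (M *v v)"
      by (simp add: matrix_vector_mult_add_rdistrib scaleR_matrix_vector_assoc[symmetric])
    show ?thesis
    proof (cases "t = 0")
      case False
      then have "t * (v \<bullet> (M *v v)) > 0" using t assms[OF that] by simp
      moreover have "(1 - t) * (v \<bullet> v) \<ge> 0" using t by simp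
      ultimately show ?thesis by (simp add: eq inner_add_right)
    qed (use that eq in simp)
  qed
  from positive_definite_invertible[OF this] t(3) show False
    by (simp add: q_def invertible_det_nz)
qed

section \<open>Curvature identities in a chart\<close>

text \<open>The setting of all local computations: one coordinate domain with a smooth field of
  positive definite matrices, detached from the manifold.\<close>

locale metric_chart =
  fixes S :: "(real ^ 'n::finite) set" and G :: "real ^ 'n \<Rightarrow> real ^ 'n ^ 'n"
  assumes open_S: "open S"
    and smooth_G: "smooth_on S G"
    and sym_G: "x \<in> S \<Longrightarrow> transpose (G x) = G x"
    and pos_G: "x \<in> S \<Longrightarrow> v \<noteq> 0 \<Longrightarrow> v \<bullet> (G x *v v) > 0"
begin

text \<open>The connection is stored as the matrices \<open>\<Gamma>\<^sub>i\<close> with entries \<open>\<Gamma>\<^sup>k\<^sub>i\<^sub>j\<close> (row \<open>k\<close>, column \<open>j\<close>), so that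
  covariant differentiation of a vector field is \<open>\<partial>\<^sub>i + \<Gamma>\<^sub>i\<close> and \<open>Rm i j\<close> is the endomorphism \<open>R(e\<^sub>i, e\<^sub>j)\<close>.\<close>

definition N :: "real ^ 'n \<Rightarrow> real ^ 'n ^ 'n" where "N x = matrix_inv (G x)"

definition \<Gamma> :: "'n \<Rightarrow> real ^ 'n \<Rightarrow> real ^ 'n ^ 'n" where
  "\<Gamma> i x = (\<chi> k j. christoffel G k i j x)"

definition Rm :: "'n \<Rightarrow> 'n \<Rightarrow> real ^ 'n \<Rightarrow> real ^ 'n ^ 'n" where
  "Rm i j x = partial i (\<Gamma> j) x - partial j (\<Gamma> i) x + \<Gamma> i x ** \<Gamma> j x - \<Gamma> j x ** \<Gamma> i x"

lemma invertible_G: "x \<in> S \<Longrightarrow> invertible (G x)"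
  by (rule positive_definite_invertible) (rule pos_G)

lemma det_G_pos: "x \<in> S \<Longrightarrow> det (G x) > 0"
  by (rule positive_definite_det_pos) (rule pos_G)

lemma G_N: "x \<in> S \<Longrightarrow> G x ** N x = mat 1" and N_G: "x \<in> S \<Longrightarrow> N x ** G x = mat 1"
  by (simp_all add: N_def matrix_inv_inverse invertible_G)

lemma sym_N: "x \<in> S \<Longrightarrow> transpose (N x) = N x"
  by (simp add: N_def transpose_matrix_inv invertible_G sym_G)

lemma sym_G_nth: "x \<in> S \<Longrightarrow> G x $ i $ j = G x $ j $ i"
  using arg_cong[OF sym_G, of x "\<lambda>M. M $ j $ i"] by (simp add: transpose_def)

lemma sym_N_nth: "x \<in> S \<Longrightarrow> N x $ i $ j = N x $ j $ i"
  using arg_cong[OF sym_N, of x "\<lambda>M. M $ j $ i"] by (simp add: transpose_def)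

lemma smooth_G_nth: "smooth_on S (\<lambda>x. G x $ i $ j)"
  by (intro smooth_on_nth open_S smooth_G)

lemma smooth_N_nth: "smooth_on S (\<lambda>x. N x $ i $ j)"
  unfolding N_def
  by (rule smooth_on_matrix_inv[OF open_S smooth_G_nth]) (use det_G_pos in force)

lemma smooth_N: "smooth_on S N"
  by (intro smooth_on_vec open_S smooth_N_nth)

lemma smooth_christoffel: "smooth_on S (christoffel G k i j)"
proof -
  have "smooth_on S (\<lambda>x. 1/2 * (\<Sum>l\<in>UNIV. N x $ k $ l *
       (partial i (\<lambda>y. G y $ j $ l) x + partial j (\<lambda>y. G y $ i $ l) x - partial l (\<lambda>y. G y $ i $ j) x)))"
    by (intro smooth_on_mult smooth_on_const smooth_on_sum smooth_on_diff smooth_on_add smooth_on_partial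
        open_S smooth_G_nth smooth_N_nth)
  then show ?thesis by (rule smooth_on_cong[OF open_S]) (simp add: christoffel_def N_def)
qed

lemma smooth_\<Gamma>: "smooth_on S (\<Gamma> i)"
  by (intro smooth_on_vec open_S) (simp add: \<Gamma>_def smooth_christoffel)

lemma smooth_Rm: "smooth_on S (Rm i j)"
  unfolding Rm_def
  by (intro smooth_on_diff smooth_on_add smooth_on_partial smooth_\<Gamma> open_S
      smooth_on_bilinear[OF _ bounded_bilinear_matrix_mult])

lemmas differentiable_S = smooth_on_differentiable[OF smooth_G] smooth_on_differentiable[OF smooth_G_nth]
  smooth_on_differentiable[OF smooth_N] smooth_on_differentiable[OF smooth_N_nth]
  smooth_on_differentiable[OF smooth_\<Gamma>] smooth_on_differentiable[OF smooth_christoffel]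
  smooth_on_differentiable[OF smooth_Rm]

section \<open>The Levi-Civita connection in matrix form\<close>

lemma christoffel_symmetric:
  assumes "x \<in> S"
  shows "christoffel G k i j x = christoffel G k j i x"
proof -
  have "partial l (\<lambda>y. G y $ i $ j) x = partial l (\<lambda>y. G y $ j $ i) x" for l
    by (rule partial_cong[OF open_S assms]) (rule sym_G_nth)
  then show ?thesis by (simp add: christoffel_def add.commute)
qed

lemma \<Gamma>_symmetric: "x \<in> S \<Longrightarrow> \<Gamma> i x $ k $ j = \<Gamma> j x $ k $ i"
  by (simp add: \<Gamma>_def christoffel_symmetric)

text \<open>Parallelism of the metric. Lowering the upper index of \<open>\<Gamma> m\<close> removes
  \<open>N\<close>, and symmetrizing the remaining Christoffel expression leaves only the derivative
  of \<open>G\<close> in direction \<open>m\<close>.\<close>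

lemma metric_compatible:
  assumes "x \<in> S"
  shows "partial m G x = G x ** \<Gamma> m x + transpose (\<Gamma> m x) ** G x"
proof -
  \<comment> \<open>Twice the Christoffel symbols of the first kind.\<close>
  define T where "T = (\<chi> l j. partial m (\<lambda>y. G y $ j $ l) x + partial j (\<lambda>y. G y $ m $ l) x
    - partial l (\<lambda>y. G y $ m $ j) x)"
  have "\<Gamma> m x = (1/2) *\<^sub>R (N x ** T)"
    by (simp add: \<Gamma>_def T_def N_def christoffel_def matrix_matrix_mult_def vec_eq_iff)
  then have G\<Gamma>: "G x ** \<Gamma> m x = (1/2) *\<^sub>R T"
    by (simp add: bounded_bilinear.scaleR_right[OF bounded_bilinear_matrix_mult] matrix_mul_assoc G_N assms)
  have "transpose (\<Gamma> m x) ** G x = transpose (G x ** \<Gamma> m x)"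
    by (simp add: matrix_transpose_mul sym_G assms)
  then have "G x ** \<Gamma> m x + transpose (\<Gamma> m x) ** G x = (1/2) *\<^sub>R (T + transpose T)"
    by (simp add: G\<Gamma> transpose_scalar scaleR_add_right)
  also have "\<dots> = partial m G x"
  proof -
    have "partial m G x $ a $ b = partial m (\<lambda>y. G y $ a $ b) x" for a b
    proof -
      have "partial m (\<lambda>y. G y $ a $ b) x = partial m (\<lambda>y. G y $ a) x $ b"
        by (rule partial_nth[OF smooth_on_differentiable[OF smooth_on_nth[OF open_S smooth_G] assms]])
      then show ?thesis by (simp add: partial_nth differentiable_S assms)
    qed
    moreover have "partial l (\<lambda>y. G y $ i $ j) x = partial l (\<lambda>y. G y $ j $ i) x" for l i j
      by (rule partial_cong[OF open_S assms]) (rule sym_G_nth)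
    then have "T $ a $ b + T $ b $ a = 2 * partial m (\<lambda>y. G y $ a $ b) x" for a b
      by (simp add: T_def)
    ultimately show ?thesis by (simp add: vec_eq_iff transpose_def)
  qed
  finally show ?thesis by simp
qed

text \<open>Parallelism of the inverse metric, obtained by differentiating the constant product of
  \<open>G\<close> and \<open>N\<close>.\<close>

lemma partial_N:
  assumes "x \<in> S"
  shows "partial m N x = - (\<Gamma> m x ** N x + N x ** transpose (\<Gamma> m x))"
proof -
  have "partial m (\<lambda>y. G y ** N y) x = partial m (\<lambda>y. mat 1) x"
    by (rule partial_cong[OF open_S assms]) (rule G_N)
  then have "G x ** partial m N x + partial m G x ** N x = 0"
    by (simp add: partial_const partial_bilinear[OF bounded_bilinear_matrix_mult] differentiable_S assms)
  then have "N x ** (G x ** partial m N x + partial m G x ** N x) = 0"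
    by (simp add: matrix_zero_right)
  then have "partial m N x + (\<Gamma> m x ** N x + N x ** transpose (\<Gamma> m x)) = 0"
    by (simp add: metric_compatible assms matrix_ring_simps N_G)
      (simp add: matrix_mul_assoc[symmetric] G_N assms)
  then show ?thesis by (simp add: add_eq_0_iff2)
qed

text \<open>Since \<open>N\<close> is parallel, the commutator of two covariant derivatives applied
  to it vanishes. This commutator is the action of the curvature on a tensor with two upper indices,
  \<open>Rm ** N + N ** transpose Rm\<close>.\<close>

lemma Rm_N_antisymmetric:
  assumes "x \<in> S"
  shows "transpose (Rm i j x ** N x) = - (Rm i j x ** N x)"
proof -
  have d: "partial i (partial j N) x = - (\<Gamma> j x ** partial i N x + partial i (\<Gamma> j) x ** N x
      + (N x ** transpose (partial i (\<Gamma> j) x) + partial i N x ** transpose (\<Gamma> j x)))" for i j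
  proof -
    have "partial i (partial j N) x = partial i (\<lambda>y. - (\<Gamma> j y ** N y + N y ** transpose (\<Gamma> j y))) x"
      by (rule partial_cong[OF open_S assms]) (rule partial_N)
    also have "\<dots> = - partial i (\<lambda>y. \<Gamma> j y ** N y + N y ** transpose (\<Gamma> j y)) x"
      by (intro partial_uminus smooth_on_differentiable[OF _ assms] smooth_on_add open_S
          smooth_on_bilinear[OF _ bounded_bilinear_matrix_mult] smooth_on_linear[OF _ bounded_linear_transpose]
          smooth_\<Gamma> smooth_N)
    also have "\<dots> = - (partial i (\<lambda>y. \<Gamma> j y ** N y) x + partial i (\<lambda>y. N y ** transpose (\<Gamma> j y)) x)"
      by (intro arg_cong[of _ _ uminus] partial_add smooth_on_differentiable[OF _ assms] open_S
          smooth_on_bilinear[OF _ bounded_bilinear_matrix_mult] smooth_on_linear[OF _ bounded_linear_transpose]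
          smooth_\<Gamma> smooth_N)
    also have "partial i (\<lambda>y. \<Gamma> j y ** N y) x = \<Gamma> j x ** partial i N x + partial i (\<Gamma> j) x ** N x"
      by (intro partial_bilinear[OF bounded_bilinear_matrix_mult] differentiable_S assms)
    also have "partial i (\<lambda>y. N y ** transpose (\<Gamma> j y)) x =
        N x ** partial i (\<lambda>y. transpose (\<Gamma> j y)) x + partial i N x ** transpose (\<Gamma> j x)"
      by (intro partial_bilinear[OF bounded_bilinear_matrix_mult] differentiable_S assms
          smooth_on_differentiable[OF _ assms] smooth_on_linear[OF _ bounded_linear_transpose] open_S smooth_\<Gamma>)
    also have "partial i (\<lambda>y. transpose (\<Gamma> j y)) x = transpose (partial i (\<Gamma> j) x)"
      by (intro partial_linear[OF bounded_linear_transpose] differentiable_S assms)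
    finally show ?thesis .
  qed
  have "partial i (partial j N) x - partial j (partial i N) x = 0"
    by (simp add: partial_commute[OF open_S smooth_N assms, of i j])
  then have "Rm i j x ** N x + N x ** transpose (Rm i j x) = 0"
    unfolding d partial_N[OF assms] Rm_def by (simp add: matrix_ring_simps algebra_simps)
  then show ?thesis by (simp add: matrix_transpose_mul sym_N assms add_eq_0_iff)
qed

section \<open>Bianchi identities\<close>

lemma Rm_swap: "Rm j i x = - Rm i j x"
  by (simp add: Rm_def)

text \<open>Raising the last index of the curvature makes \<open>Sm i j\<close> antisymmetric, and the trace \<open>Pv i\<close>
  below is the Ricci tensor with its second index raised.  In this form the contraction of the second
  Bianchi identity needs no covariant derivatives in the lower indices: by the symmetry of the
  Christoffel symbols their contributions cancel.\<close>

definition Sm :: "'n \<Rightarrow> 'n \<Rightarrow> real ^ 'n \<Rightarrow> real ^ 'n ^ 'n" where "Sm i j x = Rm i j x ** N x"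

lemma smooth_Sm: "smooth_on S (Sm i j)"
  unfolding Sm_def by (intro smooth_on_bilinear[OF _ bounded_bilinear_matrix_mult] smooth_Rm smooth_N open_S)

lemma Sm_antisymmetric: "x \<in> S \<Longrightarrow> Sm i j x $ b $ a = - Sm i j x $ a $ b"
  using arg_cong[OF Rm_N_antisymmetric[of x i j], of "\<lambda>M. M $ a $ b"] by (simp add: Sm_def transpose_def)

lemma Sm_swap: "Sm j i x = - Sm i j x"
  by (simp add: Sm_def Rm_swap[of j i] matrix_minus_left)

text \<open>The covariant derivative with respect to the two upper indices only; \<open>i\<close>
  and \<open>j\<close> are treated as labels of a family of matrices.\<close>

definition DSm :: "'n \<Rightarrow> 'n \<Rightarrow> 'n \<Rightarrow> real ^ 'n \<Rightarrow> real ^ 'n ^ 'n" where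
  "DSm m i j x = partial m (Sm i j) x + \<Gamma> m x ** Sm i j x + Sm i j x ** transpose (\<Gamma> m x)"

lemma partial_Rm:
  assumes "x \<in> S"
  shows "partial m (Rm i j) x = partial m (partial i (\<Gamma> j)) x - partial m (partial j (\<Gamma> i)) x
    + (\<Gamma> i x ** partial m (\<Gamma> j) x + partial m (\<Gamma> i) x ** \<Gamma> j x)
    - (\<Gamma> j x ** partial m (\<Gamma> i) x + partial m (\<Gamma> j) x ** \<Gamma> i x)"
proof -
  note sm = smooth_on_partial[OF smooth_\<Gamma>] smooth_on_diff[OF open_S] smooth_on_add[OF open_S]
    smooth_on_bilinear[OF open_S bounded_bilinear_matrix_mult] smooth_\<Gamma>
  note df = smooth_on_differentiable[OF _ assms]
  have "partial m (Rm i j) x =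
    partial m (\<lambda>y. partial i (\<Gamma> j) y - partial j (\<Gamma> i) y + \<Gamma> i y ** \<Gamma> j y) x - partial m (\<lambda>y. \<Gamma> j y ** \<Gamma> i y) x"
    unfolding Rm_def by (intro partial_diff df sm)
  also have "partial m (\<lambda>y. partial i (\<Gamma> j) y - partial j (\<Gamma> i) y + \<Gamma> i y ** \<Gamma> j y) x
    = partial m (\<lambda>y. partial i (\<Gamma> j) y - partial j (\<Gamma> i) y) x + partial m (\<lambda>y. \<Gamma> i y ** \<Gamma> j y) x"
    by (intro partial_add df sm)
  also have "partial m (\<lambda>y. partial i (\<Gamma> j) y - partial j (\<Gamma> i) y) x
    = partial m (partial i (\<Gamma> j)) x - partial m (partial j (\<Gamma> i)) x"
    by (intro partial_diff df sm)
  finally show ?thesis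
    by (simp add: partial_bilinear[OF bounded_bilinear_matrix_mult] differentiable_S assms)
qed

text \<open>Because \<open>N\<close> is parallel, \<open>DSm\<close> is the commutator derivative of
  the endomorphism \<open>Rm i j\<close> times \<open>N\<close>. For the operators
  \<open>\<partial>\<^sub>i + \<Gamma>\<^sub>i\<close>, whose commutators are the \<open>Rm\<close>,
  the cyclic sum vanishes by the Jacobi identity.\<close>

lemma second_bianchi:
  assumes "x \<in> S"
  shows "DSm m i j x + DSm i j m x + DSm j m i x = 0"
proof -
  have D: "DSm m i j x = (partial m (Rm i j) x + \<Gamma> m x ** Rm i j x - Rm i j x ** \<Gamma> m x) ** N x" for m i j
    unfolding DSm_def Sm_def
    by (simp add: partial_bilinear[OF bounded_bilinear_matrix_mult] differentiable_S assms partial_N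
        matrix_ring_simps algebra_simps)
  have comm: "partial m (partial i (\<Gamma> j)) x = partial i (partial m (\<Gamma> j)) x" for m i j
    by (rule partial_commute[OF open_S smooth_\<Gamma> assms])
  have "(partial m (Rm i j) x + \<Gamma> m x ** Rm i j x - Rm i j x ** \<Gamma> m x)
    + (partial i (Rm j m) x + \<Gamma> i x ** Rm j m x - Rm j m x ** \<Gamma> i x)
    + (partial j (Rm m i) x + \<Gamma> j x ** Rm m i x - Rm m i x ** \<Gamma> j x) = 0"
    unfolding partial_Rm[OF assms] Rm_def
    using comm[of m i j] comm[of m j i] comm[of i j m]
    by (simp add: matrix_ring_simps algebra_simps)
  then show ?thesis
    unfolding D by (simp add: matrix_add_rdistrib[symmetric] matrix_zero_left)
qed

definition Pv :: "'n \<Rightarrow> real ^ 'n \<Rightarrow> real ^ 'n" where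
  "Pv i x = (\<chi> a. \<Sum>j\<in>UNIV. Sm i j x $ a $ j)"

lemma smooth_Sm_nth: "smooth_on S (\<lambda>x. Sm i j x $ a $ b)"
  by (intro smooth_on_nth open_S smooth_Sm)

lemma partial_nth_nth:
  assumes "smooth_on S M" "x \<in> S"
  shows "partial m M x $ a $ b = partial m (\<lambda>y. M y $ a $ b) x"
  using partial_nth[OF smooth_on_differentiable[OF smooth_on_nth[OF open_S assms(1)] assms(2)]]
    partial_nth[OF smooth_on_differentiable[OF assms]] by metis

text \<open>In invariant terms this is \<open>dR = 2 div Ric\<close>. In the traced cyclic sum, up
  to connection terms, the first summand is the derivative of the scalar curvature and the other two
  are each minus the divergence of \<open>Pv m\<close>. The connection terms left over form the last
  sum, the correction for the lower index of the mixed tensor \<open>Pv\<close>.\<close>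

lemma contracted_bianchi:
  assumes "x \<in> S"
  shows "partial m (\<lambda>y. \<Sum>i\<in>UNIV. Pv i y $ i) x =
    2 * (\<Sum>i\<in>UNIV. partial i (\<lambda>y. Pv m y $ i) x
      + (\<Sum>a\<in>UNIV. \<Gamma> i x $ i $ a * Pv m x $ a) - (\<Sum>a\<in>UNIV. \<Gamma> m x $ i $ a * Pv i x $ a))"
proof -
  note df = smooth_on_differentiable[OF _ assms]
  have 1: "(\<Sum>i\<in>UNIV. \<Sum>j\<in>UNIV. DSm m i j x $ i $ j)
    = partial m (\<lambda>y. \<Sum>i\<in>UNIV. Pv i y $ i) x + 2 * (\<Sum>i\<in>UNIV. \<Sum>a\<in>UNIV. \<Gamma> m x $ i $ a * Pv i x $ a)"
  proof -
    have "(\<Sum>i\<in>UNIV. \<Sum>j\<in>UNIV. partial m (Sm i j) x $ i $ j) = partial m (\<lambda>y. \<Sum>i\<in>UNIV. Pv i y $ i) x"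
      by (simp add: Pv_def partial_nth_nth smooth_Sm assms partial_sum df smooth_on_sum open_S smooth_Sm_nth)
    moreover have "(\<Sum>i\<in>UNIV. \<Sum>j\<in>UNIV. (\<Gamma> m x ** Sm i j x) $ i $ j) = (\<Sum>i\<in>UNIV. \<Sum>a\<in>UNIV. \<Gamma> m x $ i $ a * Pv i x $ a)"
    proof (rule sum.cong[OF refl])
      fix i
      show "(\<Sum>j\<in>UNIV. (\<Gamma> m x ** Sm i j x) $ i $ j) = (\<Sum>a\<in>UNIV. \<Gamma> m x $ i $ a * Pv i x $ a)"
        unfolding matrix_matrix_mult_def Pv_def
        by (simp add: sum_distrib_left) (rule sum.swap)
    qed
    moreover have "(\<Sum>i\<in>UNIV. \<Sum>j\<in>UNIV. (Sm i j x ** transpose (\<Gamma> m x)) $ i $ j) = (\<Sum>j\<in>UNIV. \<Sum>a\<in>UNIV. \<Gamma> m x $ j $ a * Pv j x $ a)"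
    proof (subst sum.swap, rule sum.cong[OF refl])
      fix j
      have "Sm i j x $ i $ a = Sm j i x $ a $ i" for i a
        using Sm_antisymmetric[OF assms, of i j i a] Sm_swap[of j i x] by simp
      then show "(\<Sum>i\<in>UNIV. (Sm i j x ** transpose (\<Gamma> m x)) $ i $ j) = (\<Sum>a\<in>UNIV. \<Gamma> m x $ j $ a * Pv j x $ a)"
        unfolding matrix_matrix_mult_def Pv_def transpose_def
        by (simp add: sum_distrib_left mult.commute) (rule sum.swap)
    qed
    ultimately show ?thesis by (simp add: DSm_def sum.distrib)
  qed
  have 2: "(\<Sum>i\<in>UNIV. \<Sum>j\<in>UNIV. DSm i j m x $ i $ j)
    = - (\<Sum>i\<in>UNIV. partial i (\<lambda>y. Pv m y $ i) x + (\<Sum>a\<in>UNIV. \<Gamma> i x $ i $ a * Pv m x $ a))"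
  proof -
    have sw: "Sm j m y = - Sm m j y" for j y by (rule Sm_swap)
    have "(\<Sum>j\<in>UNIV. partial i (Sm j m) x $ i $ j) = - partial i (\<lambda>y. Pv m y $ i) x" for i
    proof -
      have "partial i (Sm j m) x $ i $ j = - partial i (\<lambda>y. Sm m j y $ i $ j) x" for j
      proof -
        have "partial i (Sm j m) x = - partial i (Sm m j) x"
          unfolding sw[abs_def, of j] by (rule partial_uminus) (rule df[OF smooth_Sm])
        then show ?thesis by (simp add: partial_nth_nth smooth_Sm assms)
      qed
      then show ?thesis
        by (simp add: Pv_def partial_sum df smooth_Sm_nth sum_negf)
    qed
    moreover have "(\<Sum>j\<in>UNIV. (\<Gamma> i x ** Sm j m x) $ i $ j) = - (\<Sum>a\<in>UNIV. \<Gamma> i x $ i $ a * Pv m x $ a)" for i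
      unfolding matrix_matrix_mult_def Pv_def sw[of _ x]
      by (simp add: sum_distrib_left sum_negf) (rule sum.swap)
    \<comment> \<open>A matrix antisymmetric in \<open>i\<close> and \<open>a\<close> is contracted
      with Christoffel symbols symmetric in them.\<close>
    moreover have "(\<Sum>i\<in>UNIV. \<Sum>j\<in>UNIV. (Sm j m x ** transpose (\<Gamma> i x)) $ i $ j) = 0"
    proof -
      let ?t = "\<lambda>i j a. Sm j m x $ i $ a * \<Gamma> i x $ j $ a"
      have "(\<Sum>i\<in>UNIV. \<Sum>a\<in>UNIV. ?t i j a) = 0" for j
      proof -
        have "(\<Sum>i\<in>UNIV. \<Sum>a\<in>UNIV. ?t i j a) = (\<Sum>a\<in>UNIV. \<Sum>i\<in>UNIV. ?t i j a)" by (rule sum.swap)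
        also have "\<dots> = (\<Sum>a\<in>UNIV. \<Sum>i\<in>UNIV. - ?t a j i)"
          using Sm_antisymmetric[OF assms, of j m] \<Gamma>_symmetric[OF assms] by (intro sum.cong refl) (metis mult_minus_left)
        finally show ?thesis by (simp add: sum_negf)
      qed
      then have "(\<Sum>j\<in>UNIV. \<Sum>i\<in>UNIV. \<Sum>a\<in>UNIV. ?t i j a) = 0" by simp
      then show ?thesis
        unfolding matrix_matrix_mult_def transpose_def by (subst sum.swap) simp
    qed
    ultimately show ?thesis by (simp add: DSm_def sum.distrib sum_negf sum_subtractf)
  qed
  \<comment> \<open>Exchanging both antisymmetric pairs turns each summand into one of the previous
    sum with \<open>i\<close> and \<open>j\<close> interchanged.\<close>
  have 3: "(\<Sum>i\<in>UNIV. \<Sum>j\<in>UNIV. DSm j m i x $ i $ j) = (\<Sum>i\<in>UNIV. \<Sum>j\<in>UNIV. DSm i j m x $ i $ j)"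
  proof -
    have "DSm j m i x $ i $ j = DSm j i m x $ j $ i" for i j
    proof -
      have s: "Sm m i y = transpose (Sm i m y)" if "y \<in> S" for y
      proof -
        have "Sm m i y $ a $ b = Sm i m y $ b $ a" for a b
          using Sm_antisymmetric[OF that, of i m b a] by (simp add: Sm_swap[of m i y])
        then show ?thesis by (simp add: transpose_def vec_eq_iff)
      qed
      have "partial j (Sm m i) x = partial j (\<lambda>y. transpose (Sm i m y)) x"
        by (rule partial_cong[OF open_S assms s])
      also have "\<dots> = transpose (partial j (Sm i m) x)"
        by (rule partial_linear[OF bounded_linear_transpose df[OF smooth_Sm]])
      finally have "DSm j m i x = transpose (DSm j i m x)"
        unfolding DSm_def s[OF assms] by (simp add: transpose_arith matrix_transpose_mul)
      then show ?thesis by (simp add: transpose_def)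
    qed
    then show ?thesis by (subst sum.swap) simp
  qed
  have "(\<Sum>i\<in>UNIV. \<Sum>j\<in>UNIV. (DSm m i j x + DSm i j m x + DSm j m i x) $ i $ j) = 0"
    by (simp add: second_bianchi assms)
  then have "(\<Sum>i\<in>UNIV. \<Sum>j\<in>UNIV. DSm m i j x $ i $ j) + (\<Sum>i\<in>UNIV. \<Sum>j\<in>UNIV. DSm i j m x $ i $ j)
     + (\<Sum>i\<in>UNIV. \<Sum>j\<in>UNIV. DSm j m i x $ i $ j) = 0"
    by (simp add: sum.distrib)
  then show ?thesis unfolding 3 unfolding 1 2 by (simp add: sum.distrib sum_subtractf algebra_simps)
qed

lemma Rm_riemann: "x \<in> S \<Longrightarrow> Rm i j x $ l $ k = riemann G l i j k x"
  by (simp add: Rm_def riemann_def partial_nth_nth smooth_\<Gamma> matrix_matrix_mult_def sum_subtractf)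
    (simp add: \<Gamma>_def)

lemma ricci_Rm: "x \<in> S \<Longrightarrow> ricci G j k x = (\<Sum>i\<in>UNIV. Rm i j x $ i $ k)"
  by (simp add: ricci_def Rm_riemann)

text \<open>\<open>Pv\<close> contracts the second lower index with the second upper one, whereas
  \<open>ricci\<close> contracts the first lower index with the first upper one; the two
  antisymmetries contribute one sign each, and these cancel.\<close>

lemma Pv_ricci:
  assumes "x \<in> S"
  shows "Pv j x = N x *v (\<chi> k. ricci G j k x)"
proof -
  have "Sm j i x $ a $ i = Sm i j x $ i $ a" for i a
    using Sm_antisymmetric[OF assms, of j i i a] Sm_swap[of i j x] by simp
  then have "Pv j x $ a = (\<Sum>i\<in>UNIV. \<Sum>k\<in>UNIV. Rm i j x $ i $ k * N x $ k $ a)" for a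
    by (simp add: Pv_def Sm_def matrix_matrix_mult_def)
  also have "(\<Sum>i\<in>UNIV. \<Sum>k\<in>UNIV. Rm i j x $ i $ k * N x $ k $ a) = (\<Sum>k\<in>UNIV. \<Sum>i\<in>UNIV. Rm i j x $ i $ k * N x $ k $ a)" for a
    by (rule sum.swap)
  finally show ?thesis
    by (simp add: vec_eq_iff matrix_vector_mult_def ricci_Rm assms sum_distrib_left sym_N_nth[OF assms] mult.commute)
qed

lemma scalar_curvature_Pv: "x \<in> S \<Longrightarrow> scalar_curvature G x = (\<Sum>i\<in>UNIV. Pv i x $ i)"
  by (simp add: Pv_ricci scalar_curvature_def matrix_vector_mult_def N_def)

end

section \<open>Hamilton's identity and the Laplacian in a chart\<close>

text \<open>Jacobi's formula in the normalized case \<open>M x = mat 1\<close>, to which an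
  invertible field is reduced by multiplying it with the inverse of its value at
  \<open>x\<close>.\<close>

lemma partial_det_identity:
  fixes M :: "real ^ 'n::finite \<Rightarrow> real ^ 'k ^ 'k"
  assumes "M x = mat 1" "\<And>i j. (\<lambda>y. M y $ i $ j) differentiable (at x)"
  shows "partial m (\<lambda>y. det (M y)) x = (\<Sum>i\<in>UNIV. partial m (\<lambda>y. M y $ i $ i) x)"
proof -
  let ?P = "{p. p permutes (UNIV :: 'k set)}"
  define D where "D i j = frechet_derivative (\<lambda>y. M y $ i $ j) (at x)" for i j
  have der: "((\<lambda>y. M y $ i $ j) has_derivative D i j) (at x)" for i j
    unfolding D_def by (rule frechet_derivative_works[THEN iffD1, OF assms(2)])
  have "((\<lambda>y. det (M y)) has_derivative
      (\<lambda>v. \<Sum>p\<in>?P. of_int (sign p) * (\<Sum>i\<in>UNIV. D i (p i) v * (\<Prod>j\<in>UNIV - {i}. M x $ j $ p j)))) (at x)"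
    unfolding det_def by (intro has_derivative_sum has_derivative_mult_right has_derivative_prod der)
  moreover have "(\<Sum>p\<in>?P. of_int (sign p) * (\<Sum>i\<in>UNIV. D i (p i) v * (\<Prod>j\<in>UNIV - {i}. M x $ j $ p j)))
      = (\<Sum>i\<in>UNIV. D i i v)" for v
  proof -
    \<comment> \<open>a permutation other than the identity moves at least two points, so a zero factor survives\<close>
    have zero: "(\<Prod>j\<in>UNIV - {i}. M x $ j $ p j) = 0" if p: "p \<in> ?P" "p \<noteq> id" for p i
    proof -
      obtain j where j: "p j \<noteq> j" using p(2) by (auto simp: fun_eq_iff)
      then have "p (p j) \<noteq> p j" using permutes_inj[of p UNIV] p(1) by (auto dest: injD)
      then obtain k where "k \<noteq> i" "p k \<noteq> k" using j by metis
      then have "M x $ k $ p k = 0" "k \<in> UNIV - {i}" by (auto simp: assms(1) mat_def)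
      then show ?thesis by (meson finite prod_zero)
    qed
    have "(\<Sum>p\<in>?P. of_int (sign p) * (\<Sum>i\<in>UNIV. D i (p i) v * (\<Prod>j\<in>UNIV - {i}. M x $ j $ p j)))
      = (\<Sum>p\<in>{id}. of_int (sign p) * (\<Sum>i\<in>UNIV. D i (p i) v * (\<Prod>j\<in>UNIV - {i}. M x $ j $ p j)))"
      by (rule sum.mono_neutral_right) (auto simp: zero permutes_id finite_permutations)
    then show ?thesis by (simp add: assms(1) mat_def)
  qed
  ultimately have "((\<lambda>y. det (M y)) has_derivative (\<lambda>v. \<Sum>i\<in>UNIV. D i i v)) (at x)" by simp
  from partial_eqI[OF this] show ?thesis by (simp add: partial_def D_def)
qed

lemma matrix_vector_mult_minus: "(- A) *v x = - (A *v x)" for A :: "'a::comm_ring_1 ^ 'n ^ 'm"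
  by (simp add: matrix_vector_mult_def vec_eq_iff sum_negf)

lemma differentiable_nth: "h differentiable (at x) \<Longrightarrow> (\<lambda>y. h y $ i) differentiable (at x)"
  unfolding differentiable_def using bounded_linear.has_derivative[OF bounded_linear_vec_nth] by blast

context metric_chart
begin

definition df :: "(real ^ 'n \<Rightarrow> real) \<Rightarrow> real ^ 'n \<Rightarrow> real ^ 'n" where
  "df F x = (\<chi> b. partial b F x)"

definition grad :: "(real ^ 'n \<Rightarrow> real) \<Rightarrow> real ^ 'n \<Rightarrow> real ^ 'n" where
  "grad F x = N x *v df F x"

text \<open>\<open>Hv F m\<close> is the covariant derivative of the gradient in direction \<open>m\<close>, that is, the Hessian with
  its second index raised.\<close>

definition Hv :: "(real ^ 'n \<Rightarrow> real) \<Rightarrow> 'n \<Rightarrow> real ^ 'n \<Rightarrow> real ^ 'n" where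
  "Hv F m x = partial m (grad F) x + \<Gamma> m x *v grad F x"

definition lap :: "(real ^ 'n \<Rightarrow> real) \<Rightarrow> real ^ 'n \<Rightarrow> real" where
  "lap F x = (\<Sum>i\<in>UNIV. Hv F i x $ i)"

definition vol :: "real ^ 'n \<Rightarrow> real" where
  "vol x = sqrt (det (G x))"

lemma smooth_df: "smooth_on S F \<Longrightarrow> smooth_on S (df F)"
  unfolding df_def by (intro smooth_on_vec open_S) (simp add: smooth_on_partial)

lemma smooth_grad: "smooth_on S F \<Longrightarrow> smooth_on S (grad F)"
  unfolding grad_def by (intro smooth_on_bilinear[OF _ bounded_bilinear_matrix_vector_mult] open_S smooth_N smooth_df)

lemma smooth_Hv: "smooth_on S F \<Longrightarrow> smooth_on S (Hv F m)"
  unfolding Hv_def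
  by (intro smooth_on_add smooth_on_bilinear[OF _ bounded_bilinear_matrix_vector_mult] open_S smooth_\<Gamma> smooth_grad smooth_on_partial)

lemma smooth_lap: "smooth_on S F \<Longrightarrow> smooth_on S (lap F)"
  unfolding lap_def by (intro smooth_on_sum smooth_on_nth smooth_Hv open_S)

lemma partial_df:
  assumes "smooth_on S F" "x \<in> S"
  shows "partial m (df F) x = (\<chi> k. hessian G F m k x) + transpose (\<Gamma> m x) *v df F x"
proof -
  have "partial m (df F) x $ k = partial m (\<lambda>y. df F y $ k) x" for k
    by (rule partial_nth[symmetric, OF smooth_on_differentiable[OF smooth_df[OF assms(1)] assms(2)]])
  then show ?thesis
    by (simp add: vec_eq_iff df_def hessian_def \<Gamma>_def vector_matrix_mult_def transpose_matrix_vector mult.commute)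
qed

text \<open>Since \<open>N\<close> is parallel, raising an index commutes with covariant
  differentiation: the transposed connection terms cancel, and the remaining one is the connection
  term of \<open>Hv\<close>.\<close>

lemma N_hessian:
  assumes "smooth_on S F" "x \<in> S"
  shows "N x *v (\<chi> k. hessian G F m k x) = Hv F m x"
proof -
  have "partial m (grad F) x = N x *v partial m (df F) x + partial m N x *v df F x"
    unfolding grad_def
    by (rule partial_bilinear[OF bounded_bilinear_matrix_vector_mult])
      (intro differentiable_S smooth_on_differentiable[OF smooth_df] assms)+
  then show ?thesis
    by (simp add: Hv_def partial_df[OF assms] partial_N[OF assms(2)] grad_def matrix_vector_right_distrib
        matrix_vector_mult_add_rdistrib matrix_vector_mult_diff_rdistrib matrix_vector_mult_minus matrix_vector_mul_assoc
        del: transpose_matrix_vector)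
qed

text \<open>The commutator of \<open>\<partial>\<^sub>i + \<Gamma>\<^sub>i\<close> and
  \<open>\<partial>\<^sub>m + \<Gamma>\<^sub>m\<close> applied to the gradient field; all
  derivatives of the field cancel and the curvature remains.\<close>

lemma ricci_identity:
  assumes "smooth_on S F" "x \<in> S"
  shows "partial i (Hv F m) x + \<Gamma> i x *v Hv F m x - (partial m (Hv F i) x + \<Gamma> m x *v Hv F i x)
    = Rm i m x *v grad F x"
proof -
  note df = smooth_on_differentiable[OF _ assms(2)]
  have d: "partial i (Hv F m) x = partial i (partial m (grad F)) x
     + (\<Gamma> m x *v partial i (grad F) x + partial i (\<Gamma> m) x *v grad F x)" for i m
  proof -
    have "partial i (Hv F m) x = partial i (partial m (grad F)) x + partial i (\<lambda>y. \<Gamma> m y *v grad F y) x"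
      unfolding Hv_def
      by (intro partial_add df smooth_on_partial smooth_grad assms smooth_\<Gamma>
          smooth_on_bilinear[OF open_S bounded_bilinear_matrix_vector_mult])
    also have "partial i (\<lambda>y. \<Gamma> m y *v grad F y) x = \<Gamma> m x *v partial i (grad F) x + partial i (\<Gamma> m) x *v grad F x"
      by (intro partial_bilinear[OF bounded_bilinear_matrix_vector_mult] df smooth_grad assms smooth_\<Gamma>)
    finally show ?thesis .
  qed
  show ?thesis
    unfolding d Rm_def Hv_def partial_commute[OF open_S smooth_grad[OF assms(1)] assms(2), of i m]
    by (simp add: matrix_vector_right_distrib matrix_vector_mult_add_rdistrib matrix_vector_mult_diff_rdistrib
        matrix_vector_mul_assoc algebra_simps)
qed

lemma G_grad: "x \<in> S \<Longrightarrow> G x *v grad F x = df F x"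
  by (simp add: grad_def matrix_vector_mul_assoc G_N)

text \<open>The connection terms coming from \<open>df\<close> and from \<open>grad\<close> are
  adjoint to each other and cancel.\<close>

lemma partial_gradient_norm:
  assumes "smooth_on S F" "x \<in> S"
  shows "partial m (\<lambda>y. df F y \<bullet> grad F y) x = 2 * ((\<chi> k. hessian G F m k x) \<bullet> grad F x)"
proof -
  let ?h = "(\<chi> k. hessian G F m k x) :: real ^ 'n"
  have 1: "partial m (\<lambda>y. df F y \<bullet> grad F y) x = df F x \<bullet> partial m (grad F) x + partial m (df F) x \<bullet> grad F x"
    by (rule partial_bilinear[OF bounded_bilinear_inner])
      (intro smooth_on_differentiable[OF _ assms(2)] smooth_df smooth_grad assms)+
  have 2: "partial m (grad F) x = N x *v ?h - \<Gamma> m x *v grad F x"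
    using N_hessian[OF assms] by (simp add: Hv_def)
  have "df F x \<bullet> (N x *v ?h) = ?h \<bullet> grad F x"
    unfolding grad_def
    by (metis dot_lmul_matrix inner_commute sym_N[OF assms(2)] transpose_matrix_vector)
  moreover have "(transpose (\<Gamma> m x) *v df F x) \<bullet> grad F x = df F x \<bullet> (\<Gamma> m x *v grad F x)"
    by (simp add: dot_lmul_matrix)
  ultimately show ?thesis
    unfolding 1 2 partial_df[OF assms] by (simp only: inner_diff_right inner_add_left)
qed

text \<open>Multiplication by \<open>N\<close> raises the second index of the soliton equation: the
  metric becomes the identity, Ricci and Hessian become \<open>Pv\<close> and \<open>Hv\<close>.
  This is the form that fits the contracted Bianchi identity.\<close>

lemma soliton_traceless:
  assumes "smooth_on S F" "x \<in> S"
    and sol: "\<And>i j. ricci G i j x + hessian G F i j x = - (1/2) * G x $ i $ j"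
  shows "Pv i x = - (1/2) *\<^sub>R axis i 1 - Hv F i x"
proof -
  have "(\<chi> k. ricci G i k x) + (\<chi> k. hessian G F i k x) = G x *v (- (1/2) *\<^sub>R axis i 1)"
    unfolding matrix_vector_mult_scaleR
    using sol sym_G_nth[OF assms(2)] by (simp add: vec_eq_iff matrix_vector_mult_basis column_def)
  then have "N x *v ((\<chi> k. ricci G i k x) + (\<chi> k. hessian G F i k x)) = N x *v (G x *v (- (1/2) *\<^sub>R axis i 1))"
    by simp
  then show ?thesis
    by (simp add: matrix_vector_right_distrib Pv_ricci[OF assms(2)] N_hessian[OF assms(1,2)]
        matrix_vector_mul_assoc N_G assms eq_diff_eq)
qed

lemma soliton_trace:
  assumes "smooth_on S F" "x \<in> S"
    and sol: "\<And>i j. ricci G i j x + hessian G F i j x = - (1/2) * G x $ i $ j"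
  shows "scalar_curvature G x = - real CARD('n) / 2 - lap F x"
  by (simp add: scalar_curvature_Pv assms(2) soliton_traceless[OF assms] lap_def sum_subtractf axis_def sum_negf)

text \<open>The derivative of the scalar curvature \<open>R\<close> is computed twice. The traced
  soliton equation gives \<open>dR = - d(lap F)\<close>; the contracted Bianchi identity gives
  \<open>dR = - 2 * (d(lap F) + Ric(grad F))\<close>. Together \<open>dR = 2 * Ric(grad F)\<close>,
  and contracting the soliton equation with \<open>grad F\<close> turns this into minus the
  derivative of the other two terms.\<close>

lemma hamilton_identity:
  assumes F: "smooth_on S F" and x: "x \<in> S"
    and sol: "\<And>y i j. y \<in> S \<Longrightarrow> ricci G i j y + hessian G F i j y = - (1/2) * G y $ i $ j"
  shows "partial m (\<lambda>y. scalar_curvature G y + df F y \<bullet> grad F y + F y) x = 0"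
proof -
  note df = smooth_on_differentiable[OF _ x]
  define X where "X = grad F x"
  define r where "r = (\<chi> k. ricci G m k x) \<bullet> X"
  let ?L = "partial m (lap F) x"
  have scal: "scalar_curvature G y = - real CARD('n) / 2 - lap F y" if "y \<in> S" for y
    by (rule soliton_trace[OF F that sol[OF that]])
  have dscal: "partial m (scalar_curvature G) x = - ?L"
  proof -
    have "partial m (scalar_curvature G) x = partial m (\<lambda>y. - real CARD('n) / 2 - lap F y) x"
      by (rule partial_cong[OF open_S x scal])
    also have "\<dots> = partial m (\<lambda>y. - real CARD('n) / 2) x - ?L"
      by (intro partial_diff df smooth_lap F smooth_on_const open_S)
    finally show ?thesis by (simp add: partial_const)
  qed
  have dPv: "partial i (\<lambda>y. Pv m y $ i) x = - partial i (Hv F m) x $ i" for i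
  proof -
    have "partial i (\<lambda>y. Pv m y $ i) x = partial i (\<lambda>y. (- (1/2) *\<^sub>R axis m 1) $ i - Hv F m y $ i) x"
      by (rule partial_cong[OF open_S x]) (simp add: soliton_traceless[OF F _ sol])
    also have "\<dots> = partial i (\<lambda>y. (- (1/2) *\<^sub>R axis m 1 :: real ^ 'n) $ i) x - partial i (\<lambda>y. Hv F m y $ i) x"
      by (intro partial_diff df smooth_on_nth smooth_Hv F open_S smooth_on_const)
    finally show ?thesis by (simp add: partial_const partial_nth[OF df[OF smooth_Hv[OF F]]])
  qed
  have "partial m (scalar_curvature G) x = partial m (\<lambda>y. \<Sum>i\<in>UNIV. Pv i y $ i) x"
    by (rule partial_cong[OF open_S x]) (rule scalar_curvature_Pv)
  also have "\<dots> = 2 * (\<Sum>i\<in>UNIV. partial i (\<lambda>y. Pv m y $ i) x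
      + (\<Sum>a\<in>UNIV. \<Gamma> i x $ i $ a * Pv m x $ a) - (\<Sum>a\<in>UNIV. \<Gamma> m x $ i $ a * Pv i x $ a))"
    by (rule contracted_bianchi[OF x])
  also have "\<dots> = 2 * (\<Sum>i\<in>UNIV. - partial i (Hv F m) x $ i
      - (\<Sum>a\<in>UNIV. \<Gamma> i x $ i $ a * Hv F m x $ a) + (\<Sum>a\<in>UNIV. \<Gamma> m x $ i $ a * Hv F i x $ a))"
  proof -
    have "Pv i x $ a = (if a = i then - (1/2) else 0) - Hv F i x $ a" for i a
      by (simp add: soliton_traceless[OF F x sol[OF x]] axis_def)
    moreover have "(\<Sum>a\<in>UNIV. w a * (if a = i then - (1/2) else 0)) = - w i / 2" for w :: "'n \<Rightarrow> real" and i
      by (subst sum.remove[of UNIV i]) simp_all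
    ultimately have "(\<Sum>a\<in>UNIV. w a * Pv i x $ a) = - w i / 2 - (\<Sum>a\<in>UNIV. w a * Hv F i x $ a)" for w :: "'n \<Rightarrow> real" and i
      by (simp only: right_diff_distrib sum_subtractf)
    then show ?thesis by (simp add: dPv \<Gamma>_symmetric[OF x, of m]) (rule sum.cong, simp_all)
  qed
  \<comment> \<open>Tracing the Ricci identity exchanges the divergence of the Hessian for the
    derivative of the Laplacian plus a Ricci term.\<close>
  also have "\<dots> = - 2 * (?L + r)"
  proof -
    have "(\<Sum>i\<in>UNIV. (partial i (Hv F m) x + \<Gamma> i x *v Hv F m x - (partial m (Hv F i) x + \<Gamma> m x *v Hv F i x)) $ i)
      = (\<Sum>i\<in>UNIV. (Rm i m x *v X) $ i)"
      by (simp only: ricci_identity[OF F x] X_def)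
    also have "\<dots> = r"
      unfolding r_def inner_vec_def matrix_vector_mult_def
      by (simp add: ricci_Rm x sum_distrib_right) (rule sum.swap)
    finally have "(\<Sum>i\<in>UNIV. partial i (Hv F m) x $ i) + (\<Sum>i\<in>UNIV. (\<Sum>a\<in>UNIV. \<Gamma> i x $ i $ a * Hv F m x $ a))
       - (\<Sum>i\<in>UNIV. partial m (Hv F i) x $ i) - (\<Sum>i\<in>UNIV. (\<Sum>a\<in>UNIV. \<Gamma> m x $ i $ a * Hv F i x $ a)) = r"
      by (simp add: sum.distrib sum_subtractf matrix_vector_mult_def)
    moreover have "?L = (\<Sum>i\<in>UNIV. partial m (Hv F i) x $ i)"
      unfolding lap_def
      by (simp add: partial_sum df smooth_on_nth[OF open_S smooth_Hv[OF F]] partial_nth[OF df[OF smooth_Hv[OF F]]])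
    ultimately show ?thesis by (simp add: sum.distrib sum_subtractf sum_negf algebra_simps)
  qed
  finally have R: "partial m (scalar_curvature G) x = 2 * r" using dscal by simp
  have "(\<chi> k. ricci G m k x) = - (\<chi> k. hessian G F m k x) - (1/2) *\<^sub>R (G x $ m)"
  proof -
    have "ricci G m k x = - hessian G F m k x - (1/2) * G x $ m $ k" for k
      using sol[OF x, of m k] by linarith
    then show ?thesis by (simp add: vec_eq_iff)
  qed
  then have "r = - ((\<chi> k. hessian G F m k x) \<bullet> X) - (1/2) * (G x $ m \<bullet> X)"
    unfolding r_def by (simp only: inner_diff_left inner_minus_left inner_scaleR_left)
  moreover have "G x $ m \<bullet> X = partial m F x"
    using arg_cong[OF G_grad[OF x, of F], of "\<lambda>v. v $ m"]
    by (simp add: matrix_vector_mult_def inner_vec_def df_def X_def)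
  moreover have "partial m (\<lambda>y. scalar_curvature G y + df F y \<bullet> grad F y + F y) x
    = partial m (scalar_curvature G) x + partial m (\<lambda>y. df F y \<bullet> grad F y) x + partial m F x"
  proof -
    have s: "smooth_on S (scalar_curvature G)"
      by (rule smooth_on_cong[OF open_S smooth_on_diff[OF open_S smooth_on_const[OF open_S] smooth_lap[OF F]]])
        (simp add: scal)
    have n: "smooth_on S (\<lambda>y. df F y \<bullet> grad F y)"
      by (intro smooth_on_bilinear[OF open_S bounded_bilinear_inner] smooth_df smooth_grad F)
    show ?thesis
      by (simp add: partial_add df s n F smooth_on_add open_S)
  qed
  ultimately show ?thesis using R partial_gradient_norm[OF F x, of m] by (simp add: X_def)
qed

section \<open>Volume density and divergence\<close>

lemma smooth_det_G: "smooth_on S (\<lambda>y. det (G y))"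
  by (intro smooth_on_det open_S smooth_G_nth)

text \<open>After normalization by the constant matrix \<open>N x\<close> the derivative is the
  trace of \<open>N x ** partial m G x\<close>; metric compatibility splits it into two equal traces
  of \<open>\<Gamma> m\<close>.\<close>

lemma partial_det_G:
  assumes "x \<in> S"
  shows "partial m (\<lambda>y. det (G y)) x = 2 * det (G x) * (\<Sum>k\<in>UNIV. \<Gamma> m x $ k $ k)"
proof -
  let ?M = "\<lambda>y. N x ** G y"
  have dM: "?M differentiable (at x)"
    by (rule smooth_on_differentiable[OF smooth_on_bilinear[OF open_S bounded_bilinear_matrix_mult smooth_on_const[OF open_S] smooth_G] assms])
  have dMn: "(\<lambda>y. ?M y $ i) differentiable (at x)" "(\<lambda>y. ?M y $ i $ j) differentiable (at x)" for i j
    using differentiable_nth[OF dM] differentiable_nth[OF differentiable_nth[OF dM]] by simp_all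
  have "det (G x) * det (N x) = 1"
    using arg_cong[OF G_N[OF assms], of det] by (simp add: det_mul)
  then have eq: "det (G y) = det (G x) * det (?M y)" for y by (simp add: det_mul mult.assoc[symmetric])
  have "partial m (\<lambda>y. det (G y)) x = partial m (\<lambda>y. det (G x) * det (?M y)) x"
    by (intro arg_cong[where f = "\<lambda>h. partial m h x"] ext eq)
  also have "\<dots> = det (G x) * partial m (\<lambda>y. det (?M y)) x"
  proof (rule partial_linear[OF bounded_linear_mult_right])
    have "smooth_on S (\<lambda>y. det (?M y))"
      by (intro smooth_on_det smooth_on_nth open_S smooth_on_bilinear[OF open_S bounded_bilinear_matrix_mult] smooth_on_const smooth_G)
    then show "(\<lambda>y. det (?M y)) differentiable (at x)" using assms smooth_on_differentiable by blast
  qed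
  also have "partial m (\<lambda>y. det (?M y)) x = (\<Sum>i\<in>UNIV. partial m (\<lambda>y. ?M y $ i $ i) x)"
    by (rule partial_det_identity) (use N_G assms dMn in auto)
  also have "\<dots> = (\<Sum>i\<in>UNIV. (N x ** partial m G x) $ i $ i)"
  proof (rule sum.cong[OF refl])
    fix i
    have "partial m ?M x = N x ** partial m G x"
      using partial_bilinear[OF bounded_bilinear_matrix_mult, of "\<lambda>y. N x" x G m]
      by (simp add: differentiable_S assms partial_const matrix_zero_left)
    then show "partial m (\<lambda>y. ?M y $ i $ i) x = (N x ** partial m G x) $ i $ i"
      by (simp only: partial_nth[OF dMn(1)] partial_nth[OF dM])
  qed
  also have "\<dots> = 2 * (\<Sum>k\<in>UNIV. \<Gamma> m x $ k $ k)"
  proof -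
    have "(\<Sum>i\<in>UNIV. (N x ** (transpose (\<Gamma> m x) ** G x)) $ i $ i) = trace ((transpose (\<Gamma> m x) ** G x) ** N x)"
      unfolding trace_def[symmetric] by (rule trace_mul_sym)
    also have "\<dots> = (\<Sum>k\<in>UNIV. \<Gamma> m x $ k $ k)"
      by (simp add: matrix_mul_assoc[symmetric] G_N assms trace_def transpose_def)
    finally show ?thesis
      by (simp add: metric_compatible assms matrix_add_ldistrib sum.distrib)
        (simp add: matrix_mul_assoc N_G assms)
  qed
  finally show ?thesis by simp
qed

lemma vol_has_derivative:
  assumes "x \<in> S"
  shows "(vol has_derivative (\<lambda>v. frechet_derivative (\<lambda>y. det (G y)) (at x) v / (2 * vol x))) (at x)"
proof -
  have "((\<lambda>y. det (G y)) has_derivative frechet_derivative (\<lambda>y. det (G y)) (at x)) (at x)"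
    using smooth_on_differentiable[OF smooth_det_G assms] frechet_derivative_works by blast
  from has_derivative_real_sqrt[OF det_G_pos[OF assms] this]
  show ?thesis unfolding vol_def by (simp add: field_simps)
qed

lemma partial_vol: "x \<in> S \<Longrightarrow> partial m vol x = vol x * (\<Sum>k\<in>UNIV. \<Gamma> m x $ k $ k)"
  using partial_eqI[OF vol_has_derivative] partial_det_G[of x m] det_G_pos[of x]
  by (simp add: partial_def vol_def field_simps)

text \<open>The derivative of the density contributes
  \<open>\<Gamma>\<^sup>k\<^sub>i\<^sub>k\<close>, which by symmetry of the connection is the
  contraction contained in the trace of \<open>Hv\<close>.\<close>

lemma divergence_formula:
  assumes "smooth_on S F" "x \<in> S"
  shows "(\<Sum>i\<in>UNIV. partial i (\<lambda>y. vol y * grad F y $ i) x) = vol x * lap F x"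
proof -
  have "partial i (\<lambda>y. vol y * grad F y $ i) x = vol x * partial i (grad F) x $ i + vol x * (\<Sum>k\<in>UNIV. \<Gamma> i x $ k $ k) * grad F x $ i" for i
  proof -
    have d: "grad F differentiable (at x)" "vol differentiable (at x)"
      using smooth_on_differentiable[OF smooth_grad[OF assms(1)] assms(2)] differentiableI[OF vol_has_derivative[OF assms(2)]] by auto
    then have "(\<lambda>y. grad F y $ i) differentiable (at x)"
      using differentiable_nth by blast
    then show ?thesis by (simp add: partial_mult d partial_vol assms partial_nth)
  qed
  then have "(\<Sum>i\<in>UNIV. partial i (\<lambda>y. vol y * grad F y $ i) x)
    = vol x * ((\<Sum>i\<in>UNIV. partial i (grad F) x $ i) + (\<Sum>i\<in>UNIV. \<Sum>k\<in>UNIV. \<Gamma> i x $ k $ k * grad F x $ i))"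
    by (simp add: sum.distrib sum_distrib_left sum_distrib_right distrib_left mult.assoc)
  also have "(\<Sum>i\<in>UNIV. \<Sum>k\<in>UNIV. \<Gamma> i x $ k $ k * grad F x $ i) = (\<Sum>k\<in>UNIV. \<Sum>i\<in>UNIV. \<Gamma> k x $ k $ i * grad F x $ i)"
    using \<Gamma>_symmetric[OF assms(2)] by (subst sum.swap) simp
  finally show ?thesis
    by (simp add: lap_def Hv_def sum.distrib matrix_vector_mult_def)
qed

end

section \<open>Integration by parts in a chart\<close>

lemma integrable_compact_support:
  fixes h :: "real ^ 'n::finite \<Rightarrow> real"
  assumes "continuous_on UNIV h" "compact K" "\<And>x. x \<notin> K \<Longrightarrow> h x = 0"
  shows "integrable lborel h"
proof -
  have "integrable lborel (\<lambda>x. indicator K x *\<^sub>R h x)"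
    by (rule borel_integrable_compact) (use assms(2) continuous_on_subset[OF assms(1)] in auto)
  moreover have "(\<lambda>x. indicator K x *\<^sub>R h x) = h"
    using assms(3) by (auto simp: indicator_def fun_eq_iff)
  ultimately show ?thesis by simp
qed

lemma continuous_on_zero_extension:
  fixes h :: "'a::t2_space \<Rightarrow> real"
  assumes "open S" "continuous_on S h" "compact K" "K \<subseteq> S" "\<And>x. x \<notin> K \<Longrightarrow> h x = 0"
  shows "continuous_on UNIV h"
proof -
  have "continuous_on (- K) h"
    using continuous_on_const[of "- K" "0::real"] by (rule continuous_on_cong[THEN iffD1, rotated 2]) (use assms in auto)
  then have "continuous_on (S \<union> - K) h"
    using assms by (intro continuous_on_open_Un open_Compl compact_imp_closed)
  moreover have "S \<union> - K = UNIV" using assms(4) by auto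
  ultimately show ?thesis by simp
qed

lemma partial_outside:
  assumes "closed K" "\<And>y. y \<notin> K \<Longrightarrow> h y = 0" "x \<notin> K"
  shows "partial i h x = 0"
  using partial_cong[of "- K" x h "\<lambda>_. 0" i] assms by (auto simp: partial_const)

text \<open>The integral is the limit of the integrals of difference quotients by dominated
  convergence. The mean value theorem bounds the quotients uniformly, and steps of size at most 1
  keep their supports in the ball of radius \<open>R + 1\<close>.\<close>

lemma integral_partial_eq_0:
  fixes h :: "real ^ 'n::finite \<Rightarrow> real"
  assumes diff: "\<And>x. h differentiable (at x)" and cont: "continuous_on UNIV (partial i h)"
    and K: "compact K" "\<And>x. x \<notin> K \<Longrightarrow> h x = 0"
  shows "(\<integral>x. partial i h x \<partial>lborel) = 0"
proof -
  define t where "t k = 1 / real (Suc k)" for k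
  \<comment> \<open>difference quotients integrate to 0 by translation invariance\<close>
  define s where "s k x = (h (x + t k *\<^sub>R axis i 1) - h x) / t k" for k x
  have t: "0 < t k" "t k \<le> 1" for k by (auto simp: t_def)
  have hc: "continuous_on UNIV h"
    using diff differentiable_imp_continuous_within by (auto simp: continuous_on_eq_continuous_within)
  have hi: "integrable lborel h" by (rule integrable_compact_support[OF hc K])
  have hm [measurable]: "h \<in> borel_measurable borel" using hc by (rule borel_measurable_continuous_onI)
  have pz: "partial i h x = 0" if "x \<notin> K" for x
    by (rule partial_outside[OF compact_imp_closed[OF K(1)] K(2) that])
  obtain B where B: "\<And>x. \<bar>partial i h x\<bar> \<le> B" "B \<ge> 0"
  proof -
    have "compact (partial i h ` K)" using K(1) cont compact_continuous_image continuous_on_subset by blast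
    then obtain B where "\<And>x. x \<in> K \<Longrightarrow> \<bar>partial i h x\<bar> \<le> B"
      unfolding compact_eq_bounded_closed bounded_iff by auto
    then have "\<bar>partial i h x\<bar> \<le> max B 0" for x using pz[of x] by (cases "x \<in> K") force+
    then show thesis using that[of "max B 0"] by auto
  qed
  obtain R where R: "\<And>x. x \<in> K \<Longrightarrow> norm x \<le> R" "R \<ge> 0"
    using K(1) unfolding compact_eq_bounded_closed bounded_pos by (meson less_imp_le)
  let ?I = "indicator (cball 0 (R + 1)) :: real ^ 'n \<Rightarrow> real"
  have der: "((\<lambda>a. h (x + a *\<^sub>R axis i 1)) has_real_derivative partial i h (x + a *\<^sub>R axis i 1)) (at a)" for x a
    by (rule has_real_derivative_along_axis) (rule diff)
  have bound: "norm (s k x) \<le> B * ?I x" for k x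
  proof (cases "x \<in> cball 0 (R + 1)")
    case True
    obtain z where "h (x + t k *\<^sub>R axis i 1) - h (x + 0 *\<^sub>R axis i 1) = (t k - 0) * partial i h (x + z *\<^sub>R axis i 1)"
      using MVT2[of 0 "t k" "\<lambda>a. h (x + a *\<^sub>R axis i 1)" "\<lambda>a. partial i h (x + a *\<^sub>R axis i 1)"] t der by metis
    then have "s k x = partial i h (x + z *\<^sub>R axis i 1)" using t[of k] by (simp add: s_def)
    then show ?thesis using B True by simp
  next
    case False
    then have "norm x > R + 1" by simp
    moreover have "norm (x + t k *\<^sub>R axis i (1::real)) \<ge> norm x - norm (t k *\<^sub>R axis i (1::real))"
      by (metis add_diff_cancel norm_triangle_ineq2 norm_minus_commute diff_add_cancel add_diff_cancel_left' norm_diff_ineq)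
    ultimately have "norm (x + t k *\<^sub>R axis i (1::real)) > R" using t[of k] by simp
    then have "x \<notin> K" "x + t k *\<^sub>R axis i 1 \<notin> K" using R \<open>norm x > R + 1\<close> by force+
    then show ?thesis using K(2) False by (simp add: s_def)
  qed
  have "(\<lambda>k. \<integral>x. s k x \<partial>lborel) \<longlonglongrightarrow> (\<integral>x. partial i h x \<partial>lborel)"
  proof (rule integral_dominated_convergence)
    show "integrable lborel (\<lambda>x. B * ?I x)"
      by (intro integrable_mult_right integrable_real_indicator) (use emeasure_lborel_cball_finite[of "0 :: real ^ 'n" "R + 1"] in auto)
    show "AE x in lborel. (\<lambda>k. s k x) \<longlonglongrightarrow> partial i h x"
    proof (rule AE_I2)
      fix x
      have "((\<lambda>a. (h (x + (0 + a) *\<^sub>R axis i 1) - h (x + 0 *\<^sub>R axis i 1)) / a) \<longlongrightarrow> partial i h (x + 0 *\<^sub>R axis i 1)) (at 0)"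
        using der[of x 0] unfolding DERIV_def .
      then have lim: "((\<lambda>a. (h (x + a *\<^sub>R axis i 1) - h x) / a) \<longlongrightarrow> partial i h x) (at 0)" by simp
      have "filterlim t (at 0) sequentially"
        unfolding filterlim_at using t LIMSEQ_inverse_real_of_nat by (auto simp: t_def[abs_def] inverse_eq_divide less_imp_neq[THEN not_sym])
      from filterlim_compose[OF lim this] show "(\<lambda>k. s k x) \<longlonglongrightarrow> partial i h x" by (simp add: s_def)
    qed
    show "partial i h \<in> borel_measurable lborel" using cont by (simp add: borel_measurable_continuous_onI)
    show "s k \<in> borel_measurable lborel" for k unfolding s_def by measurable
    show "AE x in lborel. norm (s k x) \<le> B * ?I x" for k using bound by simp
  qed
  moreover have "(\<integral>x. s k x \<partial>lborel) = 0" for k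
  proof -
    let ?c = "t k *\<^sub>R axis i (1::real) :: real ^ 'n"
    have "integrable (distr lborel borel ((+) ?c)) h" "(\<integral>x. h x \<partial>distr lborel borel ((+) ?c)) = (\<integral>x. h x \<partial>lborel)"
      using hi by (simp_all add: lborel_distr_plus)
    then have "integrable lborel (\<lambda>x. h (?c + x))" "(\<integral>x. h (?c + x) \<partial>lborel) = (\<integral>x. h x \<partial>lborel)"
      by (simp_all add: integrable_distr_eq integral_distr)
    then show ?thesis using hi by (simp add: s_def add.commute)
  qed
  ultimately show ?thesis by (simp add: LIMSEQ_const_iff)
qed

context metric_chart
begin

text \<open>The vanishing of integrals of partial derivatives is applied to the components of
  \<open>\<zeta> * vol * grad F\<close>; the product rule and the divergence formula identify the
  sum of the integrands.\<close>

lemma chart_integration_by_parts: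
  assumes F: "smooth_on S F"
    and \<zeta>: "\<And>x. \<zeta> differentiable (at x)" "\<And>i. continuous_on UNIV (partial i \<zeta>)"
    and K: "compact K" "K \<subseteq> S" "\<And>x. x \<notin> K \<Longrightarrow> \<zeta> x = 0"
  shows "integrable lborel (\<lambda>x. \<zeta> x * lap F x * vol x)"
    and "integrable lborel (\<lambda>x. (df \<zeta> x \<bullet> grad F x) * vol x)"
    and "(\<integral>x. \<zeta> x * lap F x * vol x \<partial>lborel) = - (\<integral>x. (df \<zeta> x \<bullet> grad F x) * vol x \<partial>lborel)"
proof -
  have Kc: "closed K" using K(1) compact_imp_closed by blast
  have pz: "partial i \<zeta> x = 0" if "x \<notin> K" for x i by (rule partial_outside[OF Kc K(3) that])
  have vd: "vol differentiable (at x)" if "x \<in> S" for x using vol_has_derivative[OF that] differentiableI by blast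
  have cg: "continuous_on S (\<lambda>x. grad F x $ i)" for i
    by (intro smooth_on_continuous_on smooth_on_nth open_S smooth_grad F)
  have cv: "continuous_on S vol"
    by (simp add: vd continuous_at_imp_continuous_on differentiable_imp_continuous_within)
  have c\<zeta>: "continuous_on S \<zeta>"
    using \<zeta>(1) by (simp add: continuous_at_imp_continuous_on differentiable_imp_continuous_within)
  have cp\<zeta>: "continuous_on S (partial i \<zeta>)" for i using \<zeta>(2) continuous_on_subset by blast
  have ext: "continuous_on UNIV h" "integrable lborel h"
    if "continuous_on S h" "\<And>x. x \<notin> K \<Longrightarrow> h x = 0" for h :: "real ^ 'n \<Rightarrow> real"
  proof -
    show c: "continuous_on UNIV h" by (rule continuous_on_zero_extension[OF open_S that(1) K(1,2) that(2)])
    show "integrable lborel h" by (rule integrable_compact_support[OF c K(1) that(2)])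
  qed
  define V where "V i y = vol y * grad F y $ i" for i y
  \<comment> \<open>\<open>V i\<close> is meaningful only on \<open>S\<close>, but the factor
    \<open>\<zeta>\<close> vanishes off the compact set \<open>K\<close>, so \<open>W i\<close> is
    differentiable everywhere.\<close>
  define W where "W i y = \<zeta> y * V i y" for i y
  have Vd: "V i differentiable (at x)" if "x \<in> S" for i x
    unfolding V_def using vd[OF that] smooth_on_differentiable[OF smooth_on_nth[OF open_S smooth_grad[OF F]] that]
    by (rule differentiable_mult)
  have Wd: "W i differentiable (at x)" for i x
  proof (cases "x \<in> S")
    case True
    then show ?thesis unfolding W_def using \<zeta>(1) Vd by (intro differentiable_mult)
  next
    case False
    have "((\<lambda>_. 0) has_derivative (\<lambda>_. 0)) (at x)" by simp
    then have "(W i has_derivative (\<lambda>_. 0)) (at x)"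
      by (rule has_derivative_transform_within_open[of _ _ _ _ "- K"]) (use Kc False K in \<open>auto simp: W_def\<close>)
    then show ?thesis using differentiableI by blast
  qed
  have pW: "partial i (W i) x = \<zeta> x * partial i (V i) x + partial i \<zeta> x * V i x" for i x
  proof (cases "x \<in> S")
    case True
    then show ?thesis unfolding W_def by (intro partial_mult \<zeta> Vd)
  next
    case False
    then have "x \<notin> K" using K by blast
    have "partial i (W i) x = 0"
      by (rule partial_outside[OF Kc _ \<open>x \<notin> K\<close>]) (simp add: W_def K)
    then show ?thesis using pz K(3) \<open>x \<notin> K\<close> by simp
  qed
  have pV: "partial i (V i) x = vol x * partial i (\<lambda>y. grad F y $ i) x + vol x * (\<Sum>k\<in>UNIV. \<Gamma> i x $ k $ k) * grad F x $ i"
    if "x \<in> S" for i x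
    unfolding V_def
    using partial_mult[OF vd[OF that] smooth_on_differentiable[OF smooth_on_nth[OF open_S smooth_grad[OF F]] that], of i i] partial_vol[OF that]
    by simp
  have cpV: "continuous_on S (partial i (V i))" for i
  proof (rule continuous_on_cong[THEN iffD2])
    show "continuous_on S (\<lambda>x. vol x * partial i (\<lambda>y. grad F y $ i) x + vol x * (\<Sum>k\<in>UNIV. \<Gamma> i x $ k $ k) * grad F x $ i)"
      by (intro continuous_on_add continuous_on_mult continuous_on_sum cv cg smooth_on_continuous_on smooth_on_partial
          smooth_on_nth open_S smooth_grad smooth_\<Gamma> F)
  qed (use pV in auto)
  have cpW: "continuous_on UNIV (partial i (W i))" for i
    unfolding pW[abs_def]
    by (rule ext(1)) (auto simp: V_def K(3) pz intro!: continuous_intros c\<zeta> cpV cp\<zeta> cv cg)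
  have "(\<integral>x. partial i (W i) x \<partial>lborel) = 0" "integrable lborel (partial i (W i))" for i
    using integral_partial_eq_0[OF Wd cpW K(1)] integrable_compact_support[OF cpW K(1)] K(3) pW pz
    by (auto simp: W_def)
  then have "(\<integral>x. (\<Sum>i\<in>UNIV. partial i (W i) x) \<partial>lborel) = 0" by (simp add: Bochner_Integration.integral_sum)
  moreover have "(\<Sum>i\<in>UNIV. partial i (W i) x) = \<zeta> x * lap F x * vol x + (df \<zeta> x \<bullet> grad F x) * vol x" for x
  proof (cases "x \<in> S")
    case True
    have "(\<Sum>i\<in>UNIV. partial i (W i) x) = \<zeta> x * (\<Sum>i\<in>UNIV. partial i (V i) x) + (\<Sum>i\<in>UNIV. partial i \<zeta> x * V i x)"
      by (simp add: pW sum.distrib sum_distrib_left)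
    also have "(\<Sum>i\<in>UNIV. partial i (V i) x) = vol x * lap F x"
      unfolding V_def by (rule divergence_formula[OF F True])
    also have "(\<Sum>i\<in>UNIV. partial i \<zeta> x * V i x) = (df \<zeta> x \<bullet> grad F x) * vol x"
      by (simp add: V_def df_def inner_vec_def sum_distrib_left sum_distrib_right mult_ac)
    finally show ?thesis by (simp add: mult_ac)
  next
    case False
    then have "x \<notin> K" using K by blast
    then show ?thesis by (simp add: pW pz K(3) df_def inner_vec_def)
  qed
  moreover show i1: "integrable lborel (\<lambda>x. \<zeta> x * lap F x * vol x)"
    by (rule ext(2)) (auto simp: K(3) intro!: continuous_intros c\<zeta> cv smooth_on_continuous_on[OF smooth_lap[OF F]])
  moreover show i2: "integrable lborel (\<lambda>x. (df \<zeta> x \<bullet> grad F x) * vol x)"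
    by (rule ext(2)) (auto simp: pz df_def inner_vec_def intro!: continuous_intros cp\<zeta> cv cg)
  ultimately show "(\<integral>x. \<zeta> x * lap F x * vol x \<partial>lborel) = - (\<integral>x. (df \<zeta> x \<bullet> grad F x) * vol x \<partial>lborel)"
    by simp
qed

end

section \<open>Change of variables over an arbitrary finite index type\<close>

text \<open>The change of variables theorem of the library requires the index type of the coordinates to be
  well ordered.  The copy \<open>'a wo\<close> of a finite type carries an arbitrarily chosen such order.\<close>

typedef 'a wo = "UNIV :: 'a set" by simp

definition wo_index :: "'a::finite wo \<Rightarrow> nat" where
  "wo_index x = (SOME h :: 'a \<Rightarrow> nat. inj h) (Rep_wo x)"

lemma wo_index_inject: "wo_index x = wo_index y \<longleftrightarrow> x = y"
proof -
  have "\<exists>h :: 'a \<Rightarrow> nat. inj h" using finite_imp_inj_to_nat_seg[of "UNIV :: 'a set"] finite by blast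
  then have "inj (SOME h :: 'a \<Rightarrow> nat. inj h)" by (rule someI_ex)
  then show ?thesis by (auto simp: wo_index_def Rep_wo_inject dest: injD)
qed

instance wo :: (finite) finite
proof
  have "surj (Abs_wo :: 'a \<Rightarrow> 'a wo)" by (metis Rep_wo_inverse surj_def)
  then show "finite (UNIV :: 'a wo set)" by (metis finite finite_imageI)
qed

instantiation wo :: (finite) wellorder
begin

definition less_eq_wo :: "'a wo \<Rightarrow> 'a wo \<Rightarrow> bool" where "x \<le> y \<longleftrightarrow> wo_index x \<le> wo_index y"
definition less_wo :: "'a wo \<Rightarrow> 'a wo \<Rightarrow> bool" where "x < y \<longleftrightarrow> wo_index x < wo_index y"

instance
proof
  fix P :: "'a wo \<Rightarrow> bool" and a :: "'a wo"
  assume step: "\<And>x. (\<And>y. y < x \<Longrightarrow> P y) \<Longrightarrow> P x"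
  show "P a"
  proof (induction a rule: measure_induct_rule[of wo_index])
    case (less x)
    then show ?case using step[of x] by (auto simp: less_wo_def)
  qed
qed (auto simp: less_eq_wo_def less_wo_def wo_index_inject)

end

definition to_wo :: "real ^ 'n \<Rightarrow> real ^ 'n wo" where "to_wo v = (\<chi> i. v $ Rep_wo i)"
definition of_wo :: "real ^ 'n wo \<Rightarrow> real ^ 'n" where "of_wo w = (\<chi> i. w $ Abs_wo i)"

lemma to_of_wo [simp]: "to_wo (of_wo w) = w" and of_to_wo [simp]: "of_wo (to_wo v) = v"
  by (simp_all add: to_wo_def of_wo_def vec_eq_iff Rep_wo_inverse Abs_wo_inverse)

lemma bij_Rep_wo: "bij Rep_wo"
  by (metis Abs_wo_inverse Rep_wo_inverse UNIV_I bijI')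

lemma bij_Abs_wo: "bij Abs_wo"
  by (metis Abs_wo_inverse Rep_wo_inverse UNIV_I bijI')

lemma bounded_linear_to_wo: "bounded_linear (to_wo :: real ^ 'n::finite \<Rightarrow> _)"
  by (auto intro!: linearI simp: linear_conv_bounded_linear[symmetric] to_wo_def vec_eq_iff)

lemma bounded_linear_of_wo: "bounded_linear (of_wo :: _ \<Rightarrow> real ^ 'n::finite)"
  by (auto intro!: linearI simp: linear_conv_bounded_linear[symmetric] of_wo_def vec_eq_iff)

lemma measurable_to_wo [measurable]: "(to_wo :: real ^ 'n::finite \<Rightarrow> _) \<in> borel_measurable borel"
  and measurable_of_wo [measurable]: "(of_wo :: _ \<Rightarrow> real ^ 'n::finite) \<in> borel_measurable borel"
  using bounded_linear.continuous_on[OF bounded_linear_to_wo continuous_on_id]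
    bounded_linear.continuous_on[OF bounded_linear_of_wo continuous_on_id]
  by (auto intro: borel_measurable_continuous_onI)

lemma prod_Basis_vec: "(\<Prod>b\<in>Basis. q b) = (\<Prod>i\<in>UNIV. q (axis i 1))"
  for q :: "real ^ 'n::finite \<Rightarrow> real"
proof -
  have "Basis = range (\<lambda>i. axis i 1 :: real ^ 'n)" by (auto simp: Basis_vec_def)
  moreover have "inj (\<lambda>i. axis i 1 :: real ^ 'n)" by (auto simp: inj_def axis_eq_axis)
  ultimately show ?thesis using prod.reindex[of "\<lambda>i. axis i 1 :: real ^ 'n" UNIV q] by simp
qed

text \<open>Relabelling coordinates maps boxes to boxes with the same side lengths, up to their
  order.\<close>

lemma lborel_to_wo: "distr lborel borel (to_wo :: real ^ 'n::finite \<Rightarrow> _) = lborel"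
proof (rule lborel_eqI[symmetric])
  fix l u :: "real ^ 'n wo"
  assume le: "\<And>b. b \<in> Basis \<Longrightarrow> l \<bullet> b \<le> u \<bullet> b"
  have "to_wo -` box l u = box (of_wo l) (of_wo u)"
  proof -
    have "v \<in> to_wo -` box l u \<longleftrightarrow> v \<in> box (of_wo l) (of_wo u)" for v :: "real ^ 'n"
      unfolding mem_box_cart vimage_eq to_wo_def of_wo_def
      by (simp, metis Abs_wo_inverse Rep_wo_inverse UNIV_I)
    then show ?thesis by blast
  qed
  then have "emeasure (distr lborel borel to_wo) (box l u) = emeasure lborel (box (of_wo l :: real ^ 'n) (of_wo u))"
    by (subst emeasure_distr) auto
  also have "\<dots> = ennreal (\<Prod>b\<in>Basis. (of_wo u - of_wo l :: real ^ 'n) \<bullet> b)"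
  proof (rule emeasure_lborel_box)
    fix b :: "real ^ 'n" assume "b \<in> Basis"
    then obtain i where "b = axis i 1" by (auto simp: Basis_vec_def)
    then show "of_wo l \<bullet> b \<le> of_wo u \<bullet> b"
      using le[of "axis (Abs_wo i) 1"] by (simp add: of_wo_def inner_axis)
  qed
  also have "(\<Prod>b\<in>Basis. (of_wo u - of_wo l :: real ^ 'n) \<bullet> b) = (\<Prod>b\<in>Basis. (u - l) \<bullet> b)"
    unfolding prod_Basis_vec
    using prod.reindex_bij_betw[OF bij_Abs_wo, of "\<lambda>j. (u - l) $ j"]
    by (simp add: inner_axis of_wo_def)
  finally show "emeasure (distr lborel borel (to_wo :: real ^ 'n \<Rightarrow> _)) (box l u) = (\<Prod>b\<in>Basis. (u - l) \<bullet> b)" .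
qed simp

lemma permutes_UNIV_iff: "p permutes UNIV \<longleftrightarrow> bij p"
  by (auto intro: bij_imp_permutes permutes_bij)

text \<open>Conjugation by \<open>r\<close> is a sign preserving bijection between the permutations
  of the two index types.\<close>

lemma det_reindex:
  fixes M :: "real ^ 'n::finite ^ 'n" and r :: "'k::finite \<Rightarrow> 'n"
  assumes r: "bij r"
  shows "det (\<chi> i j. M $ r i $ r j) = det M"
proof -
  let ?c = "\<lambda>p. r \<circ> p \<circ> inv r"
  have ri: "inv r (r i) = i" "r (inv r j) = j" for i j
    using r by (simp_all add: bij_is_inj bij_is_surj surj_f_inv_f)
  have bc: "bij_betw ?c {p. p permutes (UNIV :: 'k set)} {p. p permutes (UNIV :: 'n set)}"
  proof (rule bij_betwI[where g = "\<lambda>q. inv r \<circ> q \<circ> r"])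
    show "?c \<in> {p. p permutes UNIV} \<rightarrow> {p. p permutes UNIV}"
      using r by (auto simp: permutes_UNIV_iff intro!: bij_comp bij_imp_bij_inv)
    show "(\<lambda>q. inv r \<circ> q \<circ> r) \<in> {p. p permutes UNIV} \<rightarrow> {p. p permutes UNIV}"
      using r by (auto simp: permutes_UNIV_iff intro!: bij_comp bij_imp_bij_inv)
  qed (auto simp: fun_eq_iff ri)
  have sg: "sign (?c p) = sign p" if "p permutes UNIV" for p
  proof -
    have "map_permutation UNIV r p = ?c p"
      using r by (auto simp: map_permutation_def restrict_id_def fun_eq_iff bij_is_surj)
    then show ?thesis using sign_map_permutation[of r UNIV p] r that by (simp add: bij_is_inj)
  qed
  have "det M = (\<Sum>p | p permutes (UNIV :: 'k set). of_int (sign (?c p)) * (\<Prod>i\<in>UNIV. M $ i $ (?c p) i))"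
    unfolding det_def by (rule sum.reindex_bij_betw[OF bc, symmetric])
  also have "\<dots> = (\<Sum>p | p permutes (UNIV :: 'k set). of_int (sign p) * (\<Prod>i\<in>UNIV. M $ r i $ r (p i)))"
  proof (intro sum.cong refl)
    fix p assume "p \<in> {p. p permutes (UNIV :: 'k set)}"
    moreover have "(\<Prod>i\<in>UNIV. M $ i $ (?c p) i) = (\<Prod>i\<in>UNIV. M $ r i $ r (p i))"
      using prod.reindex_bij_betw[OF r, of "\<lambda>i. M $ i $ (?c p) i"] by (simp add: ri)
    ultimately show "of_int (sign (?c p)) * (\<Prod>i\<in>UNIV. M $ i $ (?c p) i) = of_int (sign p) * (\<Prod>i\<in>UNIV. M $ r i $ r (p i))"
      using sg by simp
  qed
  finally show ?thesis by (simp add: det_def)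
qed

text \<open>Translates between the extended nonnegative integral and absolute integrability with a
  real value, the form in which change of variables is stated; failure of integrability means the
  value infinity.\<close>

lemma nn_integral_absolutely_integrable:
  fixes h :: "real ^ 'n::finite \<Rightarrow> real"
  assumes "(\<lambda>x. indicator X x * h x) \<in> borel_measurable borel" "\<And>x. x \<in> X \<Longrightarrow> h x \<ge> 0"
  shows "(\<integral>\<^sup>+x\<in>X. h x \<partial>lborel) = (if h absolutely_integrable_on X then ennreal (integral X h) else \<infinity>)"
proof -
  let ?h = "\<lambda>x. indicator X x *\<^sub>R h x"
  have m: "?h \<in> borel_measurable lborel" using assms(1) by simp
  have pos: "?h x \<ge> 0" for x using assms(2) by (simp add: indicator_def)
  have eq: "(\<integral>\<^sup>+x\<in>X. h x \<partial>lborel) = (\<integral>\<^sup>+x. ennreal (?h x) \<partial>lebesgue)"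
    using m by (subst nn_integral_completion) (auto intro!: nn_integral_cong simp: indicator_def)
  have ml: "?h \<in> borel_measurable lebesgue" using m by (rule measurable_completion)
  show ?thesis
  proof (cases "h absolutely_integrable_on X")
    case True
    then have i: "integrable lebesgue ?h" by (simp add: set_integrable_def)
    have "(\<integral>\<^sup>+x. ennreal (?h x) \<partial>lebesgue) = ennreal (\<integral>x. ?h x \<partial>lebesgue)"
      by (rule nn_integral_eq_integral[OF i]) (use pos in simp)
    also have "(\<integral>x. ?h x \<partial>lebesgue) = integral X h"
      using set_lebesgue_integral_eq_integral(2)[OF True] by (simp add: set_lebesgue_integral_def)
    finally show ?thesis using True eq by simp
  next
    case False
    then have "\<not> integrable lebesgue ?h" by (simp add: set_integrable_def)
    then have "(\<integral>\<^sup>+x. ennreal (?h x) \<partial>lebesgue) = \<infinity>"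
      using integrableI_nonneg[OF ml] pos by (force simp: less_top[symmetric])
    then show ?thesis using False eq by simp
  qed
qed

lemma nn_integral_change_of_variables_wellorder:
  fixes T :: "real ^ 'n::{finite,wellorder} \<Rightarrow> real ^ 'n::_" and h :: "real ^ 'n::_ \<Rightarrow> real"
  assumes S: "S \<in> sets borel"
    and der: "\<And>x. x \<in> S \<Longrightarrow> (T has_derivative T' x) (at x within S)" and inj: "inj_on T S"
    and pos: "\<And>y. y \<in> T ` S \<Longrightarrow> h y \<ge> 0"
    and m1: "(\<lambda>y. indicator (T ` S) y * h y) \<in> borel_measurable borel"
    and m2: "(\<lambda>x. indicator S x * (\<bar>det (matrix (T' x))\<bar> * h (T x))) \<in> borel_measurable borel"
  shows "(\<integral>\<^sup>+y\<in>T ` S. h y \<partial>lborel) = (\<integral>\<^sup>+x\<in>S. (\<bar>det (matrix (T' x))\<bar> * h (T x)) \<partial>lborel)"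
proof -
  let ?D = "\<lambda>x. \<bar>det (matrix (T' x))\<bar> * h (T x)"
  define h1 where "h1 y = (vec (h y) :: real ^ 1)" for y
  have Sl: "S \<in> sets lebesgue" using S by simp
  \<comment> \<open>An equivalence for every value \<open>b\<close> says at once that both sides are
    integrable together and that their integrals agree. The detour through \<open>real ^ 1\<close>
    fits a theorem about vector valued integrands.\<close>
  have cv: "?D absolutely_integrable_on S \<and> integral S ?D = b \<longleftrightarrow>
      h absolutely_integrable_on T ` S \<and> integral (T ` S) h = b" for b
  proof -
    have v: "(\<lambda>x. \<bar>det (matrix (T' x))\<bar> *\<^sub>R h1 (T x)) = (\<lambda>x. vec (?D x) :: real ^ 1)"
      by (simp add: h1_def vec_eq_iff fun_eq_iff)
    have v2: "h1 = (\<lambda>x. vec (h x) :: real ^ 1)" by (simp add: h1_def fun_eq_iff)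
    show ?thesis
      using has_absolute_integral_change_of_variables[OF Sl der inj, of h1 "vec b"]
      unfolding v v2 absolutely_integrable_on_1_iff integral_on_1_eq by simp
  qed
  have "(?D absolutely_integrable_on S \<longleftrightarrow> h absolutely_integrable_on T ` S) \<and>
      (h absolutely_integrable_on T ` S \<longrightarrow> integral S ?D = integral (T ` S) h)"
    using cv by blast
  then show ?thesis
    using nn_integral_absolutely_integrable[OF m1 pos] nn_integral_absolutely_integrable[OF m2] pos
    by simp
qed

text \<open>Conjugation by \<open>to_wo\<close> moves the statement to the well ordered index type;
  it preserves Lebesgue measure and determinants.\<close>

lemma nn_integral_change_of_variables:
  fixes T :: "real ^ 'n::finite \<Rightarrow> real ^ 'n" and h :: "real ^ 'n \<Rightarrow> real"
  assumes S: "S \<in> sets borel"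
    and der: "\<And>x. x \<in> S \<Longrightarrow> (T has_derivative T' x) (at x within S)" and inj: "inj_on T S"
    and pos: "\<And>y. y \<in> T ` S \<Longrightarrow> h y \<ge> 0"
    and m1: "(\<lambda>y. indicator (T ` S) y * h y) \<in> borel_measurable borel"
    and m2: "(\<lambda>x. indicator S x * (\<bar>det (matrix (T' x))\<bar> * h (T x))) \<in> borel_measurable borel"
  shows "(\<integral>\<^sup>+y\<in>T ` S. h y \<partial>lborel) = (\<integral>\<^sup>+x\<in>S. (\<bar>det (matrix (T' x))\<bar> * h (T x)) \<partial>lborel)"
proof -
  define S2 where "S2 = to_wo ` S"
  define T2 where "T2 y = to_wo (T (of_wo y))" for y
  define T2' where "T2' y v = to_wo (T' (of_wo y) (of_wo v))" for y v
  define h2 where "h2 y = h (of_wo y)" for y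
  have mem: "y \<in> to_wo ` X \<longleftrightarrow> of_wo y \<in> X" for y and X :: "(real ^ 'n) set"
    by (metis imageE imageI of_to_wo to_of_wo)
  have img: "to_wo ` X = of_wo -` X" for X :: "(real ^ 'n) set" using mem by blast
  have TS: "T2 ` S2 = to_wo ` (T ` S)" by (auto simp: S2_def T2_def image_image)
  have dt: "\<bar>det (matrix (T2' y))\<bar> = \<bar>det (matrix (T' (of_wo y)))\<bar>" for y
  proof -
    have "matrix (T2' y) = (\<chi> i j. matrix (T' (of_wo y)) $ Rep_wo i $ Rep_wo j)"
    proof -
      have "of_wo (axis j 1) = (axis (Rep_wo j) 1 :: real ^ 'n)" for j :: "'n wo"
        by (simp add: of_wo_def axis_def fun_eq_iff) (metis Abs_wo_inverse Rep_wo_inverse UNIV_I)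
      then show ?thesis by (simp add: matrix_def T2'_def to_wo_def)
    qed
    then show ?thesis by (simp add: det_reindex[OF bij_Rep_wo])
  qed
  have "(\<integral>\<^sup>+y\<in>T2 ` S2. h2 y \<partial>lborel) = (\<integral>\<^sup>+x\<in>S2. (\<bar>det (matrix (T2' x))\<bar> * h2 (T2 x)) \<partial>lborel)"
  proof (rule nn_integral_change_of_variables_wellorder)
    show "S2 \<in> sets borel" unfolding S2_def img using measurable_sets[OF measurable_of_wo S] by simp
    show "inj_on T2 S2"
      using inj by (auto simp: inj_on_def T2_def S2_def) (metis of_to_wo)
    show "(T2 has_derivative T2' x) (at x within S2)" if x: "x \<in> S2" for x
    proof -
      have sx: "of_wo x \<in> S" using x mem S2_def by blast
      have im: "of_wo ` S2 \<subseteq> S" using mem S2_def by blast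
      have "(of_wo has_derivative of_wo) (at x within S2)"
        by (rule bounded_linear_imp_has_derivative[OF bounded_linear_of_wo])
      moreover have "(T has_derivative T' (of_wo x)) (at (of_wo x) within of_wo ` S2)"
        by (rule has_derivative_subset[OF der[OF sx] im])
      ultimately have "((\<lambda>y. T (of_wo y)) has_derivative (\<lambda>v. T' (of_wo x) (of_wo v))) (at x within S2)"
        by (rule has_derivative_in_compose)
      from bounded_linear.has_derivative[OF bounded_linear_to_wo this]
      show ?thesis by (simp add: T2_def[abs_def] T2'_def[abs_def])
    qed
    show "h2 y \<ge> 0" if "y \<in> T2 ` S2" for y
      using that pos mem unfolding TS h2_def by blast
    have "(\<lambda>y. indicator (T2 ` S2) y * h2 y) = (\<lambda>y. indicator (T ` S) y * h y) \<circ> of_wo"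
      unfolding TS by (auto simp: fun_eq_iff h2_def indicator_def mem)
    then show "(\<lambda>y. indicator (T2 ` S2) y * h2 y) \<in> borel_measurable borel"
      using measurable_comp[OF measurable_of_wo m1] by simp
    have "(\<lambda>x. indicator S2 x * (\<bar>det (matrix (T2' x))\<bar> * h2 (T2 x)))
      = (\<lambda>x. indicator S x * (\<bar>det (matrix (T' x))\<bar> * h (T x))) \<circ> of_wo"
      unfolding S2_def by (auto simp: fun_eq_iff h2_def indicator_def mem dt T2_def)
    then show "(\<lambda>x. indicator S2 x * (\<bar>det (matrix (T2' x))\<bar> * h2 (T2 x))) \<in> borel_measurable borel"
      using measurable_comp[OF measurable_of_wo m2] by simp
  qed
  moreover have tr: "(\<integral>\<^sup>+y\<in>to_wo ` X. q y \<partial>lborel) = (\<integral>\<^sup>+x\<in>X. q (to_wo x) \<partial>lborel)"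
    if m: "(\<lambda>x. indicator X x * q (to_wo x)) \<in> borel_measurable borel" for X and q :: "real ^ 'n wo \<Rightarrow> real"
  proof -
    have "(\<lambda>y. q y * indicator (to_wo ` X) y) = (\<lambda>x. indicator X x * q (to_wo x)) \<circ> of_wo"
      by (auto simp: fun_eq_iff indicator_def mem)
    then have "(\<lambda>y. q y * indicator (to_wo ` X) y) \<in> borel_measurable borel"
      using measurable_comp[OF measurable_of_wo m] by simp
    then have m': "(\<lambda>y. ennreal (q y * indicator (to_wo ` X) y)) \<in> borel_measurable borel" by measurable
    have ei: "ennreal (q y) * indicator Y y = ennreal (q y * indicator Y y)" for Y y by (simp add: indicator_def)
    have ei': "ennreal (q (to_wo y)) * indicator Y y = ennreal (q (to_wo y) * indicator Y y)" for Y y by (simp add: indicator_def)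
    have "(\<integral>\<^sup>+y\<in>to_wo ` X. q y \<partial>lborel) = (\<integral>\<^sup>+y. ennreal (q y * indicator (to_wo ` X) y) \<partial>distr lborel borel to_wo)"
      by (simp add: lborel_to_wo ei)
    also have "\<dots> = (\<integral>\<^sup>+x. ennreal (q (to_wo x) * indicator (to_wo ` X) (to_wo x)) \<partial>lborel)"
      using m' by (subst nn_integral_distr) simp_all
    finally have "(\<integral>\<^sup>+y\<in>to_wo ` X. q y \<partial>lborel) = (\<integral>\<^sup>+x. ennreal (q (to_wo x) * indicator (to_wo ` X) (to_wo x)) \<partial>lborel)" .
    moreover have "indicator (to_wo ` X) (to_wo x) = (indicator X x :: real)" for x by (simp add: indicator_def mem)
    ultimately show ?thesis by (simp only: ei')
  qed
  moreover have "(\<integral>\<^sup>+y\<in>T2 ` S2. h2 y \<partial>lborel) = (\<integral>\<^sup>+y\<in>T ` S. h y \<partial>lborel)"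
    unfolding TS by (subst tr) (use m1 in \<open>simp_all add: h2_def\<close>)
  moreover have "(\<integral>\<^sup>+x\<in>S2. (\<bar>det (matrix (T2' x))\<bar> * h2 (T2 x)) \<partial>lborel) = (\<integral>\<^sup>+x\<in>S. (\<bar>det (matrix (T' x))\<bar> * h (T x)) \<partial>lborel)"
    unfolding S2_def by (subst tr) (use m2 in \<open>simp_all add: h2_def T2_def dt\<close>)
  ultimately show ?thesis by simp
qed

section \<open>The Riemannian volume measure\<close>

lemma suminf_swap_ennreal: "(\<Sum>i. \<Sum>k. q i k) = (\<Sum>k. \<Sum>i. q i k)" for q :: "nat \<Rightarrow> nat \<Rightarrow> ennreal"
  using nn_integral_suminf[of q "count_space UNIV"] by (simp add: nn_integral_count_space_nat)

context riemannian_manifold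
begin

lemma metric_chart: "c \<in> A \<Longrightarrow> metric_chart (chart_image c) (g c)"
  by unfold_locales (auto intro: open_image metric_smooth metric_symmetric metric_positive)

lemma chart_inverse [simp]: "c \<in> A \<Longrightarrow> p \<in> fst c \<Longrightarrow> chart_inv c (snd c p) = p"
  and chart_chart_inv [simp]: "c \<in> A \<Longrightarrow> x \<in> chart_image c \<Longrightarrow> snd c (chart_inv c x) = x"
  and chart_inv_in [simp]: "c \<in> A \<Longrightarrow> x \<in> chart_image c \<Longrightarrow> chart_inv c x \<in> fst c"
  using chart_homeomorphism[of c] by (auto simp: homeomorphism_def)

lemma chart_in_image [simp]: "p \<in> fst c \<Longrightarrow> snd c p \<in> chart_image c"
  by (simp add: chart_image_def)

lemma continuous_on_chart: "c \<in> A \<Longrightarrow> continuous_on (fst c) (snd c)"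
  and continuous_on_chart_inv: "c \<in> A \<Longrightarrow> continuous_on (chart_image c) (chart_inv c)"
  using chart_homeomorphism[of c] by (auto simp: homeomorphism_def)

lemma chart_at: obtains c where "c \<in> A" "p \<in> fst c"
  using charts_cover by (metis UNIV_I UN_E)

lemma image_chart_eq: "c \<in> A \<Longrightarrow> E \<subseteq> fst c \<Longrightarrow> snd c ` E = {x \<in> chart_image c. chart_inv c x \<in> E}"
  by (force simp: chart_image_def)

lemma transition_in: "c \<in> A \<Longrightarrow> d \<in> A \<Longrightarrow> x \<in> snd c ` (fst c \<inter> fst d) \<Longrightarrow> transition c d x \<in> chart_image d"
  by (auto simp: transition_def)

lemma open_overlap:
  assumes "c \<in> A" "d \<in> A"
  shows "open (snd c ` (fst c \<inter> fst d))"
proof -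
  have "snd c ` (fst c \<inter> fst d) = chart_image c \<inter> chart_inv c -` fst d"
    using image_chart_eq[OF assms(1), of "fst c \<inter> fst d"] assms(1) by auto
  then show ?thesis
    using continuous_on_open_vimage[OF open_image[OF assms(1)], of "chart_inv c"] continuous_on_chart_inv[OF assms(1)]
      open_domain[OF assms(2)] by (simp add: Int_commute)
qed

lemma transition_has_derivative:
  assumes "c \<in> A" "d \<in> A" "x \<in> snd c ` (fst c \<inter> fst d)"
  shows "(transition c d has_derivative (\<lambda>v. jacobian (transition c d) (at x) *v v)) (at x)"
  using smooth_on_differentiable[OF smooth_transition[OF assms(1,2)] assms(3)] jacobian_works by blast

abbreviation chart_density :: "('m, 'n) chart \<Rightarrow> real ^ 'n \<Rightarrow> real" where
  "chart_density c x \<equiv> sqrt (det (g c x))"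

lemma continuous_on_chart_density: "c \<in> A \<Longrightarrow> continuous_on (chart_image c) (chart_density c)"
  by (intro continuous_on_real_sqrt smooth_on_continuous_on metric_chart.smooth_det_G[OF metric_chart])

lemma chart_density_pos: "c \<in> A \<Longrightarrow> x \<in> chart_image c \<Longrightarrow> chart_density c x > 0"
  using metric_chart.det_G_pos[OF metric_chart] by simp

text \<open>The determinant of the Jacobian enters the determinant of the metric squared, hence the
  density through its absolute value.\<close>

lemma chart_density_transition:
  assumes "c \<in> A" "d \<in> A" "x \<in> snd c ` (fst c \<inter> fst d)"
  shows "chart_density c x = \<bar>det (jacobian (transition c d) (at x))\<bar> * chart_density d (transition c d x)"
proof -
  have "det (g c x) = (det (jacobian (transition c d) (at x)))\<^sup>2 * det (g d (transition c d x))"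
    by (simp add: metric_transformation[OF assms] det_mul det_transpose power2_eq_square)
  then show ?thesis by (simp add: real_sqrt_mult)
qed

lemma borel_image_chart:
  assumes "c \<in> A" "E \<in> sets borel" "E \<subseteq> fst c"
  shows "snd c ` E \<in> sets borel"
proof -
  have "chart_inv c \<in> borel_measurable (restrict_space borel (chart_image c))"
    by (rule borel_measurable_continuous_on_restrict[OF continuous_on_chart_inv[OF assms(1)]])
  from measurable_sets[OF this assms(2)] have "chart_inv c -` E \<inter> chart_image c \<in> sets (restrict_space borel (chart_image c))"
    by (simp add: space_restrict_space)
  then have "chart_inv c -` E \<inter> chart_image c \<in> sets borel"
    using open_image[OF assms(1)] by (subst (asm) sets_restrict_space_iff) auto
  moreover have "snd c ` E = chart_inv c -` E \<inter> chart_image c" using image_chart_eq[OF assms(1,3)] by auto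
  ultimately show ?thesis by simp
qed

text \<open>The indicator discards the arbitrary values that \<open>g c\<close> may take outside the
  chart image.\<close>

definition chart_measure :: "('m, 'n) chart \<Rightarrow> (real ^ 'n) measure" where
  "chart_measure c = density lborel (\<lambda>x. ennreal (indicator (chart_image c) x * chart_density c x))"

lemma measurable_chart_density:
  assumes "c \<in> A" "E \<in> sets borel" "E \<subseteq> chart_image c"
  shows "(\<lambda>x. indicator E x * chart_density c x) \<in> borel_measurable borel"
  using borel_measurable_continuous_on_indicator[OF assms(2) continuous_on_subset[OF continuous_on_chart_density[OF assms(1)] assms(3)]]
  by simp

lemma measurable_chart_density' [measurable]:
  "c \<in> A \<Longrightarrow> (\<lambda>x. indicator (chart_image c) x * chart_density c x) \<in> borel_measurable borel"
  by (rule measurable_chart_density) (simp_all add: borel_open open_image)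

lemma sets_chart_measure [simp]: "sets (chart_measure c) = sets borel"
  by (simp add: chart_measure_def)

lemma emeasure_chart_measure:
  assumes "c \<in> A" "X \<in> sets borel" "X \<subseteq> chart_image c"
  shows "emeasure (chart_measure c) X = (\<integral>\<^sup>+x\<in>X. chart_density c x \<partial>lborel)"
proof -
  have "emeasure (chart_measure c) X = (\<integral>\<^sup>+x\<in>X. ennreal (indicator (chart_image c) x * chart_density c x) \<partial>lborel)"
    unfolding chart_measure_def using assms measurable_chart_density' by (intro emeasure_density) auto
  also have "\<dots> = (\<integral>\<^sup>+x\<in>X. chart_density c x \<partial>lborel)"
    using assms(3) by (intro nn_integral_cong) (auto simp: indicator_def)
  finally show ?thesis .
qed

text \<open>The Jacobian factor of the change of coordinates is the one by which the two densities
  differ.\<close>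

lemma chart_measure_agree:
  assumes c: "c \<in> A" and d: "d \<in> A" and E: "E \<in> sets borel" "E \<subseteq> fst c" "E \<subseteq> fst d"
  shows "emeasure (chart_measure c) (snd c ` E) = emeasure (chart_measure d) (snd d ` E)"
proof -
  let ?T = "transition c d" let ?S = "snd c ` E"
  have Sc: "?S \<subseteq> chart_image c" and Sd: "snd d ` E \<subseteq> chart_image d" and SO: "?S \<subseteq> snd c ` (fst c \<inter> fst d)"
    using E by (auto simp: chart_image_def)
  have TS: "?T ` ?S = snd d ` E" using E c by (force simp: transition_def image_image)
  have bS: "?S \<in> sets borel" "snd d ` E \<in> sets borel" using borel_image_chart c d E by auto
  let ?J = "\<lambda>x v. jacobian ?T (at x) *v v"
  have mJ: "matrix (?J x) = jacobian ?T (at x)" for x by simp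
  have eqd: "\<bar>det (matrix (?J x))\<bar> * chart_density d (?T x) = chart_density c x" if "x \<in> ?S" for x
    unfolding mJ using chart_density_transition[OF c d, of x] SO that by (simp only: subset_iff)
  have "(\<integral>\<^sup>+y\<in>?T ` ?S. chart_density d y \<partial>lborel) = (\<integral>\<^sup>+x\<in>?S. (\<bar>det (matrix (?J x))\<bar> * chart_density d (?T x)) \<partial>lborel)"
  proof (rule nn_integral_change_of_variables[OF bS(1)])
    show "(?T has_derivative ?J x) (at x within ?S)" if "x \<in> ?S" for x
      using transition_has_derivative[OF c d] SO that by (blast intro: has_derivative_at_withinI)
    show "inj_on ?T ?S"
      using E c d by (intro inj_onI) (auto simp: transition_def, metis chart_inverse subsetD)
    show "chart_density d y \<ge> 0" if "y \<in> ?T ` ?S" for y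
      using that unfolding TS using chart_density_pos[OF d] Sd by (meson less_imp_le subsetD)
    show "(\<lambda>y. indicator (?T ` ?S) y * chart_density d y) \<in> borel_measurable borel"
      unfolding TS by (rule measurable_chart_density[OF d bS(2) Sd])
    have "(\<lambda>x. indicator ?S x * (\<bar>det (matrix (?J x))\<bar> * chart_density d (?T x))) = (\<lambda>x. indicator ?S x * chart_density c x)"
    proof
      fix x show "indicator ?S x * (\<bar>det (matrix (?J x))\<bar> * chart_density d (?T x)) = indicator ?S x * chart_density c x"
        using eqd[of x] by (cases "x \<in> ?S") simp_all
    qed
    then show "(\<lambda>x. indicator ?S x * (\<bar>det (matrix (?J x))\<bar> * chart_density d (?T x))) \<in> borel_measurable borel"
      using measurable_chart_density[OF c bS(1) Sc] by simp
  qed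
  also have "\<dots> = (\<integral>\<^sup>+x\<in>?S. chart_density c x \<partial>lborel)"
  proof (rule nn_integral_cong)
    fix x show "ennreal (\<bar>det (matrix (?J x))\<bar> * chart_density d (?T x)) * indicator ?S x = ennreal (chart_density c x) * indicator ?S x"
      using eqd[of x] by (cases "x \<in> ?S") simp_all
  qed
  finally show ?thesis
    unfolding TS using emeasure_chart_measure[OF c bS(1) Sc] emeasure_chart_measure[OF d bS(2) Sd] by simp
qed

section \<open>Gluing the chart measures\<close>

lemma chart_measure_suminf:
  assumes "c \<in> A" "range E \<subseteq> sets borel" "disjoint_family E" "\<And>i. E i \<subseteq> fst c"
  shows "(\<Sum>i. emeasure (chart_measure c) (snd c ` E i)) = emeasure (chart_measure c) (snd c ` (\<Union>i. E i))"
proof -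
  have "disjoint_family (\<lambda>i. snd c ` E i)"
    using assms unfolding disjoint_family_on_def
    by (auto, metis IntI chart_inverse[OF assms(1)] empty_iff subsetD)
  moreover have "range (\<lambda>i. snd c ` E i) \<subseteq> sets (chart_measure c)"
    using borel_image_chart[OF assms(1) _ assms(4)] assms(2) by auto
  ultimately show ?thesis using suminf_emeasure[of "\<lambda>i. snd c ` E i" "chart_measure c"] by (simp add: image_UN)
qed

text \<open>Second countability enters here, through the Lindelof property. The sequence may repeat
  charts, as their domains are made disjoint later.\<close>

lemma countable_atlas:
  obtains e :: "nat \<Rightarrow> ('m, 'n) chart" where "\<And>k. e k \<in> A" "(\<Union>k. fst (e k)) = UNIV"
proof -
  obtain F where F: "F \<subseteq> fst ` A" "countable F" "\<Union>F = \<Union>(fst ` A)"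
    by (rule Lindelof[of "fst ` A"]) (use open_domain in force)+
  have ne: "F \<noteq> {}" using F(3) charts_cover by auto
  have "\<exists>c. c \<in> A \<and> fst c = from_nat_into F k" for k
    using subsetD[OF F(1) from_nat_into[OF ne, of k]] by force
  then obtain e where e: "\<And>k. e k \<in> A \<and> fst (e k) = from_nat_into F k" by metis
  have "(\<Union>k. fst (e k)) = \<Union>F" using e range_from_nat_into[OF ne F(2)] by auto
  then show thesis using that[of e] e F(3) charts_cover by auto
qed

text \<open>The predicate under the definite description in
  \<open>riemannian_volume\<close>.\<close>

definition volume_property :: "'m measure \<Rightarrow> bool" where
  "volume_property M \<longleftrightarrow> sets M = sets borel \<and>
    (\<forall>c\<in>A. \<forall>E\<in>sets borel. E \<subseteq> fst c \<longrightarrow>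
      emeasure M E = (\<integral>\<^sup>+x\<in>snd c ` E. ennreal (sqrt (det (g c x))) \<partial>lborel))"

lemma volume_property_iff:
  "volume_property M \<longleftrightarrow> sets M = sets borel \<and>
    (\<forall>c\<in>A. \<forall>E\<in>sets borel. E \<subseteq> fst c \<longrightarrow> emeasure M E = emeasure (chart_measure c) (snd c ` E))"
proof -
  have "emeasure (chart_measure c) (snd c ` E) = (\<integral>\<^sup>+x\<in>snd c ` E. ennreal (sqrt (det (g c x))) \<partial>lborel)"
    if "c \<in> A" "E \<in> sets borel" "E \<subseteq> fst c" for c E
    using that by (intro emeasure_chart_measure borel_image_chart) (auto simp: chart_image_def)
  then show ?thesis unfolding volume_property_def by auto
qed

text \<open>The countable atlas is cut into disjoint Borel pieces \<open>D k\<close>, each measured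
  in its own chart. Agreement of the chart measures on overlaps shows that the sum has the required
  value in every chart, and the same decomposition determines any such measure, hence
  uniqueness.\<close>

lemma volume_exists_unique: "\<exists>!M. volume_property M"
proof -
  obtain e :: "nat \<Rightarrow> ('m, 'n) chart" where e: "\<And>k. e k \<in> A" "(\<Union>k. fst (e k)) = UNIV"
    by (rule countable_atlas) blast
  define D where "D = disjointed (\<lambda>k. fst (e k))"
  have De: "D k \<subseteq> fst (e k)" for k unfolding D_def by (rule disjointed_subset)
  have Dd: "disjoint_family D" unfolding D_def by (rule disjoint_family_disjointed)
  have DU: "(\<Union>k. D k) = UNIV" unfolding D_def UN_disjointed_eq by (rule e(2))
  have Db: "D k \<in> sets borel" for k
  proof -
    have "range (\<lambda>k. fst (e k)) \<subseteq> sets borel" using borel_open[OF open_domain[OF e(1)]] by auto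
    from sets.range_disjointed_sets[OF this] show ?thesis by (auto simp: D_def)
  qed
  have fam: "disjoint_family (\<lambda>k. E \<inter> D k)" for E
    using Dd by (auto simp: disjoint_family_on_def)
  define m where "m E = (\<Sum>k. emeasure (chart_measure (e k)) (snd (e k) ` (E \<inter> D k)))" for E
  define M where "M = measure_of UNIV (sets borel) m"
  have sM: "sets M = sets borel"
    unfolding M_def using sets.sigma_sets_eq[of borel] by (simp add: sets_measure_of)
  have emM: "emeasure M E = m E" if "E \<in> sets borel" for E
  proof (rule emeasure_measure_of[OF M_def])
    show "positive (sets M) m" by (simp add: positive_def m_def)
    show "countably_additive (sets M) m"
    proof (rule countably_additiveI)
      fix E :: "nat \<Rightarrow> 'm set"
      assume E: "range E \<subseteq> sets M" "disjoint_family E"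
      have "(\<Sum>i. m (E i)) = (\<Sum>k. \<Sum>i. emeasure (chart_measure (e k)) (snd (e k) ` (E i \<inter> D k)))"
        unfolding m_def by (rule suminf_swap_ennreal)
      also have "\<dots> = (\<Sum>k. emeasure (chart_measure (e k)) (snd (e k) ` (\<Union>i. E i \<inter> D k)))"
      proof (intro arg_cong[of _ _ suminf] ext)
        fix k
        show "(\<Sum>i. emeasure (chart_measure (e k)) (snd (e k) ` (E i \<inter> D k))) = emeasure (chart_measure (e k)) (snd (e k) ` (\<Union>i. E i \<inter> D k))"
          using E De[of k] Db[of k] sM by (intro chart_measure_suminf e) (auto simp: disjoint_family_on_def)
      qed
      finally show "(\<Sum>i. m (E i)) = m (\<Union>i. E i)" by (simp add: m_def)
    qed
  qed (use that sM in auto)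
  have "volume_property M"
    unfolding volume_property_iff
  proof (intro conjI sM ballI impI)
    fix c E assume c: "c \<in> A" and E: "E \<in> sets borel" "E \<subseteq> fst c"
    have "emeasure M E = (\<Sum>k. emeasure (chart_measure c) (snd c ` (E \<inter> D k)))"
      unfolding emM[OF E(1)] m_def
    proof (intro arg_cong[of _ _ suminf] ext chart_measure_agree e c)
      show "E \<inter> D k \<in> sets borel" for k using E Db by auto
    qed (use E De in auto)
    also have "\<dots> = emeasure (chart_measure c) (snd c ` (\<Union>k. E \<inter> D k))"
      using E Db by (intro chart_measure_suminf c fam) auto
    also have "(\<Union>k. E \<inter> D k) = E" using DU by blast
    finally show "emeasure M E = emeasure (chart_measure c) (snd c ` E)" .
  qed
  moreover have "M1 = M2" if "volume_property M1" "volume_property M2" for M1 M2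
  proof (rule measure_eqI)
    show "sets M1 = sets M2" using that by (simp add: volume_property_def)
    fix E assume "E \<in> sets M1"
    then have E: "E \<in> sets borel" using that by (simp add: volume_property_def)
    have "emeasure M' E = (\<Sum>k. emeasure (chart_measure (e k)) (snd (e k) ` (E \<inter> D k)))" if "volume_property M'" for M'
    proof -
      have "range (\<lambda>k. E \<inter> D k) \<subseteq> sets M'" using that E Db by (auto simp: volume_property_def)
      then have "emeasure M' (\<Union>k. E \<inter> D k) = (\<Sum>k. emeasure M' (E \<inter> D k))" by (intro suminf_emeasure[symmetric] fam)
      moreover have "emeasure M' (E \<inter> D k) = emeasure (chart_measure (e k)) (snd (e k) ` (E \<inter> D k))" for k
        using that e(1) E Db De[of k] by (simp add: volume_property_iff le_infI2)
      moreover have "(\<Union>k. E \<inter> D k) = E" using DU by blast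
      ultimately show ?thesis by simp
    qed
    then show "emeasure M1 E = emeasure M2 E" using that by simp
  qed
  ultimately show ?thesis by blast
qed

abbreviation V :: "'m measure" where "V \<equiv> riemannian_volume A g"

lemma volume_property_V: "volume_property V"
  using theI'[OF volume_exists_unique] by (simp add: riemannian_volume_def volume_property_def[abs_def])

lemma sets_V [simp, measurable_cong]: "sets V = sets borel"
  using volume_property_V by (simp add: volume_property_def)

lemma emeasure_V: "c \<in> A \<Longrightarrow> E \<in> sets borel \<Longrightarrow> E \<subseteq> fst c \<Longrightarrow> emeasure V E = emeasure (chart_measure c) (snd c ` E)"
  using volume_property_V by (simp add: volume_property_iff)

text \<open>The restriction of \<open>V\<close> to a chart domain is the image of
  \<open>chart_measure c\<close> under the extended inverse chart, which turns integrals of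
  functions living in one chart into Lebesgue integrals.\<close>

lemma integral_V_chart:
  fixes h :: "'m \<Rightarrow> real"
  assumes c: "c \<in> A" and h: "h \<in> borel_measurable borel" and out: "\<And>p. p \<notin> fst c \<Longrightarrow> h p = 0"
  shows "integrable V h \<longleftrightarrow> integrable lborel (\<lambda>x. indicator (chart_image c) x * chart_density c x * h (chart_inv c x))"
    and "(\<integral>p. h p \<partial>V) = (\<integral>x. indicator (chart_image c) x * chart_density c x * h (chart_inv c x) \<partial>lborel)"
proof -
  \<comment> \<open>\<open>p0\<close> is the value given to the inverse chart outside
    \<open>chart_image c\<close>, so that the extended map is Borel measurable;
    \<open>chart_measure c\<close> assigns no mass to that region.\<close>
  obtain p0 where p0: "p0 \<notin> fst c \<or> fst c = UNIV" by blast
  define \<psi> where "\<psi> x = (if x \<in> chart_image c then chart_inv c x else p0)" for x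
  have Ub: "fst c \<in> sets borel" "chart_image c \<in> sets borel" using open_domain[OF c] open_image[OF c] by auto
  have \<psi>m [measurable]: "\<psi> \<in> borel_measurable borel"
  proof -
    have "chart_inv c \<in> borel_measurable (restrict_space borel (chart_image c))"
      by (rule borel_measurable_continuous_on_restrict[OF continuous_on_chart_inv[OF c]])
    then show ?thesis unfolding \<psi>_def using Ub
      by (intro measurable_If_restrict_space_iff[THEN iffD2]) auto
  qed
  have indm: "(indicator (fst c) :: 'm \<Rightarrow> real) \<in> borel_measurable V" using Ub by simp
  have eqm: "density V (\<lambda>p. ennreal (indicator (fst c) p)) = distr (chart_measure c) borel \<psi>"
  proof (rule measure_eqI)
    fix E assume "E \<in> sets (density V (\<lambda>p. ennreal (indicator (fst c) p)))"
    then have E: "E \<in> sets borel" by simp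
    have "ennreal (indicator (fst c) p) * indicator E p = indicator (E \<inter> fst c) p" for p
      by (auto simp: indicator_def)
    moreover have "emeasure (density V (\<lambda>p. ennreal (indicator (fst c) p))) E
        = (\<integral>\<^sup>+p. ennreal (indicator (fst c) p) * indicator E p \<partial>V)"
      using E Ub by (intro emeasure_density) auto
    ultimately have "emeasure (density V (\<lambda>p. ennreal (indicator (fst c) p))) E = (\<integral>\<^sup>+p. indicator (E \<inter> fst c) p \<partial>V)"
      by simp
    also have "\<dots> = emeasure V (E \<inter> fst c)" using E Ub by (intro nn_integral_indicator) simp
    also have "\<dots> = emeasure (chart_measure c) (snd c ` (E \<inter> fst c))"
      using E Ub by (intro emeasure_V c) auto
    also have "\<dots> = emeasure (chart_measure c) (\<psi> -` E)"
    proof -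
      have im: "snd c ` (E \<inter> fst c) = \<psi> -` E \<inter> chart_image c"
        using image_chart_eq[OF c, of "E \<inter> fst c"] c by (auto simp: \<psi>_def)
      have Em: "\<psi> -` E \<in> sets borel" using measurable_sets[OF \<psi>m E] by simp
      have "emeasure (chart_measure c) X = emeasure (chart_measure c) (X \<inter> chart_image c)" if X: "X \<in> sets borel" for X
        unfolding chart_measure_def using X Ub measurable_chart_density'[OF c]
        by (subst (1 2) emeasure_density) (auto intro!: nn_integral_cong simp: indicator_def)
      from this[OF Em] show ?thesis by (simp add: im)
    qed
    finally show "emeasure (density V (\<lambda>p. ennreal (indicator (fst c) p))) E = emeasure (distr (chart_measure c) borel \<psi>) E"
      using E \<psi>m by (subst emeasure_distr) (simp_all add: chart_measure_def)
  qed simp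
  have hm: "h \<in> borel_measurable V" using h by (simp add: measurable_cong_sets[OF sets_V])
  have ind: "(\<lambda>p. indicator (fst c) p * h p) = h" using out by (auto simp: indicator_def fun_eq_iff)
  have h\<psi>: "(\<lambda>x. h (\<psi> x)) \<in> borel_measurable lborel" using h by measurable
  have \<psi>c: "\<psi> \<in> measurable (chart_measure c) borel" using \<psi>m by (simp add: chart_measure_def)
  have dn: "(\<lambda>x. indicator (chart_image c) x * chart_density c x) \<in> borel_measurable lborel"
    using measurable_chart_density'[OF c] by simp
  have nn: "AE x in lborel. 0 \<le> indicator (chart_image c) x * chart_density c x"
    using chart_density_pos[OF c] by (intro AE_I2) (auto simp: indicator_def less_imp_le)
  have \<psi>e: "(indicator (chart_image c) x * chart_density c x) *\<^sub>R h (\<psi> x) = indicator (chart_image c) x * chart_density c x * h (chart_inv c x)" for x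
    by (simp add: \<psi>_def indicator_def)
  have "integrable V h \<longleftrightarrow> integrable (distr (chart_measure c) borel \<psi>) h"
    using integrable_density[OF hm indm] eqm by (simp add: ind)
  also have "\<dots> \<longleftrightarrow> integrable (chart_measure c) (\<lambda>x. h (\<psi> x))"
    by (rule integrable_distr_eq[OF \<psi>c h])
  also have "\<dots> \<longleftrightarrow> integrable lborel (\<lambda>x. (indicator (chart_image c) x * chart_density c x) *\<^sub>R h (\<psi> x))"
    unfolding chart_measure_def by (rule integrable_density[OF h\<psi> dn nn])
  finally show "integrable V h \<longleftrightarrow> integrable lborel (\<lambda>x. indicator (chart_image c) x * chart_density c x * h (chart_inv c x))"
    unfolding \<psi>e .
  have "(\<integral>p. h p \<partial>V) = (\<integral>p. h p \<partial>distr (chart_measure c) borel \<psi>)"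
    using integral_density[OF hm indm] eqm by (simp add: ind)
  also have "\<dots> = (\<integral>x. h (\<psi> x) \<partial>chart_measure c)"
    by (rule integral_distr[OF \<psi>c h])
  also have "\<dots> = (\<integral>x. (indicator (chart_image c) x * chart_density c x) *\<^sub>R h (\<psi> x) \<partial>lborel)"
    unfolding chart_measure_def by (rule integral_density[OF h\<psi> dn nn])
  finally show "(\<integral>p. h p \<partial>V) = (\<integral>x. indicator (chart_image c) x * chart_density c x * h (chart_inv c x) \<partial>lborel)"
    unfolding \<psi>e .
qed

end

section \<open>Functions of class C1 and gradients on the manifold\<close>

lemma isCont_imp_continuous_on_open:
  fixes h :: "'a::t2_space \<Rightarrow> 'b::topological_space"
  shows "open S \<Longrightarrow> (\<And>x. x \<in> S \<Longrightarrow> \<exists>X. open X \<and> x \<in> X \<and> continuous_on X h) \<Longrightarrow> continuous_on S h"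
proof (intro continuous_at_imp_continuous_on ballI)
  fix x assume "x \<in> S" and *: "\<And>x. x \<in> S \<Longrightarrow> \<exists>X. open X \<and> x \<in> X \<and> continuous_on X h"
  then obtain X where "open X" "x \<in> X" "continuous_on X h" by blast
  then show "isCont h x" by (simp add: continuous_on_eq_continuous_at)
qed

lemma partial_chain:
  fixes h :: "real ^ 'n::finite \<Rightarrow> real" and T :: "real ^ 'n \<Rightarrow> real ^ 'n"
  assumes "T differentiable (at x)" "h differentiable (at (T x))"
  shows "(\<lambda>y. h (T y)) differentiable (at x)"
    and "partial i (\<lambda>y. h (T y)) x = (\<Sum>k\<in>UNIV. partial i T x $ k * partial k h (T x))"
proof -
  have "((\<lambda>y. h (T y)) has_derivative (\<lambda>v. \<Sum>k\<in>UNIV. frechet_derivative T (at x) v $ k *\<^sub>R partial k h (T x))) (at x)"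
    using has_derivative_compose[OF frechet_derivative_works[THEN iffD1, OF assms(1)] has_derivative_partial_sum[OF assms(2)]]
    by simp
  then show "(\<lambda>y. h (T y)) differentiable (at x)" "partial i (\<lambda>y. h (T y)) x = (\<Sum>k\<in>UNIV. partial i T x $ k * partial k h (T x))"
    using partial_eqI differentiableI by (blast, fastforce simp: partial_def)
qed

lemma partial_compose_real:
  fixes h :: "real ^ 'n::finite \<Rightarrow> real"
  assumes "h differentiable (at x)" "(q has_real_derivative q') (at (h x))"
  shows "(\<lambda>y. q (h y)) differentiable (at x)" and "partial i (\<lambda>y. q (h y)) x = q' * partial i h x"
proof -
  have "((\<lambda>y. q (h y)) has_derivative (\<lambda>v. q' * frechet_derivative h (at x) v)) (at x)"
    using has_derivative_compose[OF frechet_derivative_works[THEN iffD1, OF assms(1)] assms(2)[unfolded has_field_derivative_def]]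
    by simp
  then show "(\<lambda>y. q (h y)) differentiable (at x)" "partial i (\<lambda>y. q (h y)) x = q' * partial i h x"
    using partial_eqI differentiableI by (blast, fastforce simp: partial_def)
qed

section \<open>C1 cutoff functions\<close>

definition pos_sq :: "real \<Rightarrow> real" where "pos_sq t = (max 0 t)\<^sup>2"

text \<open>Squaring makes the positive part C1: at zero the difference quotient is bounded by
  \<open>abs h\<close>.\<close>

lemma pos_sq_has_derivative: "(pos_sq has_real_derivative 2 * max 0 t) (at t)"
proof -
  consider "t > 0" | "t < 0" | "t = 0" by linarith
  then show ?thesis
  proof cases
    case 1
    have "((\<lambda>t. t\<^sup>2) has_real_derivative 2 * t) (at t)" by (auto intro!: derivative_eq_intros)
    then have "(pos_sq has_real_derivative 2 * t) (at t)"
      by (rule DERIV_cong_ev[THEN iffD1, rotated 3])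
        (use eventually_gt_at_top[of 0] 1 in \<open>auto simp: pos_sq_def eventually_nhds intro!: exI[of _ "{0<..}"]\<close>)
    then show ?thesis using 1 by simp
  next
    case 2
    have "((\<lambda>t. 0) has_real_derivative 0) (at t)" by simp
    then have "(pos_sq has_real_derivative 0) (at t)"
      by (rule DERIV_cong_ev[THEN iffD1, rotated 3])
        (use 2 in \<open>auto simp: pos_sq_def eventually_nhds intro!: exI[of _ "{..<0}"]\<close>)
    then show ?thesis using 2 by simp
  next
    case 3
    have "((\<lambda>h. (pos_sq (0 + h) - pos_sq 0) / h) \<longlongrightarrow> 0) (at 0)"
    proof (rule Lim_null_comparison)
      show "\<forall>\<^sub>F h in at 0. norm ((pos_sq (0 + h) - pos_sq 0) / h) \<le> \<bar>h\<bar>"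
        by (intro always_eventually) (auto simp: pos_sq_def max_def power2_eq_square)
      show "((\<lambda>h. \<bar>h\<bar>) \<longlongrightarrow> 0) (at (0::real))" by (intro tendsto_eq_intros) auto
    qed
    then show ?thesis using 3 by (simp add: DERIV_def)
  qed
qed

lemma pos_sq_simps: "t \<le> 0 \<Longrightarrow> pos_sq t = 0" "t \<ge> 0 \<Longrightarrow> pos_sq t = t\<^sup>2" "pos_sq t \<ge> 0"
  by (auto simp: pos_sq_def max_def)

text \<open>A C1 step from 0 to 1. The denominator never vanishes, because \<open>t\<close> and
  \<open>1 - t\<close> cannot both be nonpositive.\<close>

definition cutoff :: "real \<Rightarrow> real" where "cutoff t = pos_sq t / (pos_sq t + pos_sq (1 - t))"

lemma cutoff_denom_pos: "pos_sq t + pos_sq (1 - t) > 0"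
proof -
  have "pos_sq t > 0 \<or> pos_sq (1 - t) > 0" by (cases "t > 0") (auto simp: pos_sq_def max_def)
  then show ?thesis using pos_sq_simps(3)[of t] pos_sq_simps(3)[of "1 - t"] by linarith
qed

lemma cutoff_0: "t \<le> 0 \<Longrightarrow> cutoff t = 0" and cutoff_1: "t \<ge> 1 \<Longrightarrow> cutoff t = 1"
  by (auto simp: cutoff_def pos_sq_simps)

definition cutoff' :: "real \<Rightarrow> real" where
  "cutoff' t = (2 * max 0 t * (pos_sq t + pos_sq (1 - t)) - pos_sq t * (2 * max 0 t - 2 * max 0 (1 - t))) / (pos_sq t + pos_sq (1 - t))\<^sup>2"

lemma cutoff_has_derivative: "(cutoff has_real_derivative cutoff' t) (at t)"
proof -
  have "((\<lambda>t. pos_sq (1 - t)) has_real_derivative 2 * max 0 (1 - t) * (- 1)) (at t)"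
    by (rule DERIV_chain2[OF pos_sq_has_derivative]) (auto intro!: derivative_eq_intros)
  then have "((\<lambda>t. pos_sq t + pos_sq (1 - t)) has_real_derivative 2 * max 0 t - 2 * max 0 (1 - t)) (at t)"
    by (auto intro!: derivative_eq_intros pos_sq_has_derivative)
  from DERIV_divide[OF pos_sq_has_derivative this] cutoff_denom_pos[of t]
  have "((\<lambda>t. pos_sq t / (pos_sq t + pos_sq (1 - t))) has_real_derivative cutoff' t) (at t)"
    by (simp add: cutoff'_def power2_eq_square)
  then show ?thesis by (simp add: cutoff_def[abs_def])
qed

lemma continuous_cutoff': "continuous_on UNIV cutoff'"
proof -
  have "pos_sq t + pos_sq (1 - t) \<noteq> 0" for t using cutoff_denom_pos[of t] by simp
  moreover have "continuous_on UNIV pos_sq"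
    using DERIV_isCont[OF pos_sq_has_derivative] by (simp add: continuous_at_imp_continuous_on)
  moreover from this have "continuous_on UNIV (\<lambda>t. pos_sq (1 - t))"
    by (rule continuous_on_compose2) (auto intro!: continuous_intros)
  ultimately show ?thesis unfolding cutoff'_def by (intro continuous_intros) auto
qed

context riemannian_manifold
begin

abbreviation rep :: "('m, 'n) chart \<Rightarrow> ('m \<Rightarrow> real) \<Rightarrow> real ^ 'n \<Rightarrow> real" where
  "rep c h \<equiv> h \<circ> chart_inv c"

text \<open>The condition is imposed on a neighbourhood that may be small, so that it can be carried
  to any other chart around the point, however small the overlap.\<close>

definition C1_at :: "('m, 'n) chart \<Rightarrow> ('m \<Rightarrow> real) \<Rightarrow> real ^ 'n \<Rightarrow> bool" where
  "C1_at c h x \<longleftrightarrow> (\<exists>X. open X \<and> x \<in> X \<and> X \<subseteq> chart_image c \<and> (\<forall>y\<in>X. rep c h differentiable (at y))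
     \<and> (\<forall>i. continuous_on X (partial i (rep c h))))"

definition C1 :: "('m \<Rightarrow> real) \<Rightarrow> bool" where
  "C1 h \<longleftrightarrow> (\<forall>c\<in>A. \<forall>x\<in>chart_image c. C1_at c h x)"

lemma C1_differentiable: "C1 h \<Longrightarrow> c \<in> A \<Longrightarrow> x \<in> chart_image c \<Longrightarrow> rep c h differentiable (at x)"
  unfolding C1_def C1_at_def by blast

lemma C1_continuous_partial: "C1 h \<Longrightarrow> c \<in> A \<Longrightarrow> continuous_on (chart_image c) (partial i (rep c h))"
proof (rule isCont_imp_continuous_on_open[OF open_image])
  fix x assume "C1 h" "c \<in> A" "x \<in> chart_image c"
  then have "C1_at c h x" by (simp add: C1_def)
  then show "\<exists>X. open X \<and> x \<in> X \<and> continuous_on X (partial i (rep c h))" unfolding C1_at_def by blast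
qed

lemma C1_I:
  "(\<And>c x. c \<in> A \<Longrightarrow> x \<in> chart_image c \<Longrightarrow> rep c h differentiable (at x)) \<Longrightarrow>
   (\<And>c i. c \<in> A \<Longrightarrow> continuous_on (chart_image c) (partial i (rep c h))) \<Longrightarrow> C1 h"
  unfolding C1_def C1_at_def 
proof (intro ballI)
  fix c x assume *: "\<And>c x. c \<in> A \<Longrightarrow> x \<in> chart_image c \<Longrightarrow> rep c h differentiable (at x)"
    "\<And>c i. c \<in> A \<Longrightarrow> continuous_on (chart_image c) (partial i (rep c h))" and c: "c \<in> A" "x \<in> chart_image c"
  then show "\<exists>X. open X \<and> x \<in> X \<and> X \<subseteq> chart_image c \<and> (\<forall>y\<in>X. rep c h differentiable at y) \<and>
      (\<forall>i. continuous_on X (partial i (rep c h)))"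
    using open_image[OF c(1)] by blast
qed

lemma continuous_on_rep:
  "C1 h \<Longrightarrow> c \<in> A \<Longrightarrow> continuous_on (chart_image c) (rep c h)"
  by (rule continuous_at_imp_continuous_on) (use C1_differentiable differentiable_imp_continuous_within in blast)

lemma continuous_on_domain:
  assumes "c \<in> A" "continuous_on (chart_image c) q"
  shows "continuous_on (fst c) (\<lambda>p. q (snd c p))"
  by (rule continuous_on_compose2[OF assms(2) continuous_on_chart[OF assms(1)]]) auto

lemma C1_continuous:
  assumes "C1 h" shows "continuous_on UNIV h"
proof (rule isCont_imp_continuous_on_open)
  fix p :: 'm
  obtain c where c: "c \<in> A" "p \<in> fst c" by (rule chart_at)
  have "continuous_on (fst c) (\<lambda>p. rep c h (snd c p))"
    by (rule continuous_on_domain[OF c(1) continuous_on_rep[OF assms c(1)]])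
  then have "continuous_on (fst c) h" by (rule continuous_on_cong[THEN iffD1, rotated 2]) (auto simp: c)
  then show "\<exists>X. open X \<and> p \<in> X \<and> continuous_on X h" using c open_domain by blast
qed simp

lemma rep_transition:
  "c \<in> A \<Longrightarrow> d \<in> A \<Longrightarrow> y \<in> snd d ` (fst d \<inter> fst c) \<Longrightarrow> rep d h y = rep c h (transition d c y)"
  by (auto simp: transition_def)

lemma transition_partial:
  assumes "c \<in> A" "d \<in> A" "y \<in> snd d ` (fst d \<inter> fst c)" "rep c h differentiable (at (transition d c y))"
  shows "rep d h differentiable (at y)"
    and "partial i (rep d h) y = (\<Sum>k\<in>UNIV. partial i (transition d c) y $ k * partial k (rep c h) (transition d c y))"
proof -
  let ?O = "snd d ` (fst d \<inter> fst c)"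
  have oo: "open ?O" by (rule open_overlap[OF assms(2,1)])
  note T = smooth_on_differentiable[OF smooth_transition[OF assms(2,1)] assms(3)]
  note ch = partial_chain[OF T assms(4)]
  have "(rep d h has_derivative frechet_derivative (\<lambda>y. rep c h (transition d c y)) (at y)) (at y)"
    by (rule has_derivative_transform_within_open[OF frechet_derivative_works[THEN iffD1, OF ch(1)] oo assms(3)])
      (simp only: rep_transition[OF assms(1,2)])
  then show "rep d h differentiable (at y)" using differentiableI by blast
  have "partial i (rep d h) y = partial i (\<lambda>y. rep c h (transition d c y)) y"
    by (rule partial_cong[OF oo assms(3)]) (simp only: rep_transition[OF assms(1,2)])
  then show "partial i (rep d h) y = (\<Sum>k\<in>UNIV. partial i (transition d c) y $ k * partial k (rep c h) (transition d c y))"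
    using ch(2)[of i] by (rule trans)
qed

lemma C1_at_transition:
  assumes "c \<in> A" "d \<in> A" "y \<in> snd d ` (fst d \<inter> fst c)" "C1_at c h (transition d c y)"
  shows "C1_at d h y"
proof -
  let ?O = "snd d ` (fst d \<inter> fst c)" let ?T = "transition d c"
  obtain X where X: "open X" "?T y \<in> X" "X \<subseteq> chart_image c" "\<And>z. z \<in> X \<Longrightarrow> rep c h differentiable (at z)"
    "\<And>i. continuous_on X (partial i (rep c h))"
    using assms(4) unfolding C1_at_def by blast
  have oo: "open ?O" by (rule open_overlap[OF assms(2,1)])
  have cT: "continuous_on ?O ?T" by (rule smooth_on_continuous_on[OF smooth_transition[OF assms(2,1)]])
  define Y where "Y = ?O \<inter> ?T -` X"
  have oY: "open Y" unfolding Y_def by (rule continuous_open_preimage[OF cT oo X(1)])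
  have YO: "Y \<subseteq> ?O" by (auto simp: Y_def)
  have TY: "?T z \<in> X" if "z \<in> Y" for z using that by (simp add: Y_def)
  show ?thesis unfolding C1_at_def
  proof (intro exI[of _ Y] conjI ballI allI oY)
    show "y \<in> Y" using assms(3) X(2) by (simp add: Y_def)
    show "Y \<subseteq> chart_image d" using YO by (auto simp: chart_image_def)
    show "rep d h differentiable (at z)" if "z \<in> Y" for z
      using transition_partial(1)[OF assms(1,2)] X(4) TY YO that by blast
    have "continuous_on Y (\<lambda>z. \<Sum>k\<in>UNIV. partial i ?T z $ k * partial k (rep c h) (?T z))" for i
    proof (intro continuous_on_sum continuous_on_mult)
      fix k
      have "smooth_on ?O (\<lambda>z. partial i ?T z $ k)"
        by (intro smooth_on_nth smooth_on_partial smooth_transition oo assms)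
      then show "continuous_on Y (\<lambda>z. partial i ?T z $ k)"
        using smooth_on_continuous_on continuous_on_subset YO by blast
      show "continuous_on Y (\<lambda>z. partial k (rep c h) (?T z))"
        by (rule continuous_on_compose2[OF X(5) continuous_on_subset[OF cT YO]]) (use TY in auto)
    qed
    then show "continuous_on Y (partial i (rep d h))" for i
    proof (rule continuous_on_cong[THEN iffD1, rotated 2])
      fix z assume "z \<in> Y"
      then show "(\<Sum>k\<in>UNIV. partial i ?T z $ k * partial k (rep c h) (?T z)) = partial i (rep d h) z"
        using transition_partial(2)[OF assms(1,2), of z h i] X(4) TY YO by auto
    qed simp
  qed
qed

text \<open>Regularity may be checked in one convenient chart at each point: for a bump function,
  its own chart on the domain of that chart, and elsewhere any chart, where it vanishes
  locally.\<close>

lemma C1_local: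
  assumes "\<And>p. \<exists>c\<in>A. p \<in> fst c \<and> C1_at c h (snd c p)"
  shows "C1 h"
  unfolding C1_def
proof (intro ballI)
  fix d y assume d: "d \<in> A" and y: "y \<in> chart_image d"
  obtain c where c: "c \<in> A" "chart_inv d y \<in> fst c" "C1_at c h (snd c (chart_inv d y))" using assms by blast
  show "C1_at d h y"
  proof (rule C1_at_transition[OF c(1) d])
    show "y \<in> snd d ` (fst d \<inter> fst c)" using c(2) d y by (metis IntI chart_chart_inv chart_inv_in image_eqI)
    show "C1_at c h (transition d c y)" using c(3) by (simp add: transition_def)
  qed
qed

lemma C1_const: "C1 (\<lambda>p. a)"
  by (rule C1_I) (simp_all add: o_def partial_const[abs_def])

lemma C1_compose:
  assumes "C1 h" "\<And>t. t \<in> range h \<Longrightarrow> (q has_real_derivative q' t) (at t)" "continuous_on (range h) q'"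
  shows "C1 (\<lambda>p. q (h p))"
    and "c \<in> A \<Longrightarrow> x \<in> chart_image c \<Longrightarrow> partial i (rep c (\<lambda>p. q (h p))) x = q' (h (chart_inv c x)) * partial i (rep c h) x"
proof -
  have eq: "rep c (\<lambda>p. q (h p)) = (\<lambda>y. q (rep c h y))" for c by (simp add: o_def)
  show p: "partial i (rep c (\<lambda>p. q (h p))) x = q' (h (chart_inv c x)) * partial i (rep c h) x"
    if "c \<in> A" "x \<in> chart_image c" for c x i
    unfolding eq
    using partial_compose_real(2)[OF C1_differentiable[OF assms(1) that] assms(2)[of "rep c h x"], of i]
    by (simp add: o_def del: mult_cancel_left)
  show "C1 (\<lambda>p. q (h p))"
  proof (rule C1_I)
    fix c assume c: "c \<in> A"
    show "rep c (\<lambda>p. q (h p)) differentiable (at x)" if "x \<in> chart_image c" for x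
      unfolding eq by (rule partial_compose_real(1)[OF C1_differentiable[OF assms(1) c that] assms(2)]) simp
    have *: "continuous_on (chart_image c) (\<lambda>x. q' (rep c h x) * partial i (rep c h) x)" for i
      by (intro continuous_on_mult C1_continuous_partial assms c
          continuous_on_compose2[OF assms(3) continuous_on_rep[OF assms(1) c]]) auto
    show "continuous_on (chart_image c) (partial i (rep c (\<lambda>p. q (h p))))" for i
      by (rule continuous_on_cong[THEN iffD1, OF refl _ *[of i]]) (simp add: p c)
  qed
qed

lemma C1_mult:
  assumes "C1 h" "C1 k"
  shows "C1 (\<lambda>p. h p * k p)"
proof (rule C1_I)
  fix c assume c: "c \<in> A"
  have eq: "rep c (\<lambda>p. h p * k p) = (\<lambda>y. rep c h y * rep c k y)" by (simp add: o_def)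
  show "rep c (\<lambda>p. h p * k p) differentiable (at x)" if "x \<in> chart_image c" for x
    unfolding eq by (intro differentiable_mult C1_differentiable assms c that)
  have "continuous_on (chart_image c) (\<lambda>x. rep c h x * partial i (rep c k) x + partial i (rep c h) x * rep c k x)" for i
    by (intro continuous_on_add continuous_on_mult C1_continuous_partial continuous_on_rep assms c)
  then show "continuous_on (chart_image c) (partial i (rep c (\<lambda>p. h p * k p)))" for i
    by (rule continuous_on_cong[THEN iffD1, rotated 2]) (simp_all only: eq partial_mult C1_differentiable assms c)
qed

lemma C1_diff:
  assumes "C1 h" "C1 k"
  shows "C1 (\<lambda>p. h p - k p)"
proof (rule C1_I)
  fix c assume c: "c \<in> A"
  have eq: "rep c (\<lambda>p. h p - k p) = (\<lambda>y. rep c h y - rep c k y)" by (simp add: o_def)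
  show "rep c (\<lambda>p. h p - k p) differentiable (at x)" if "x \<in> chart_image c" for x
    unfolding eq by (intro differentiable_diff C1_differentiable assms c that)
  have "continuous_on (chart_image c) (\<lambda>x. partial i (rep c h) x - partial i (rep c k) x)" for i
    by (intro continuous_on_diff C1_continuous_partial assms c)
  then show "continuous_on (chart_image c) (partial i (rep c (\<lambda>p. h p - k p)))" for i
    by (rule continuous_on_cong[THEN iffD1, rotated 2]) (simp_all only: eq partial_diff C1_differentiable assms c)
qed

lemma smooth_function_C1: "smooth_function A h \<Longrightarrow> C1 h"
  by (rule C1_I) (auto simp: smooth_function_def intro: smooth_on_differentiable smooth_on_continuous_on smooth_on_partial)

section \<open>Inner products of gradients\<close>

definition dh :: "('m, 'n) chart \<Rightarrow> ('m \<Rightarrow> real) \<Rightarrow> real ^ 'n \<Rightarrow> real ^ 'n" where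
  "dh c h x = (\<chi> b. partial b (rep c h) x)"

text \<open>The inner product of the two gradients, expressed through the differentials and the
  inverse metric.\<close>

definition gip_chart :: "('m, 'n) chart \<Rightarrow> ('m \<Rightarrow> real) \<Rightarrow> ('m \<Rightarrow> real) \<Rightarrow> real ^ 'n \<Rightarrow> real" where
  "gip_chart c h k x = dh c h x \<bullet> (matrix_inv (g c x) *v dh c k x)"

text \<open>Since \<open>gip_chart\<close> is independent of the chart, the choice below is immaterial.\<close>

definition gip :: "('m \<Rightarrow> real) \<Rightarrow> ('m \<Rightarrow> real) \<Rightarrow> 'm \<Rightarrow> real" where
  "gip h k p = (let c = (SOME c. c \<in> A \<and> p \<in> fst c) in gip_chart c h k (snd c p))"

text \<open>Differentials transform by the transposed Jacobian, and inverting the transformation law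
  of the metric gives \<open>?J ** matrix_inv ?Gd ** transpose ?J = matrix_inv ?Gc\<close>, so the
  Jacobians are absorbed.\<close>

lemma gip_chart_transition:
  assumes c: "c \<in> A" and d: "d \<in> A" and y: "y \<in> snd d ` (fst d \<inter> fst c)"
    and h: "rep c h differentiable (at (transition d c y))" and k: "rep c k differentiable (at (transition d c y))"
  shows "gip_chart d h k y = gip_chart c h k (transition d c y)"
proof -
  let ?T = "transition d c" let ?J = "jacobian ?T (at y)"
  let ?Gd = "g d y" and ?Gc = "g c (?T y)"
  have yd: "y \<in> chart_image d" using y by (auto simp: chart_image_def)
  have Tc: "?T y \<in> chart_image c" by (rule transition_in[OF d c y])
  have J: "?J $ k $ i = partial i ?T y $ k" for i k
    using partial_eqI[OF transition_has_derivative[OF d c y], of i] by (simp add: matrix_vector_mult_basis column_def)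
  have dh_tr: "dh d q y = transpose ?J *v dh c q (?T y)" if "rep c q differentiable (at (?T y))" for q
    by (simp add: vec_eq_iff dh_def transition_partial(2)[OF c d y that] matrix_vector_mult_def transpose_def J
        del: transpose_matrix_vector)
  have G: "?Gd = transpose ?J ** ?Gc ** ?J" by (rule metric_transformation[OF d c y])
  have invd: "invertible ?Gd" and invc: "invertible ?Gc"
    using metric_chart.invertible_G metric_chart c d yd Tc by blast+
  have detJ: "det ?J \<noteq> 0" using invd unfolding invertible_det_nz G by (auto simp: det_mul)
  then have Ji: "invertible ?J" by (simp add: invertible_det_nz)
  let ?M = "?J ** matrix_inv ?Gd ** transpose ?J"
  have "?J = ?J ** (matrix_inv ?Gd ** ?Gd)" by (simp add: matrix_inv_inverse[OF invd])
  also have "\<dots> = (?M ** ?Gc) ** ?J" by (subst (2) G) (simp only: matrix_mul_assoc)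
  finally have "?J ** matrix_inv ?J = ((?M ** ?Gc) ** ?J) ** matrix_inv ?J" by simp
  then have "?M ** ?Gc = mat 1"
    by (simp add: matrix_mul_assoc[symmetric] matrix_inv_inverse[OF Ji])
  then have "(?M ** ?Gc) ** matrix_inv ?Gc = matrix_inv ?Gc" by simp
  then have M: "?M = matrix_inv ?Gc" by (simp add: matrix_mul_assoc[symmetric] matrix_inv_inverse[OF invc])
  have "gip_chart d h k y = (transpose ?J *v dh c h (?T y)) \<bullet> (matrix_inv ?Gd *v (transpose ?J *v dh c k (?T y)))"
    unfolding gip_chart_def dh_tr[OF h] dh_tr[OF k] ..
  also have "\<dots> = dh c h (?T y) \<bullet> (?J *v (matrix_inv ?Gd *v (transpose ?J *v dh c k (?T y))))"
    by (subst transpose_matrix_vector) (rule dot_lmul_matrix)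
  also have "\<dots> = dh c h (?T y) \<bullet> (?M *v dh c k (?T y))"
    by (simp only: matrix_vector_mul_assoc matrix_mul_assoc)
  finally show ?thesis unfolding M by (simp add: gip_chart_def)
qed

lemma gip_eq:
  assumes "C1 h" "C1 k" "c \<in> A" "p \<in> fst c"
  shows "gip h k p = gip_chart c h k (snd c p)"
proof -
  define e where "e = (SOME c. c \<in> A \<and> p \<in> fst c)"
  have e: "e \<in> A" "p \<in> fst e" using someI_ex[of "\<lambda>c. c \<in> A \<and> p \<in> fst c"] assms(3,4) unfolding e_def by blast+
  have T: "transition e c (snd e p) = snd c p" using e by (simp add: transition_def)
  have "gip_chart e h k (snd e p) = gip_chart c h k (transition e c (snd e p))"
    by (rule gip_chart_transition[OF assms(3) e(1)]) (use e assms T C1_differentiable in auto)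
  then show ?thesis by (simp add: gip_def e_def[symmetric] Let_def T)
qed

text \<open>A cutoff of a quadratic function of the coordinates in a small ball of one chart,
  extended by zero. The extension is C1 because the image \<open>K\<close> of the closed ball is
  compact, hence closed, so that off the chart domain the function vanishes on an open set.\<close>

lemma exists_bump:
  assumes "open U" "p \<in> U" "c \<in> A" "p \<in> fst c"
  obtains b K P where "C1 b" "compact K" "K \<subseteq> U \<inter> fst c" "\<And>q. q \<notin> K \<Longrightarrow> b q = 0" "\<And>q. b q \<ge> 0"
    "open P" "p \<in> P" "\<And>q. q \<in> P \<Longrightarrow> b q = 1"
proof -
  let ?x = "snd c p"
  have eqU: "snd c ` (U \<inter> fst c) = chart_image c \<inter> chart_inv c -` U"
    using image_chart_eq[OF assms(3), of "U \<inter> fst c"] assms(3) by auto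
  have "open (snd c ` (U \<inter> fst c))"
    unfolding eqU
    by (rule continuous_open_preimage[OF continuous_on_chart_inv[OF assms(3)] open_image[OF assms(3)] assms(1)])
  moreover have "?x \<in> snd c ` (U \<inter> fst c)" using assms by blast
  ultimately obtain r where r: "r > 0" "cball ?x r \<subseteq> snd c ` (U \<inter> fst c)" using open_contains_cball by metis
  have cbi: "cball ?x r \<subseteq> chart_image c" using r(2) by (auto simp: chart_image_def)
  \<comment> \<open>The argument of \<open>cutoff\<close> is at least 1 where
    \<open>|y - x|^2 \<le> r^2 / 2\<close>, hence near the centre, and at most 0 outside radius
    \<open>r\<close>.\<close>
  define \<beta> where "\<beta> y = cutoff (2 - 2 * ((y - ?x) \<bullet> (y - ?x)) / r\<^sup>2)" for y
  define b where "b q = (if q \<in> fst c then \<beta> (snd c q) else 0)" for q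
  define K where "K = chart_inv c ` cball ?x r"
  define P where "P = fst c \<inter> snd c -` {y. (y - ?x) \<bullet> (y - ?x) < r\<^sup>2 / 2}"
  have \<beta>0: "\<beta> y = 0" if "y \<notin> cball ?x r" for y
  proof -
    have "norm (y - ?x) > r" using that by (simp add: dist_norm norm_minus_commute)
    then have "(y - ?x) \<bullet> (y - ?x) > r\<^sup>2" using r(1)
      by (metis power2_norm_eq_inner abs_of_pos less_imp_le power_strict_mono zero_less_numeral)
    then show ?thesis unfolding \<beta>_def using r(1) by (intro cutoff_0) (simp add: field_simps)
  qed
  have Kc: "compact K" unfolding K_def
    by (intro compact_continuous_image continuous_on_subset[OF continuous_on_chart_inv[OF assms(3)] cbi] compact_cball)
  have KU: "K \<subseteq> U \<inter> fst c"
  proof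
    fix q assume "q \<in> K"
    then obtain y where y: "y \<in> cball ?x r" "q = chart_inv c y" by (auto simp: K_def)
    then obtain q' where "q' \<in> U \<inter> fst c" "y = snd c q'" using r(2) by blast
    then show "q \<in> U \<inter> fst c" using y assms(3) by simp
  qed
  have bK: "b q = 0" if "q \<notin> K" for q
  proof (cases "q \<in> fst c")
    case True
    then have "snd c q \<notin> cball ?x r" using that assms(3) K_def by (metis chart_inverse image_eqI)
    then show ?thesis using \<beta>0 True by (simp add: b_def)
  qed (simp add: b_def)
  show thesis
  proof (rule that[of b K P])
    show "C1 b"
    proof (rule C1_local)
      fix q :: 'm
      show "\<exists>c\<in>A. q \<in> fst c \<and> C1_at c b (snd c q)"
      proof (cases "q \<in> fst c")
        case True
        define d where "d y = 2 - 2 * ((y - ?x) \<bullet> (y - ?x)) / r\<^sup>2" for y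
        have der: "(d has_derivative (\<lambda>v. 0 - (2 / r\<^sup>2) * ((y - ?x) \<bullet> v + v \<bullet> (y - ?x)))) (at y)" for y
        proof -
          have "((\<lambda>y. 2 - (2 / r\<^sup>2) * ((y - ?x) \<bullet> (y - ?x))) has_derivative
              (\<lambda>v. 0 - (2 / r\<^sup>2) * ((y - ?x) \<bullet> v + v \<bullet> (y - ?x)))) (at y)"
            by (intro has_derivative_diff has_derivative_const has_derivative_mult_right has_derivative_inner)
              (auto intro!: derivative_eq_intros)
          then show ?thesis by (simp add: d_def[abs_def])
        qed
        have dd: "d differentiable (at y)" for y using der differentiableI by blast
        have dp: "partial i d y = - 4 * (y - ?x) $ i / r\<^sup>2" for i y
          using partial_eqI[OF der, of i y] r(1) by (simp add: inner_axis inner_axis' field_simps)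
        have \<beta>d: "\<beta> differentiable (at y)" "partial i \<beta> y = cutoff' (d y) * partial i d y" for i y
          unfolding \<beta>_def[abs_def] d_def[symmetric] by (rule partial_compose_real[OF dd cutoff_has_derivative])+
        have cd: "continuous_on UNIV d" unfolding d_def using r(1) by (intro continuous_intros) auto
        have \<beta>c: "continuous_on UNIV (partial i \<beta>)" for i
          unfolding \<beta>d(2)[abs_def] dp using r(1)
          by (intro continuous_on_mult continuous_on_compose2[OF continuous_cutoff' cd] continuous_intros) auto
        have eq: "rep c b y = \<beta> y" if "y \<in> chart_image c" for y using that assms(3) by (simp add: b_def)
        have "C1_at c b (snd c q)"
          unfolding C1_at_def
        proof (intro exI[of _ "chart_image c"] conjI ballI allI)
          show "rep c b differentiable (at y)" if "y \<in> chart_image c" for y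
            using has_derivative_transform_within_open[OF frechet_derivative_works[THEN iffD1, OF \<beta>d(1)] open_image[OF assms(3)] that, of "rep c b"]
            eq differentiableI by (metis (no_types, lifting))
          show "continuous_on (chart_image c) (partial i (rep c b))" for i
            by (rule continuous_on_cong[THEN iffD1, OF refl _ continuous_on_subset[OF \<beta>c subset_UNIV]])
              (rule partial_cong[OF open_image[OF assms(3)]], simp_all add: eq[symmetric])
        qed (use True assms(3) open_image in auto)
        then show ?thesis using True assms(3) by blast
      next
        case False
        then have qK: "q \<notin> K" using KU by blast
        obtain e where e: "e \<in> A" "q \<in> fst e" by (rule chart_at)
        let ?X = "chart_image e \<inter> chart_inv e -` (- K)"
        have oX: "open ?X"
          by (rule continuous_open_preimage[OF continuous_on_chart_inv[OF e(1)] open_image[OF e(1)]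
                open_Compl[OF compact_imp_closed[OF Kc]]])
        have eq: "rep e b y = 0" if "y \<in> ?X" for y using that bK by simp
        have "C1_at e b (snd e q)"
          unfolding C1_at_def
        proof (intro exI[of _ ?X] conjI ballI allI oX)
          have "((\<lambda>y. 0) has_derivative (\<lambda>v. 0)) (at y)" for y :: "real ^ 'n" by simp
          from has_derivative_transform_within_open[OF this oX, of _ "rep e b"] eq
          show "rep e b differentiable (at y)" if "y \<in> ?X" for y using that by (auto simp: differentiable_def)
          have "partial i (rep e b) y = 0" if "y \<in> ?X" for y i
            using partial_cong[OF oX that, of "rep e b" "\<lambda>_. 0"] eq by (simp add: partial_const)
          then show "continuous_on ?X (partial i (rep e b))" for i
            by (intro continuous_on_cong[THEN iffD1, OF refl _ continuous_on_const[of ?X "0::real"]]) simp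
        qed (use e qK in auto)
        then show ?thesis using e by blast
      qed
    qed
    have "open {y. (y - ?x) \<bullet> (y - ?x) < r\<^sup>2 / 2}" by (intro open_Collect_less continuous_intros)
    then show "open P" unfolding P_def
      by (rule continuous_open_preimage[OF continuous_on_chart[OF assms(3)] open_domain[OF assms(3)]])
    show "b q \<ge> 0" for q
      using pos_sq_simps(3) by (auto simp: b_def \<beta>_def cutoff_def intro!: divide_nonneg_nonneg add_nonneg_nonneg)
    show "b q = 1" if "q \<in> P" for q
      using that r(1) by (auto simp: b_def \<beta>_def P_def field_simps intro!: cutoff_1)
  qed (use Kc KU bK assms r in \<open>auto simp: P_def\<close>)
qed

end

section \<open>Integration by parts on the manifold\<close>

context riemannian_manifold
begin

definition lap_chart :: "('m, 'n) chart \<Rightarrow> ('m \<Rightarrow> real) \<Rightarrow> 'm \<Rightarrow> real" where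
  "lap_chart c f p = metric_chart.lap (g c) (rep c f) (snd c p)"

lemma smooth_rep: "smooth_function A f \<Longrightarrow> c \<in> A \<Longrightarrow> smooth_on (chart_image c) (rep c f)"
  by (simp add: smooth_function_def)

lemma continuous_on_lap_chart:
  assumes "smooth_function A f" "c \<in> A"
  shows "continuous_on (fst c) (lap_chart c f)"
  unfolding lap_chart_def
  by (intro continuous_on_domain smooth_on_continuous_on metric_chart.smooth_lap[OF metric_chart] smooth_rep assms)

lemma continuous_on_dh:
  assumes "C1 h" "c \<in> A"
  shows "continuous_on (chart_image c) (dh c h)"
  unfolding dh_def by (intro continuous_on_vec_lambda C1_continuous_partial assms)

lemma continuous_on_gip_chart:
  assumes "C1 h" "C1 k" "c \<in> A"
  shows "continuous_on (chart_image c) (gip_chart c h k)"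
proof -
  interpret metric_chart "chart_image c" "g c" by (rule metric_chart[OF assms(3)])
  have "continuous_on (chart_image c) (\<lambda>x. matrix_inv (g c x))"
    using smooth_on_continuous_on[OF smooth_N] by (simp add: N_def[abs_def])
  then have "continuous_on (chart_image c) (\<lambda>x. matrix_inv (g c x) *v dh c k x)"
    by (intro bounded_bilinear.continuous_on[OF bounded_bilinear_matrix_vector_mult] continuous_on_dh assms)
  then show ?thesis unfolding gip_chart_def by (intro continuous_on_inner continuous_on_dh assms)
qed

lemma continuous_on_gip:
  assumes "C1 h" "C1 k"
  shows "continuous_on UNIV (gip h k)"
proof (rule isCont_imp_continuous_on_open)
  fix p :: 'm
  obtain c where c: "c \<in> A" "p \<in> fst c" by (rule chart_at)
  have "continuous_on (fst c) (\<lambda>p. gip_chart c h k (snd c p))"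
    by (rule continuous_on_domain[OF c(1) continuous_on_gip_chart[OF assms c(1)]])
  then have "continuous_on (fst c) (gip h k)"
    by (rule continuous_on_cong[THEN iffD1, OF refl, rotated]) (simp add: gip_eq[OF assms c(1)])
  then show "\<exists>X. open X \<and> p \<in> X \<and> continuous_on X (gip h k)" using c open_domain by blast
qed simp

lemma gip_outside:
  assumes "C1 h" "C1 k" "closed K" "\<And>q. q \<notin> K \<Longrightarrow> h q = 0" "p \<notin> K"
  shows "gip h k p = 0"
proof -
  obtain c where c: "c \<in> A" "p \<in> fst c" by (rule chart_at)
  let ?X = "chart_image c \<inter> chart_inv c -` (- K)"
  have oX: "open ?X"
    by (rule continuous_open_preimage[OF continuous_on_chart_inv[OF c(1)] open_image[OF c(1)] open_Compl[OF assms(3)]])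
  have "partial i (rep c h) (snd c p) = partial i (\<lambda>_. 0) (snd c p)" for i
    by (rule partial_cong[OF oX]) (use c assms in auto)
  then have "dh c h (snd c p) = 0" by (simp add: dh_def partial_const vec_eq_iff)
  then show ?thesis using gip_eq[OF assms(1,2) c] by (simp add: gip_chart_def)
qed

lemma integration_by_parts_chart:
  assumes f: "smooth_function A f" and c: "c \<in> A" and \<zeta>: "C1 \<zeta>"
    and K: "compact K" "K \<subseteq> fst c" "\<And>p. p \<notin> K \<Longrightarrow> \<zeta> p = 0"
  shows "integrable V (\<lambda>p. \<zeta> p * lap_chart c f p)"
    and "integrable V (gip \<zeta> f)"
    and "(\<integral>p. \<zeta> p * lap_chart c f p \<partial>V) = - (\<integral>p. gip \<zeta> f p \<partial>V)"
proof -
  interpret metric_chart "chart_image c" "g c" by (rule metric_chart[OF c])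
  note C1f = smooth_function_C1[OF f]
  \<comment> \<open>Outside \<open>chart_image c\<close> the inverse chart has arbitrary values, so
    the representative of \<open>\<zeta>\<close> is set to zero there by hand.\<close>
  define z where "z x = (if x \<in> chart_image c then rep c \<zeta> x else 0)" for x
  define K' where "K' = snd c ` K"
  have K': "compact K'" "K' \<subseteq> chart_image c"
    unfolding K'_def using K(1,2) continuous_on_chart[OF c] compact_continuous_image continuous_on_subset
    by (blast, auto simp: chart_image_def)
  have z0: "z x = 0" if "x \<notin> K'" for x
  proof (cases "x \<in> chart_image c")
    case True
    then have "chart_inv c x \<notin> K" using that c unfolding K'_def by (metis chart_chart_inv image_eqI)
    then show ?thesis by (simp add: z_def K)
  qed (simp add: z_def)
  have oK': "open (- K')" using K'(1) compact_imp_closed by blast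
  have zd: "z differentiable (at x)" for x
  proof (cases "x \<in> chart_image c")
    case True
    have "(z has_derivative frechet_derivative (rep c \<zeta>) (at x)) (at x)"
      by (rule has_derivative_transform_within_open[OF frechet_derivative_works[THEN iffD1, OF C1_differentiable[OF \<zeta> c True]]
            open_image[OF c] True]) (simp add: z_def)
    then show ?thesis using differentiableI by blast
  next
    case False
    then have xK: "x \<in> - K'" using K' by blast
    have "((\<lambda>_. 0) has_derivative (\<lambda>_. 0)) (at x)" by simp
    then have "(z has_derivative (\<lambda>_. 0)) (at x)"
      by (rule has_derivative_transform_within_open[OF _ oK' xK]) (simp add: z0)
    then show ?thesis using differentiableI by blast
  qed
  have pz: "partial i z x = partial i (rep c \<zeta>) x" if "x \<in> chart_image c" for i x
    by (rule partial_cong[OF open_image[OF c] that]) (simp add: z_def)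
  have pz0: "partial i z x = 0" if "x \<notin> K'" for i x
    by (rule partial_outside[OF compact_imp_closed[OF K'(1)] z0 that])
  have pzc: "continuous_on UNIV (partial i z)" for i
  proof (rule continuous_on_zero_extension[OF open_image[OF c] _ K' pz0])
    show "continuous_on (chart_image c) (partial i z)"
      by (rule continuous_on_cong[THEN iffD1, OF refl _ C1_continuous_partial[OF \<zeta> c, of i]]) (simp add: pz)
  qed
  have ibp: "integrable lborel (\<lambda>x. z x * lap (rep c f) x * vol x)"
    "integrable lborel (\<lambda>x. (df z x \<bullet> grad (rep c f) x) * vol x)"
    "(\<integral>x. z x * lap (rep c f) x * vol x \<partial>lborel) = - (\<integral>x. (df z x \<bullet> grad (rep c f) x) * vol x \<partial>lborel)"
    using chart_integration_by_parts[OF smooth_rep[OF f c] zd pzc K' z0] by blast+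
  let ?h1 = "\<lambda>p. \<zeta> p * lap_chart c f p"
  have h1c: "continuous_on UNIV ?h1"
  proof (rule continuous_on_zero_extension[OF open_domain[OF c] _ K(1,2)])
    show "continuous_on (fst c) ?h1"
      by (intro continuous_on_mult continuous_on_lap_chart f c continuous_on_subset[OF C1_continuous[OF \<zeta>]]) simp
  qed (simp add: K)
  have h2c: "continuous_on UNIV (gip \<zeta> f)" by (rule continuous_on_gip[OF \<zeta> C1f])
  have out1: "?h1 p = 0" if "p \<notin> fst c" for p using that K by (auto simp: subset_iff)
  have out2: "gip \<zeta> f p = 0" if "p \<notin> fst c" for p
    by (rule gip_outside[OF \<zeta> C1f compact_imp_closed[OF K(1)] K(3)]) (use that K in auto)
  have e1: "indicator (chart_image c) x * chart_density c x * ?h1 (chart_inv c x) = z x * lap (rep c f) x * vol x" for x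
    using c by (simp add: z_def lap_chart_def vol_def indicator_def)
  have e2: "indicator (chart_image c) x * chart_density c x * gip \<zeta> f (chart_inv c x) = (df z x \<bullet> grad (rep c f) x) * vol x" for x
  proof (cases "x \<in> chart_image c")
    case True
    have "gip \<zeta> f (chart_inv c x) = gip_chart c \<zeta> f x"
      using gip_eq[OF \<zeta> C1f c, of "chart_inv c x"] c True by simp
    also have "\<dots> = df z x \<bullet> grad (rep c f) x"
      by (simp add: gip_chart_def df_def grad_def dh_def N_def pz True)
    finally show ?thesis using True by (simp add: vol_def)
  next
    case False
    then have "x \<notin> K'" using K' by blast
    then have "df z x = 0" by (simp add: df_def vec_eq_iff pz0)
    then show ?thesis using False by simp
  qed
  have i1: "integrable V ?h1 \<longleftrightarrow> integrable lborel (\<lambda>x. z x * lap (rep c f) x * vol x)"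
    "(\<integral>p. ?h1 p \<partial>V) = (\<integral>x. z x * lap (rep c f) x * vol x \<partial>lborel)"
    using integral_V_chart[OF c borel_measurable_continuous_onI[OF h1c] out1] e1 by simp_all
  have i2: "integrable V (gip \<zeta> f) \<longleftrightarrow> integrable lborel (\<lambda>x. (df z x \<bullet> grad (rep c f) x) * vol x)"
    "(\<integral>p. gip \<zeta> f p \<partial>V) = (\<integral>x. (df z x \<bullet> grad (rep c f) x) * vol x \<partial>lborel)"
    using integral_V_chart[OF c borel_measurable_continuous_onI[OF h2c] out2] e2 by simp_all
  show "integrable V ?h1" "integrable V (gip \<zeta> f)" "(\<integral>p. ?h1 p \<partial>V) = - (\<integral>p. gip \<zeta> f p \<partial>V)"
    using i1 i2 ibp by simp_all
qed

text \<open>The density is positive. This lets the vanishing of the integral of a nonnegative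
  function contradict its positivity on an open set.\<close>

lemma emeasure_V_open_nonzero:
  assumes "c \<in> A" "open X" "X \<subseteq> fst c" "X \<noteq> {}"
  shows "emeasure V X \<noteq> 0"
proof
  assume "emeasure V X = 0"
  let ?Y = "snd c ` X"
  have Xb: "X \<in> sets borel" using assms(2) by simp
  have Yo: "open ?Y"
  proof -
    have "?Y = chart_image c \<inter> chart_inv c -` X" using image_chart_eq[OF assms(1,3)] by auto
    then show ?thesis
      using continuous_open_preimage[OF continuous_on_chart_inv[OF assms(1)] open_image[OF assms(1)] assms(2)] by simp
  qed
  have Y: "?Y \<in> sets borel" "?Y \<subseteq> chart_image c" using Yo assms(3) by (auto simp: chart_image_def)
  have eq0: "(\<integral>\<^sup>+x\<in>?Y. chart_density c x \<partial>lborel) = 0"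
    using emeasure_V[OF assms(1) Xb assms(3)] emeasure_chart_measure[OF assms(1) Y] \<open>emeasure V X = 0\<close> by simp
  have eq1: "ennreal (chart_density c x) * indicator ?Y x = ennreal (indicator ?Y x * chart_density c x)" for x
    by (simp add: indicator_def)
  have m: "(\<lambda>x. ennreal (indicator ?Y x * chart_density c x)) \<in> borel_measurable lborel"
    using measurable_chart_density[OF assms(1) Y] by measurable
  have ae: "AE x in lborel. ennreal (indicator ?Y x * chart_density c x) = 0"
    using eq0 unfolding eq1 nn_integral_0_iff_AE[OF m] .
  have "?Y \<in> null_sets lborel"
  proof (rule AE_iff_null_sets[THEN iffD2])
    show "AE x in lborel. x \<notin> ?Y"
      using ae
    proof eventually_elim
      case (elim x)
      show ?case
      proof
        assume "x \<in> ?Y"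
        then have "chart_density c x > 0" using Y(2) chart_density_pos[OF assms(1)] by blast
        then show False using elim \<open>x \<in> ?Y\<close> by simp
      qed
    qed
  qed (use Y in simp)
  then have "negligible ?Y" by (simp add: negligible_iff_null_sets null_sets_completionI)
  then show False using open_not_negligible[OF Yo] assms(4) by blast
qed

text \<open>The Laplacian is seen to be independent of the chart by testing it against bump functions, which
  only involves the first order quantity \<open>gip\<close> and avoids transforming Christoffel symbols.\<close>

lemma lap_chart_le:
  assumes f: "smooth_function A f" and cd: "c \<in> A" "d \<in> A" and p: "p \<in> fst c" "p \<in> fst d"
  shows "lap_chart c f p \<le> lap_chart d f p"
proof (rule ccontr)
  assume less: "\<not> lap_chart c f p \<le> lap_chart d f p"
  let ?D = "\<lambda>q. lap_chart c f q - lap_chart d f q"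
  let ?W = "fst c \<inter> fst d"
  have oW: "open ?W" using open_domain cd by blast
  have cD: "continuous_on ?W ?D"
    by (intro continuous_on_diff continuous_on_subset[OF continuous_on_lap_chart[OF f cd(1)]]
        continuous_on_subset[OF continuous_on_lap_chart[OF f cd(2)]]) auto
  define Q where "Q = ?W \<inter> ?D -` {0<..}"
  have oQ: "open Q" unfolding Q_def by (rule continuous_open_preimage[OF cD oW]) simp
  have pQ: "p \<in> Q" using p less by (simp add: Q_def)
  obtain b K P where b: "C1 b" "compact K" "K \<subseteq> Q \<inter> fst c" "\<And>q. q \<notin> K \<Longrightarrow> b q = 0" "\<And>q. b q \<ge> 0"
    "open P" "p \<in> P" "\<And>q. q \<in> P \<Longrightarrow> b q = 1"
    using exists_bump[OF oQ pQ cd(1) p(1)] by blast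
  have Kd: "K \<subseteq> fst d" "K \<subseteq> fst c" "\<And>q. q \<in> K \<Longrightarrow> ?D q > 0" using b(3) by (auto simp: Q_def)
  note ic = integration_by_parts_chart[OF f cd(1) b(1,2) Kd(2) b(4)]
  note id = integration_by_parts_chart[OF f cd(2) b(1,2) Kd(1) b(4)]
  have eq: "b q * lap_chart c f q - b q * lap_chart d f q = b q * ?D q" for q by (simp add: algebra_simps)
  \<comment> \<open>Both Laplacians have the same integral against \<open>b\<close>, namely minus
    that of \<open>gip b f\<close>.\<close>
  have i: "integrable V (\<lambda>q. b q * ?D q)" "(\<integral>q. b q * ?D q \<partial>V) = 0"
    using Bochner_Integration.integrable_diff[OF ic(1) id(1)] Bochner_Integration.integral_diff[OF ic(1) id(1)]
      ic(3) id(3) by (simp_all add: eq)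
  have nn: "b q * ?D q \<ge> 0" for q
    using b(4)[of q] b(5)[of q] Kd(3)[of q] by (cases "q \<in> K") (auto intro!: mult_nonneg_nonneg)
  have ae: "AE q in V. b q * ?D q = 0"
    using integral_nonneg_eq_0_iff_AE[OF i(1)] nn i(2) by simp
  let ?X = "P \<inter> Q"
  have "?X \<in> null_sets V"
  proof (rule AE_iff_null_sets[THEN iffD2])
    show "AE x in V. x \<notin> ?X" using ae
    proof eventually_elim
      case (elim q)
      then show ?case using b(8) by (auto simp: Q_def)
    qed
    show "?X \<in> sets V" using b(6) oQ by simp
  qed
  moreover have "emeasure V ?X \<noteq> 0"
    by (rule emeasure_V_open_nonzero[OF cd(1)]) (use b(6,7) oQ pQ in \<open>auto simp: Q_def\<close>)
  ultimately show False by auto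
qed

definition laplacian :: "('m \<Rightarrow> real) \<Rightarrow> 'm \<Rightarrow> real" where
  "laplacian f p = lap_chart (SOME c. c \<in> A \<and> p \<in> fst c) f p"

lemma laplacian_eq:
  assumes "smooth_function A f" "c \<in> A" "p \<in> fst c"
  shows "laplacian f p = lap_chart c f p"
proof -
  define e where "e = (SOME c. c \<in> A \<and> p \<in> fst c)"
  have e: "e \<in> A" "p \<in> fst e" using someI_ex[of "\<lambda>c. c \<in> A \<and> p \<in> fst c"] assms(2,3) unfolding e_def by blast+
  show ?thesis
    unfolding laplacian_def e_def[symmetric]
    using lap_chart_le[OF assms(1) e(1) assms(2) e(2) assms(3)] lap_chart_le[OF assms(1,2) e(1) assms(3) e(2)] by simp
qed

lemma gip_add_left:
  assumes "C1 h1" "C1 h2" "C1 h" "C1 k" "\<And>q. h q = h1 q + h2 q"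
  shows "gip h k p = gip h1 k p + gip h2 k p"
proof -
  obtain c where c: "c \<in> A" "p \<in> fst c" by (rule chart_at)
  have "partial i (rep c h) (snd c p) = partial i (rep c h1) (snd c p) + partial i (rep c h2) (snd c p)" for i
  proof -
    have "rep c h = (\<lambda>y. rep c h1 y + rep c h2 y)" using assms(5) by (simp add: fun_eq_iff)
    then show ?thesis
      by (simp only: partial_add C1_differentiable[OF assms(1) c(1)] C1_differentiable[OF assms(2) c(1)] chart_in_image c)
  qed
  then have "dh c h (snd c p) = dh c h1 (snd c p) + dh c h2 (snd c p)" by (simp add: dh_def vec_eq_iff)
  then show ?thesis by (simp add: gip_eq[OF _ assms(4) c] assms gip_chart_def inner_add_left)
qed

text \<open>One bump function is split off at a time: \<open>b * \<zeta>\<close> is supported in a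
  single chart, while \<open>(1 - b) * \<zeta>\<close> vanishes outside a compact set covered by one
  open set fewer.\<close>

lemma integration_by_parts:
  assumes f: "smooth_function A f" and \<zeta>: "C1 \<zeta>" and K: "compact K" "\<And>p. p \<notin> K \<Longrightarrow> \<zeta> p = 0"
  shows "integrable V (\<lambda>p. \<zeta> p * laplacian f p) \<and> integrable V (gip \<zeta> f) \<and>
    (\<integral>p. \<zeta> p * laplacian f p \<partial>V) = - (\<integral>p. gip \<zeta> f p \<partial>V)"
proof -
  note C1f = smooth_function_C1[OF f]
  define good where "good P \<longleftrightarrow> open P \<and> (\<exists>c\<in>A. \<exists>b K. C1 b \<and> compact K \<and> K \<subseteq> fst c \<and> (\<forall>q. q \<notin> K \<longrightarrow> b q = 0) \<and> (\<forall>q\<in>P. b q = 1))"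
    for P :: "'m set"
  have "\<exists>P. good P \<and> p \<in> P" for p
  proof -
    obtain c where c: "c \<in> A" "p \<in> fst c" by (rule chart_at)
    obtain b K P where "C1 b" "compact K" "K \<subseteq> UNIV \<inter> fst c" "\<And>q. q \<notin> K \<Longrightarrow> b q = 0"
      "open P" "p \<in> P" "\<And>q. q \<in> P \<Longrightarrow> b q = 1"
      using exists_bump[OF open_UNIV UNIV_I c] by metis
    then show ?thesis unfolding good_def using c by (intro exI[of _ P]) blast
  qed
  then have "K \<subseteq> \<Union>{P. good P}" by blast
  moreover have "open P" if "P \<in> {P. good P}" for P using that by (simp add: good_def)
  ultimately obtain F where F: "F \<subseteq> {P. good P}" "finite F" "K \<subseteq> \<Union>F"
    using K(1) by (meson compactE)
  have "\<And>P. P \<in> F \<Longrightarrow> good P" using F(1) by blast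
  with F(2) show ?thesis using F(3) \<zeta> K
  proof (induction F arbitrary: \<zeta> K rule: finite_induct)
    case empty
    then have z: "\<zeta> p = 0" for p by auto
    have g0: "gip \<zeta> f = (\<lambda>p. 0)"
      using gip_outside[OF empty.prems(3) C1f closed_empty] z by (intro ext) blast
    show ?case unfolding g0 by (simp add: z)
  next
    case (insert P F)
    obtain c b K1 where b: "open P" "c \<in> A" "C1 b" "compact K1" "K1 \<subseteq> fst c" "\<And>q. q \<notin> K1 \<Longrightarrow> b q = 0" "\<And>q. q \<in> P \<Longrightarrow> b q = 1"
      using insert.prems(1)[of P] unfolding good_def by blast
    let ?z1 = "\<lambda>p. b p * \<zeta> p" and ?z2 = "\<lambda>p. (1 - b p) * \<zeta> p"
    have C1z: "C1 ?z1" "C1 ?z2" 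
      by (rule C1_mult[OF b(3) insert.prems(3)]) (rule C1_mult[OF C1_diff[OF C1_const b(3)] insert.prems(3)])
    have add: "\<zeta> q = ?z1 q + ?z2 q" for q by (simp add: algebra_simps)
    have one: "integrable V (\<lambda>p. ?z1 p * lap_chart c f p)" "integrable V (gip ?z1 f)"
      "(\<integral>p. ?z1 p * lap_chart c f p \<partial>V) = - (\<integral>p. gip ?z1 f p \<partial>V)"
      using integration_by_parts_chart[OF f b(2) C1z(1) b(4,5)] b(6) by auto
    have l1: "?z1 p * lap_chart c f p = ?z1 p * laplacian f p" for p
      using b(5,6) laplacian_eq[OF f b(2), of p] by (cases "p \<in> K1") auto
    note one' = one(1,3)[unfolded l1]
    have two: "integrable V (\<lambda>p. ?z2 p * laplacian f p) \<and> integrable V (gip ?z2 f) \<and>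
      (\<integral>p. ?z2 p * laplacian f p \<partial>V) = - (\<integral>p. gip ?z2 f p \<partial>V)"
    proof (rule insert.IH)
      \<comment> \<open>\<open>1 - b\<close> vanishes on \<open>P\<close>, which may therefore be
        removed from the support.\<close>
      show "compact (K - P)" using insert.prems(4) b(1) by (rule compact_diff)
      show "K - P \<subseteq> \<Union>F" using insert.prems(2) by blast
      show "?z2 p = 0" if "p \<notin> K - P" for p using that insert.prems(5) b(7) by auto
    qed (use insert.prems C1z in auto)
    have g: "gip \<zeta> f = (\<lambda>p. gip ?z1 f p + gip ?z2 f p)"
      using gip_add_left[OF C1z insert.prems(3) C1f add] by blast
    have l: "\<zeta> p * laplacian f p = ?z1 p * laplacian f p + ?z2 p * laplacian f p" for p by (simp add: algebra_simps)
    show ?case unfolding g l using one one' two by simp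
  qed
qed

end

section \<open>Riemannian distance\<close>

context riemannian_manifold
begin

lemma metric_nonneg: "c \<in> A \<Longrightarrow> x \<in> chart_image c \<Longrightarrow> v \<bullet> (g c x *v v) \<ge> 0"
  using metric_positive[of c x v] by (cases "v = 0") auto

lemma speed_continuous:
  assumes "c \<in> A" "\<gamma> ` {b..b'} \<subseteq> fst c"
    and "\<And>t. t \<in> {b..b'} \<Longrightarrow> ((snd c \<circ> \<gamma>) has_vector_derivative v t) (at t within {b..b'})"
    and "continuous_on {b..b'} v"
  shows "continuous_on {b..b'} (\<lambda>t. sqrt (v t \<bullet> (g c (snd c (\<gamma> t)) *v v t)))"
proof -
  have x: "continuous_on {b..b'} (\<lambda>t. snd c (\<gamma> t))"
    using has_vector_derivative_continuous[OF assms(3)] by (simp add: continuous_on_eq_continuous_within o_def)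
  have "continuous_on {b..b'} (\<lambda>t. g c (snd c (\<gamma> t)))"
    by (rule continuous_on_compose2[OF smooth_on_continuous_on[OF metric_smooth[OF assms(1)]] x]) (use assms(2) in auto)
  then show ?thesis
    by (intro continuous_on_real_sqrt continuous_on_inner assms(4)
        bounded_bilinear.continuous_on[OF bounded_bilinear_matrix_vector_mult])
qed

lemma curve_length_nonneg: "curve_length A g \<gamma> a b L \<Longrightarrow> a \<le> b \<and> 0 \<le> L"
proof (induction rule: curve_length.induct)
  case (append a b L b' c v)
  have "integral {b..b'} (\<lambda>t. sqrt (v t \<bullet> (g c (snd c (\<gamma> t)) *v v t))) \<ge> 0"
  proof (rule integral_nonneg)
    show "(\<lambda>t. sqrt (v t \<bullet> (g c (snd c (\<gamma> t)) *v v t))) integrable_on {b..b'}"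
      by (intro integrable_continuous_real speed_continuous append.hyps)
    show "0 \<le> sqrt (v t \<bullet> (g c (snd c (\<gamma> t)) *v v t))" if "t \<in> {b..b'}" for t
      using append.hyps(3,4) that by (intro real_sqrt_ge_zero metric_nonneg chart_in_image) auto
  qed
  then show ?case using append by auto
qed simp

lemma curve_length_cong:
  "curve_length A g \<gamma> a b L \<Longrightarrow> (\<And>t. a \<le> t \<Longrightarrow> t \<le> b \<Longrightarrow> \<gamma>' t = \<gamma> t) \<Longrightarrow> curve_length A g \<gamma>' a b L"
proof (induction rule: curve_length.induct)
  case (point a)
  show ?case by (rule curve_length.point)
next
  case (append a b L b' c v)
  have ab: "a \<le> b" using curve_length_nonneg append.hyps(1) by blast
  have eq: "\<gamma>' t = \<gamma> t" if "t \<in> {b..b'}" for t using append.prems ab that by auto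
  have "integral {b..b'} (\<lambda>t. sqrt (v t \<bullet> (g c (snd c (\<gamma> t)) *v v t))) = integral {b..b'} (\<lambda>t. sqrt (v t \<bullet> (g c (snd c (\<gamma>' t)) *v v t)))"
    by (rule Henstock_Kurzweil_Integration.integral_cong) (simp add: eq)
  moreover have "curve_length A g \<gamma>' a b' (L + integral {b..b'} (\<lambda>t. sqrt (v t \<bullet> (g c (snd c (\<gamma>' t)) *v v t))))"
  proof (rule curve_length.append)
    show "curve_length A g \<gamma>' a b L" using append by simp
    show "\<gamma>' ` {b..b'} \<subseteq> fst c" using append.hyps(4) eq by auto
    show "((snd c \<circ> \<gamma>') has_vector_derivative v t) (at t within {b..b'})" if "t \<in> {b..b'}" for t
      by (rule has_vector_derivative_transform[OF that _ append.hyps(5)[OF that]]) (simp add: eq)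
  qed (use append.hyps in auto)
  ultimately show ?case by simp
qed

text \<open>Induction on the second curve, because \<open>append\<close> prolongs a curve at its
  right end.\<close>

lemma curve_length_concat:
  assumes "curve_length A g \<gamma> b c L2" "curve_length A g \<gamma> a b L1"
  shows "curve_length A g \<gamma> a c (L1 + L2)"
  using assms
proof (induction rule: curve_length.induct)
  case (point b)
  then show ?case by simp
next
  case (append b c L2 c' d v)
  have "curve_length A g \<gamma> a c' ((L1 + L2) + integral {c..c'} (\<lambda>t. sqrt (v t \<bullet> (g d (snd d (\<gamma> t)) *v v t))))"
    by (rule curve_length.append) (use append in auto)
  then show ?case by (simp add: add.assoc)
qed

lemma curve_length_shift:
  "curve_length A g \<gamma> a b L \<Longrightarrow> curve_length A g (\<lambda>t. \<gamma> (t - s)) (a + s) (b + s) L"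
proof (induction rule: curve_length.induct)
  case (point a)
  show ?case by (rule curve_length.point)
next
  case (append a b L b' c v)
  have v: "continuous_on {b + s..b' + s} (\<lambda>t. v (t - s))"
    by (rule continuous_on_compose2[OF append.hyps(6)]) (auto intro!: continuous_intros)
  have "curve_length A g (\<lambda>t. \<gamma> (t - s)) (a + s) (b' + s)
    (L + integral {b + s..b' + s} (\<lambda>t. sqrt (v (t - s) \<bullet> (g c (snd c (\<gamma> (t - s))) *v v (t - s)))))"
  proof (rule curve_length.append[OF append.IH _ append.hyps(3) _ _ v])
    show "(\<lambda>t. \<gamma> (t - s)) ` {b + s..b' + s} \<subseteq> fst c" using append.hyps(4) by (auto simp: image_subset_iff)
    show "((snd c \<circ> (\<lambda>t. \<gamma> (t - s))) has_vector_derivative v (t - s)) (at t within {b + s..b' + s})"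
      if t: "t \<in> {b + s..b' + s}" for t
    proof -
      have "((\<lambda>t. t - s) has_vector_derivative 1) (at t within {b + s..b' + s})"
        by (auto intro!: derivative_eq_intros)
      moreover have "(\<lambda>t. t - s) ` {b + s..b' + s} = {b..b'}"
        by simp
      then have "((snd c \<circ> \<gamma>) has_vector_derivative v (t - s)) (at (t - s) within (\<lambda>t. t - s) ` {b + s..b' + s})"
        using append.hyps(5)[of "t - s"] t by simp
      ultimately have "(((snd c \<circ> \<gamma>) \<circ> (\<lambda>t. t - s)) has_vector_derivative 1 *\<^sub>R v (t - s)) (at t within {b + s..b' + s})"
        by (rule vector_diff_chain_within)
      then show ?thesis by (simp add: o_def)
    qed
  qed (use append.hyps in auto)
  moreover have "integral {b + s..b' + s} (\<lambda>t. sqrt (v (t - s) \<bullet> (g c (snd c (\<gamma> (t - s))) *v v (t - s))))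
    = integral {b..b'} (\<lambda>t. sqrt (v t \<bullet> (g c (snd c (\<gamma> t)) *v v t)))"
    using integral_shift[of "b + s" "- s" "b' + s" "\<lambda>t. sqrt (v t \<bullet> (g c (snd c (\<gamma> t)) *v v t))"]
      speed_continuous[OF append.hyps(3-6)] by (simp add: o_def)
  ultimately show ?case by simp
qed

text \<open>The last piece becomes the first after reversal, so each step concatenates the reversed
  piece with the reversed remainder.\<close>

lemma curve_length_reverse:
  "curve_length A g \<gamma> a b L \<Longrightarrow> curve_length A g (\<lambda>t. \<gamma> (- t)) (- b) (- a) L"
proof (induction rule: curve_length.induct)
  case (point a)
  show ?case by (rule curve_length.point)
next
  case (append a b L b' c v)
  have v: "continuous_on {- b'..- b} (\<lambda>t. - v (- t))"
    by (intro continuous_on_minus continuous_on_compose2[OF append.hyps(6)]) (auto intro!: continuous_intros)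
  have "curve_length A g (\<lambda>t. \<gamma> (- t)) (- b') (- b)
    (0 + integral {- b'..- b} (\<lambda>t. sqrt (- v (- t) \<bullet> (g c (snd c (\<gamma> (- t))) *v - v (- t)))))"
  proof (rule curve_length.append[OF curve_length.point _ append.hyps(3) _ _ v])
    show "(\<lambda>t. \<gamma> (- t)) ` {- b'..- b} \<subseteq> fst c" using append.hyps(4) by (auto simp: image_subset_iff)
    show "((snd c \<circ> (\<lambda>t. \<gamma> (- t))) has_vector_derivative - v (- t)) (at t within {- b'..- b})"
      if t: "t \<in> {- b'..- b}" for t
    proof -
      have "((\<lambda>t. - t) has_vector_derivative - 1) (at t within {- b'..- b})"
        by (auto intro!: derivative_eq_intros)
      moreover have "(\<lambda>t. - t) ` {- b'..- b} = {b..b'}" by (simp add: image_uminus_atLeastAtMost)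
      then have "((snd c \<circ> \<gamma>) has_vector_derivative v (- t)) (at (- t) within (\<lambda>t. - t) ` {- b'..- b})"
        using append.hyps(5)[of "- t"] t by simp
      ultimately have "(((snd c \<circ> \<gamma>) \<circ> (\<lambda>t. - t)) has_vector_derivative (- 1) *\<^sub>R v (- t)) (at t within {- b'..- b})"
        by (rule vector_diff_chain_within)
      then show ?thesis by (simp add: o_def)
    qed
  qed (use append.hyps in auto)
  moreover have "- w \<bullet> (M *v - w) = w \<bullet> (M *v w)" for w :: "real ^ 'n" and M :: "real ^ 'n ^ 'n"
    by (metis (no_types, lifting) inner_minus_left inner_minus_right matrix_vector_mult_scaleR minus_minus scaleR_minus1_left)
  then have "integral {- b'..- b} (\<lambda>t. sqrt (- v (- t) \<bullet> (g c (snd c (\<gamma> (- t))) *v - v (- t))))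
    = integral {b..b'} (\<lambda>t. sqrt (v t \<bullet> (g c (snd c (\<gamma> t)) *v v t)))"
    using Henstock_Kurzweil_Integration.integral_reflect_real[of b' b "\<lambda>t. sqrt (v t \<bullet> (g c (snd c (\<gamma> t)) *v v t))"] by simp
  ultimately have "curve_length A g (\<lambda>t. \<gamma> (- t)) (- b') (- b) (integral {b..b'} (\<lambda>t. sqrt (v t \<bullet> (g c (snd c (\<gamma> t)) *v v t))))"
    by simp
  from curve_length_concat[OF append.IH this] show ?case by (simp add: add.commute)
qed

section \<open>Points joined by curves\<close>

definition joined :: "'m \<Rightarrow> 'm \<Rightarrow> real \<Rightarrow> bool" where
  "joined p q L \<longleftrightarrow> (\<exists>\<gamma> a b. \<gamma> a = p \<and> \<gamma> b = q \<and> curve_length A g \<gamma> a b L)"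

lemma joined_nonneg: "joined p q L \<Longrightarrow> L \<ge> 0"
  unfolding joined_def using curve_length_nonneg by blast

lemma joined_refl: "joined p p 0"
  unfolding joined_def using curve_length.point[of A g "\<lambda>_. p" 0] by (intro exI[of _ "\<lambda>_. p"] exI[of _ 0]) auto

lemma joined_sym: "joined p q L \<Longrightarrow> joined q p L"
proof -
  assume "joined p q L"
  then obtain \<gamma> a b where "\<gamma> a = p" "\<gamma> b = q" "curve_length A g \<gamma> a b L" unfolding joined_def by blast
  then show ?thesis unfolding joined_def
    by (intro exI[of _ "\<lambda>t. \<gamma> (- t)"] exI[of _ "- b"] exI[of _ "- a"]) (simp add: curve_length_reverse)
qed

lemma joined_trans:
  assumes "joined p q L1" "joined q r L2"
  shows "joined p r (L1 + L2)"
proof -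
  obtain \<gamma> a b where 1: "\<gamma> a = p" "\<gamma> b = q" "curve_length A g \<gamma> a b L1" using assms(1) unfolding joined_def by blast
  obtain \<delta> c d where 2: "\<delta> c = q" "\<delta> d = r" "curve_length A g \<delta> c d L2" using assms(2) unfolding joined_def by blast
  define s where "s = b - c"
  \<comment> \<open>The second curve is shifted in time so as to start at \<open>b\<close>, where
    both branches have the value \<open>q\<close>.\<close>
  define \<eta> where "\<eta> t = (if t \<le> b then \<gamma> t else \<delta> (t - s))" for t
  have ab: "a \<le> b" and cd: "c \<le> d" using curve_length_nonneg 1(3) 2(3) by blast+
  have "curve_length A g \<eta> a b L1"
    by (rule curve_length_cong[OF 1(3)]) (simp add: \<eta>_def)
  moreover have "curve_length A g \<eta> b (d + s) L2"
  proof -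
    have "curve_length A g \<eta> (c + s) (d + s) L2"
      by (rule curve_length_cong[OF curve_length_shift[OF 2(3), of s]]) (use 1 2 in \<open>auto simp: \<eta>_def s_def\<close>)
    then show ?thesis by (simp add: s_def)
  qed
  ultimately have "curve_length A g \<eta> a (d + s) (L1 + L2)" by (metis curve_length_concat)
  moreover have "\<eta> a = p" "\<eta> (d + s) = r" using ab cd 1 2 by (auto simp: \<eta>_def s_def)
  ultimately show ?thesis unfolding joined_def by blast
qed

text \<open>Straight coordinate segments in a ball of one chart are admissible curves.\<close>

lemma joined_locally: "\<exists>X. open X \<and> p \<in> X \<and> (\<forall>q\<in>X. \<exists>L. joined p q L)"
proof -
  obtain c where c: "c \<in> A" "p \<in> fst c" by (rule chart_at)
  let ?x = "snd c p"
  obtain r where r: "r > 0" "ball ?x r \<subseteq> chart_image c"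
    using open_image[OF c(1)] c(2) by (meson chart_in_image openE)
  define X where "X = fst c \<inter> snd c -` ball ?x r"
  have "open X" unfolding X_def
    by (rule continuous_open_preimage[OF continuous_on_chart[OF c(1)] open_domain[OF c(1)] open_ball])
  moreover have "\<exists>L. joined p q L" if "q \<in> X" for q
  proof -
    define w where "w = snd c q - ?x"
    define \<gamma> where "\<gamma> t = chart_inv c (?x + t *\<^sub>R w)" for t :: real
    have in_ball: "?x + t *\<^sub>R w \<in> chart_image c" if "t \<in> {0..1}" for t
    proof -
      have "norm w < r" using \<open>q \<in> X\<close> by (simp add: X_def w_def dist_norm norm_minus_commute)
      then have "norm (t *\<^sub>R w) < r" using that mult_right_mono[of t 1 "norm w"] by auto
      then have "?x + t *\<^sub>R w \<in> ball ?x r" by (simp add: dist_norm)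
      then show ?thesis using r by blast
    qed
    have e: "(snd c \<circ> \<gamma>) t = ?x + t *\<^sub>R w" if "t \<in> {0..1}" for t using in_ball[OF that] c by (simp add: \<gamma>_def)
    have "curve_length A g \<gamma> 0 1 (0 + integral {0..1} (\<lambda>t. sqrt (w \<bullet> (g c (snd c (\<gamma> t)) *v w))))"
    proof (rule curve_length.append[OF curve_length.point _ c(1)])
      show "\<gamma> ` {0..1} \<subseteq> fst c" using in_ball c by (auto simp: \<gamma>_def)
      show "((snd c \<circ> \<gamma>) has_vector_derivative w) (at t within {0..1})" if "t \<in> {0..1}" for t
      proof (rule has_vector_derivative_transform[OF that e])
        show "((\<lambda>t. ?x + t *\<^sub>R w) has_vector_derivative w) (at t within {0..1})"
          by (auto intro!: derivative_eq_intros)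
      qed
    qed auto
    moreover have "\<gamma> 0 = p" "\<gamma> 1 = q" using c that by (simp_all add: \<gamma>_def w_def X_def)
    ultimately show ?thesis unfolding joined_def by blast
  qed
  ultimately show ?thesis using c r by (intro exI[of _ X]) (auto simp: X_def)
qed

text \<open>Being joined is an equivalence relation with open classes on a connected space. The sets
  of lengths are thereby nonempty, so that their infimum carries information.\<close>

lemma joined_exists: "\<exists>L. joined p q L"
proof (rule connected_equivalence_relation[OF connected_manifold, of p q "\<lambda>p q. \<exists>L. joined p q L"])
  show "\<exists>L. joined y x L" if "\<exists>L. joined x y L" for x y using that joined_sym by blast
  show "\<exists>L. joined x z L" if "\<exists>L. joined x y L" "\<exists>L. joined y z L" for x y z using that joined_trans by blast
  show "\<exists>T. openin (top_of_set UNIV) T \<and> a \<in> T \<and> (\<forall>x\<in>T. \<exists>L. joined a x L)" for a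
    using joined_locally[of a] by simp
qed auto

section \<open>The distance function and Lipschitz bounds\<close>

lemma riemannian_dist_eq: "riemannian_dist A g p q = Inf {L. joined p q L}"
  by (simp add: riemannian_dist_def joined_def)

lemma bdd_below_joined: "bdd_below {L. joined p q L}"
  using joined_nonneg by (intro bdd_belowI[of _ 0]) auto

lemma riemannian_dist_le: "joined p q L \<Longrightarrow> riemannian_dist A g p q \<le> L"
  unfolding riemannian_dist_eq by (rule cInf_lower[OF _ bdd_below_joined]) simp

lemma riemannian_dist_less:
  assumes "riemannian_dist A g p q < r"
  obtains L where "joined p q L" "L < r"
  using cInf_lessD[of "{L. joined p q L}" r] joined_exists assms unfolding riemannian_dist_eq by auto

text \<open>Cauchy-Schwarz between a covector of norm at most 1 and a vector: with \<open>s\<close>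
  the length of \<open>v\<close>, the squared length of \<open>v - s *\<^sub>R (?N *v a)\<close> is
  nonnegative.\<close>

lemma covector_le_speed:
  assumes "c \<in> A" "x \<in> chart_image c" "a \<bullet> (matrix_inv (g c x) *v a) \<le> 1"
  shows "a \<bullet> v \<le> sqrt (v \<bullet> (g c x *v v))"
proof (cases "v = 0")
  case False
  interpret metric_chart "chart_image c" "g c" by (rule metric_chart[OF assms(1)])
  let ?G = "g c x" and ?N = "matrix_inv (g c x)"
  define s where "s = sqrt (v \<bullet> (?G *v v))"
  have s: "s > 0" "s * s = v \<bullet> (?G *v v)" using pos_G[OF assms(2) False] by (simp_all add: s_def)
  have inv: "?G *v (?N *v a) = a" using G_N[OF assms(2)] by (simp add: matrix_vector_mul_assoc N_def)
  have symm: "y \<bullet> (?G *v z) = z \<bullet> (?G *v y)" for y z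
    by (metis dot_lmul_matrix inner_commute sym_G[OF assms(2)] transpose_matrix_vector)
  let ?y = "v - s *\<^sub>R (?N *v a)"
  have "0 \<le> ?y \<bullet> (?G *v ?y)" by (rule metric_nonneg[OF assms(1,2)])
  also have "?y \<bullet> (?G *v ?y) = v \<bullet> (?G *v v) - 2 * s * (a \<bullet> v) + s * s * (a \<bullet> (?N *v a))"
    using symm[of v "?N *v a"] by (simp add: matrix_vector_mult_diff_distrib matrix_vector_mult_scaleR inv
        inner_diff_left inner_diff_right inner_commute algebra_simps)
  also have "\<dots> \<le> s * s - 2 * s * (a \<bullet> v) + s * s * 1"
    using s(1) assms(3) by (intro add_mono mult_left_mono) (auto simp: s(2)[symmetric])
  finally have "s * (a \<bullet> v) \<le> s * s" by simp
  then have "a \<bullet> v \<le> s" using s(1) mult_le_cancel_left_pos by blast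
  then show ?thesis by (simp add: s_def)
qed simp

text \<open>On each piece the derivative of \<open>w\<close> is its differential applied to the
  velocity, hence at most the speed; the fundamental theorem of calculus integrates this.\<close>

lemma lipschitz_along_curve:
  assumes w: "C1 w" "\<And>p. gip w w p \<le> 1"
  shows "curve_length A g \<gamma> a b L \<Longrightarrow> w (\<gamma> b) - w (\<gamma> a) \<le> L"
proof (induction rule: curve_length.induct)
  case (append a b L b' c v)
  note c = append.hyps(3)
  have im: "snd c (\<gamma> t) \<in> chart_image c" if "t \<in> {b..b'}" for t
    using append.hyps(4) that by (intro chart_in_image) auto
  let ?d = "\<lambda>t. dh c w (snd c (\<gamma> t)) \<bullet> v t"
  have der: "((\<lambda>t. w (\<gamma> t)) has_vector_derivative ?d t) (at t within {b..b'})" if t: "t \<in> {b..b'}" for t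
  proof -
    let ?x = "snd c (\<gamma> t)"
    have "(rep c w has_derivative (\<lambda>v. dh c w ?x \<bullet> v)) (at ?x)"
      using has_derivative_partial_sum[OF C1_differentiable[OF w(1) c im[OF t]]]
      by (simp add: dh_def inner_vec_def mult.commute)
    then have "((rep c w \<circ> (snd c \<circ> \<gamma>)) has_vector_derivative dh c w ?x \<bullet> v t) (at t within {b..b'})"
      using append.hyps(5)[OF t] unfolding has_vector_derivative_def
      by (intro has_derivative_eq_rhs[OF diff_chain_within[OF _ has_derivative_at_withinI]])
        (auto simp: o_def fun_eq_iff)
    then show ?thesis
      by (rule has_vector_derivative_transform[OF t, rotated]) (use append.hyps(4) c in \<open>auto simp: image_subset_iff\<close>)
  qed
  have "(?d has_integral (w (\<gamma> b') - w (\<gamma> b))) {b..b'}"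
    by (rule fundamental_theorem_of_calculus[OF _ der]) (use append.hyps(2) in auto)
  moreover have "((\<lambda>t. sqrt (v t \<bullet> (g c (snd c (\<gamma> t)) *v v t))) has_integral
      integral {b..b'} (\<lambda>t. sqrt (v t \<bullet> (g c (snd c (\<gamma> t)) *v v t)))) {b..b'}"
    by (intro integrable_integral integrable_continuous_real speed_continuous append.hyps)
  ultimately have "w (\<gamma> b') - w (\<gamma> b) \<le> integral {b..b'} (\<lambda>t. sqrt (v t \<bullet> (g c (snd c (\<gamma> t)) *v v t)))"
  proof (rule has_integral_le)
    fix t assume t: "t \<in> {b..b'}"
    have "gip_chart c w w (snd c (\<gamma> t)) \<le> 1"
      using w(2)[of "\<gamma> t"] gip_eq[OF w(1) w(1) c, of "\<gamma> t"] append.hyps(4) t by (auto simp: image_subset_iff)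
    then show "?d t \<le> sqrt (v t \<bullet> (g c (snd c (\<gamma> t)) *v v t))"
      by (intro covector_le_speed[OF c im[OF t]]) (simp add: gip_chart_def)
  qed
  then show ?case using append.IH by simp
qed simp

lemma lipschitz_joined:
  assumes "C1 w" "\<And>p. gip w w p \<le> 1" "joined p q L"
  shows "w q - w p \<le> L"
  using lipschitz_along_curve[OF assms(1,2)] assms(3) unfolding joined_def by blast

lemma gip_scale:
  assumes "C1 h" "C1 h'" "c \<in> A" "p \<in> fst c" "\<And>i. partial i (rep c h') (snd c p) = t * partial i (rep c h) (snd c p)"
  shows "gip h' h' p = t\<^sup>2 * gip h h p" and "C1 k \<Longrightarrow> gip h' k p = t * gip h k p"
proof -
  have "dh c h' (snd c p) = t *\<^sub>R dh c h (snd c p)" using assms(5) by (simp add: dh_def vec_eq_iff)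
  then show "gip h' h' p = t\<^sup>2 * gip h h p" "C1 k \<Longrightarrow> gip h' k p = t * gip h k p"
    by (simp_all add: gip_eq[OF _ _ assms(3,4)] assms gip_chart_def matrix_vector_mult_scaleR power2_eq_square)
qed

text \<open>Without this fact nothing is known about \<open>geodesic_ball\<close>: the characterisation of
  \<open>Metric_space.mball\<close> presupposes the metric space axioms.\<close>

lemma Metric_space_riemannian: "Metric_space UNIV (riemannian_dist A g)"
proof
  show "0 \<le> riemannian_dist A g p q" for p q
    unfolding riemannian_dist_eq by (rule cInf_greatest) (use joined_exists joined_nonneg in auto)
  show "riemannian_dist A g p q = riemannian_dist A g q p" for p q
    unfolding riemannian_dist_eq using joined_sym by (metis (no_types, lifting) Collect_cong)
  show "riemannian_dist A g p r \<le> riemannian_dist A g p q + riemannian_dist A g q r" for p q r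
  proof (rule field_le_epsilon)
    fix e :: real assume "e > 0"
    obtain L1 where L1: "joined p q L1" "L1 < riemannian_dist A g p q + e / 2"
      using riemannian_dist_less[of p q "riemannian_dist A g p q + e / 2"] \<open>e > 0\<close> by auto
    obtain L2 where L2: "joined q r L2" "L2 < riemannian_dist A g q r + e / 2"
      using riemannian_dist_less[of q r "riemannian_dist A g q r + e / 2"] \<open>e > 0\<close> by auto
    show "riemannian_dist A g p r \<le> riemannian_dist A g p q + riemannian_dist A g q r + e"
      using riemannian_dist_le[OF joined_trans[OF L1(1) L2(1)]] L1(2) L2(2) by linarith
  qed
  have pos: "riemannian_dist A g p q \<noteq> 0" if pq: "p \<noteq> q" for p q
  proof
    assume d0: "riemannian_dist A g p q = 0"
    obtain c where c: "c \<in> A" "p \<in> fst c" by (rule chart_at)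
    obtain b K P where b: "C1 b" "compact K" "K \<subseteq> - {q} \<inter> fst c" "\<And>q. q \<notin> K \<Longrightarrow> b q = 0"
      "p \<in> P" "\<And>q. q \<in> P \<Longrightarrow> b q = 1"
      by (rule exists_bump[of "- {q}" p, OF open_Compl[OF closed_singleton] _ c]) (use pq in auto)
    \<comment> \<open>a rescaled bump function at \<open>p\<close> is 1-Lipschitz and separates \<open>p\<close> from \<open>q\<close>\<close>
    have "compact (gip b b ` K)"
      using continuous_on_gip[OF b(1) b(1)] b(2) compact_continuous_image continuous_on_subset by blast
    then obtain M where M: "\<And>x. x \<in> K \<Longrightarrow> \<bar>gip b b x\<bar> \<le> M"
      unfolding compact_eq_bounded_closed bounded_iff by auto
    have gM: "gip b b x \<le> max M 1" for x
    proof (cases "x \<in> K")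
      case False
      then show ?thesis using gip_outside[OF b(1) b(1) compact_imp_closed[OF b(2)] b(4)] by simp
    qed (use M in force)
    define s where "s = 1 / sqrt (max M 1)"
    have s: "s > 0" "s\<^sup>2 * max M 1 = 1" by (auto simp: s_def power_divide)
    have ds: "((\<lambda>t. - s * t) has_real_derivative - s) (at t)" for t by (auto intro!: derivative_eq_intros)
    note cc = C1_compose[OF b(1) ds continuous_on_const]
    have "gip (\<lambda>p. - s * b p) (\<lambda>p. - s * b p) x \<le> 1" for x
    proof -
      obtain e where e: "e \<in> A" "x \<in> fst e" by (rule chart_at)
      have "gip (\<lambda>p. - s * b p) (\<lambda>p. - s * b p) x = (- s)\<^sup>2 * gip b b x"
        by (rule gip_scale(1)[OF b(1) cc(1) e]) (rule cc(2)[OF e(1)], use e in simp)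
      also have "\<dots> \<le> s\<^sup>2 * max M 1" using gM[of x] by (simp add: mult_left_mono)
      finally show ?thesis using s by simp
    qed
    then have "(- s * b q) - (- s * b p) \<le> L" if "joined p q L" for L
      using lipschitz_joined[OF cc(1) _ that] by blast
    moreover have "b q = 0" "b p = 1" using b by auto
    ultimately have "s \<le> L" if "joined p q L" for L using that by force
    then have "s \<le> riemannian_dist A g p q"
      unfolding riemannian_dist_eq by (intro cInf_greatest) (use joined_exists in auto)
    then show False using s d0 by simp
  qed
  show "(riemannian_dist A g p q = 0) = (p = q)" for p q
  proof
    assume "p = q"
    have "riemannian_dist A g p p \<le> 0" by (rule riemannian_dist_le[OF joined_refl])
    moreover have "riemannian_dist A g p p \<ge> 0"
      unfolding riemannian_dist_eq by (rule cInf_greatest) (use joined_exists joined_nonneg in auto)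
    ultimately show "riemannian_dist A g p q = 0" using \<open>p = q\<close> by simp
  qed (use pos in blast)
qed

lemma in_geodesic_ball:
  assumes "q \<in> geodesic_ball A g p r"
  obtains L where "joined p q L" "L < r"
  using assms riemannian_dist_less
  unfolding geodesic_ball_def Metric_space.in_mball[OF Metric_space_riemannian] by blast

end

section \<open>Volume growth\<close>

text \<open>All partial derivatives vanish by Hamilton's identity, and a ball is convex.\<close>

lemma (in metric_chart) hamilton_constant:
  assumes F: "smooth_on S F" and sub: "ball z r \<subseteq> S" and xy: "x \<in> ball z r" "y \<in> ball z r"
    and sol: "\<And>y i j. y \<in> S \<Longrightarrow> ricci G i j y + hessian G F i j y = - (1/2) * G y $ i $ j"
  shows "scalar_curvature G x + df F x \<bullet> grad F x + F x = scalar_curvature G y + df F y \<bullet> grad F y + F y"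
proof -
  let ?H = "\<lambda>y. scalar_curvature G y + df F y \<bullet> grad F y + F y"
  have s: "smooth_on S (scalar_curvature G)"
    by (rule smooth_on_cong[OF open_S smooth_on_diff[OF open_S smooth_on_const[OF open_S, of "- real CARD('n) / 2"] smooth_lap[OF F]]])
      (simp add: soliton_trace[OF F _ sol])
  have "smooth_on S ?H"
    by (intro smooth_on_add[OF open_S] s F smooth_on_bilinear[OF open_S bounded_bilinear_inner] smooth_df smooth_grad)
  then have "(?H has_derivative (\<lambda>v. 0)) (at x)" if "x \<in> S" for x
    using has_derivative_partial_sum[OF smooth_on_differentiable[OF _ that], of ?H] hamilton_identity[OF F that sol] by simp
  then show ?thesis
    using has_derivative_zero_unique[OF convex_ball _ xy, of ?H] sub by (blast intro: has_derivative_at_withinI)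
qed

text \<open>The derivative \<open>2 * max 0 t\<close> is Lipschitz with constant 2, so the remainder
  is at most \<open>h^2\<close> uniformly in \<open>t\<close>; this permits differentiation under
  the integral.\<close>

lemma pos_sq_taylor: "\<bar>pos_sq (t + h) - pos_sq t - 2 * max 0 t * h\<bar> \<le> h\<^sup>2"
proof -
  consider "t \<ge> 0" "t + h \<ge> 0" | "t \<ge> 0" "t + h < 0" | "t < 0" "t + h \<ge> 0" | "t < 0" "t + h < 0" by linarith
  then show ?thesis
  proof cases
    case 1
    then show ?thesis by (simp add: pos_sq_simps power2_eq_square algebra_simps)
  next
    case 2
    have "(t + h)\<^sup>2 \<ge> 0" by simp
    moreover have "t * (t + 2 * h) \<le> 0" using 2 by (intro mult_nonneg_nonpos) auto
    ultimately show ?thesis using 2 by (simp add: pos_sq_simps power2_eq_square algebra_simps)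
  next
    case 3
    then have "(t + h)\<^sup>2 \<le> h\<^sup>2" by (intro power_mono) auto
    then show ?thesis using 3 by (simp add: pos_sq_simps)
  next
    case 4
    then show ?thesis by (simp add: pos_sq_simps)
  qed
qed

section \<open>Local finiteness of the volume\<close>

context riemannian_manifold
begin

text \<open>Every point has a neighbourhood contained in a compact subset of one chart domain, where
  the continuous density is integrable; finitely many of these neighbourhoods cover
  \<open>K\<close>.\<close>

lemma emeasure_V_compact_finite:
  assumes "compact K"
  shows "emeasure V K < \<infinity>"
proof -
  define good where "good P \<longleftrightarrow> open P \<and> emeasure V P < \<infinity>" for P
  have "\<exists>P. good P \<and> p \<in> P" for p
  proof -
    obtain c where c: "c \<in> A" "p \<in> fst c" by (rule chart_at)
    obtain b K P where b: "compact K" "K \<subseteq> UNIV \<inter> fst c" "\<And>q. q \<notin> K \<Longrightarrow> b q = (0::real)" "open P" "p \<in> P" "\<And>q. q \<in> P \<Longrightarrow> b q = 1"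
      by (rule exists_bump[OF open_UNIV UNIV_I c]) blast
    have K: "K \<in> sets borel" "K \<subseteq> fst c" using b(2) borel_closed[OF compact_imp_closed[OF b(1)]] by auto
    have sK: "compact (snd c ` K)" "snd c ` K \<subseteq> chart_image c"
      using compact_continuous_image[OF continuous_on_subset[OF continuous_on_chart[OF c(1)] K(2)] b(1)] K(2)
      by (auto simp: chart_image_def)
    have i: "integrable lborel (\<lambda>x. indicator (snd c ` K) x *\<^sub>R chart_density c x)"
      by (rule borel_integrable_compact[OF sK(1) continuous_on_subset[OF continuous_on_chart_density[OF c(1)] sK(2)]])
    have "emeasure V K = (\<integral>\<^sup>+x\<in>snd c ` K. chart_density c x \<partial>lborel)"
      using emeasure_V[OF c(1) K] emeasure_chart_measure[OF c(1) borel_image_chart[OF c(1) K] sK(2)] by simp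
    also have "\<dots> \<le> (\<integral>\<^sup>+x. ennreal (norm (indicator (snd c ` K) x *\<^sub>R chart_density c x)) \<partial>lborel)"
      by (intro nn_integral_mono) (auto simp: indicator_def intro!: ennreal_leI)
    also have "\<dots> < \<infinity>" using i by (simp add: integrable_iff_bounded)
    finally have "emeasure V K < \<infinity>" .
    moreover have "P \<subseteq> K" using b(3,6) by force
    then have "emeasure V P \<le> emeasure V K" using K by (intro emeasure_mono) auto
    ultimately have "emeasure V P < \<infinity>" by (rule order_le_less_trans[rotated])
    then show ?thesis using b(4,5) by (auto simp: good_def)
  qed
  then have "K \<subseteq> \<Union>{P. good P}" by blast
  moreover have "open P" if "P \<in> {P. good P}" for P using that by (simp add: good_def)
  ultimately obtain F where F: "F \<subseteq> {P. good P}" "finite F" "K \<subseteq> \<Union>F"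
    using assms by (meson compactE)
  have sF: "P \<in> sets V" if "P \<in> F" for P using that F(1) by (auto simp: good_def)
  have "emeasure V K \<le> emeasure V (\<Union>F)"
    using F(2,3) sF by (intro emeasure_mono sets.finite_Union) auto
  also have "\<dots> \<le> (\<Sum>P\<in>F. emeasure V P)"
    using emeasure_subadditive_finite[of F "\<lambda>P. P" V] F(2) sF by auto
  also have "\<dots> < \<infinity>" using F(1,2) by (auto simp: good_def less_top ennreal_sum_less_top)
  finally show ?thesis .
qed

lemma integrable_V_compact_support:
  fixes h :: "'m \<Rightarrow> real"
  assumes "continuous_on UNIV h" "compact K" "\<And>p. p \<notin> K \<Longrightarrow> h p = 0"
  shows "integrable V h"
proof -
  have "compact (h ` K)" using assms compact_continuous_image continuous_on_subset by blast
  then obtain M where M: "\<And>x. x \<in> K \<Longrightarrow> \<bar>h x\<bar> \<le> M" unfolding compact_eq_bounded_closed bounded_iff by auto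
  have K: "K \<in> sets V" using borel_closed[OF compact_imp_closed[OF assms(2)]] by simp
  have "integrable V (\<lambda>p. M * indicator K p)"
    using emeasure_V_compact_finite[OF assms(2)] K by (intro integrable_mult_right integrable_real_indicator) auto
  moreover have "norm (h p) \<le> norm (M * indicator K p)" for p
    using M[of p] assms(3)[of p] by (cases "p \<in> K") force+
  moreover have "h \<in> borel_measurable V"
    using borel_measurable_continuous_onI[OF assms(1)] by (simp add: measurable_cong_sets[OF sets_V])
  ultimately show ?thesis by (intro Bochner_Integration.integrable_bound[of V "\<lambda>p. M * indicator K p" h]) auto
qed

end

section \<open>Hamilton's identity on the manifold\<close>

context expanding_gradient_ricci_soliton
begin

lemmas C1_potential = smooth_function_C1[OF potential_smooth]

text \<open>The scalar curvature as a function of the point, by way of the traced soliton equation;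
  its independence of the chart is inherited from \<open>laplacian\<close>.\<close>

definition scal :: "'m \<Rightarrow> real" where "scal p = - real CARD('n) / 2 - laplacian f p"

lemma scal_eq:
  assumes "c \<in> A" "p \<in> fst c"
  shows "scalar_curvature (g c) (snd c p) = scal p"
proof -
  interpret metric_chart "chart_image c" "g c" by (rule metric_chart[OF assms(1)])
  show ?thesis
    using soliton_trace[OF smooth_rep[OF potential_smooth assms(1)] _ soliton_equation[OF assms(1)], of "snd c p"] assms
    by (simp add: scal_def laplacian_eq[OF potential_smooth assms] lap_chart_def)
qed

text \<open>Local constancy on coordinate balls, spread by connectedness of the manifold.\<close>

lemma hamilton_globally: "\<exists>c0. \<forall>p. scal p + gip f f p + f p = c0"
proof -
  let ?H = "\<lambda>p. scal p + gip f f p + f p"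
  have loc: "\<exists>X. open X \<and> p \<in> X \<and> (\<forall>q\<in>X. ?H p = ?H q)" for p
  proof -
    obtain c where c: "c \<in> A" "p \<in> fst c" by (rule chart_at)
    interpret metric_chart "chart_image c" "g c" by (rule metric_chart[OF c(1)])
    obtain r where r: "r > 0" "ball (snd c p) r \<subseteq> chart_image c"
      using open_image[OF c(1)] c(2) by (meson chart_in_image openE)
    define X where "X = fst c \<inter> snd c -` ball (snd c p) r"
    have "open X" unfolding X_def
      by (rule continuous_open_preimage[OF continuous_on_chart[OF c(1)] open_domain[OF c(1)] open_ball])
    moreover have H: "?H q = scalar_curvature (g c) (snd c q) + df (rep c f) (snd c q) \<bullet> grad (rep c f) (snd c q) + rep c f (snd c q)"
      if "q \<in> X" for q
    proof -
      have q: "q \<in> fst c" using that by (simp add: X_def)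
      have "gip f f q = df (rep c f) (snd c q) \<bullet> grad (rep c f) (snd c q)"
        unfolding gip_eq[OF C1_potential C1_potential c(1) q] by (simp add: gip_chart_def df_def grad_def dh_def N_def)
      then show ?thesis using scal_eq[OF c(1) q] c(1) q by simp
    qed
    have "?H p = ?H q" if "q \<in> X" for q
    proof -
      have pX: "p \<in> X" using c r by (simp add: X_def)
      show ?thesis unfolding H[OF pX] H[OF that]
        using hamilton_constant[OF smooth_rep[OF potential_smooth c(1)] r(2) _ _ soliton_equation[OF c(1)], of "snd c p" "snd c q"]
          pX that by (simp add: X_def)
    qed
    ultimately show ?thesis using c r by (intro exI[of _ X]) (auto simp: X_def)
  qed
  have "?H p = ?H q" for p q
  proof (rule connected_equivalence_relation[OF connected_manifold, of p q "\<lambda>p q. ?H p = ?H q"])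
    show "\<exists>T. openin (top_of_set UNIV) T \<and> a \<in> T \<and> (\<forall>x\<in>T. ?H a = ?H x)" for a
      using loc[of a] by simp
  qed auto
  then show ?thesis by metis
qed

end

text \<open>Fixes the constant \<open>c0\<close> of Hamilton's identity and a curvature bound
  \<open>B\<close>, in which the constants of all later estimates are expressed.\<close>

locale proper_expanding_soliton = expanding_gradient_ricci_soliton A g f
  for A :: "('m::{t2_space, second_countable_topology}, 'n::finite) chart set"
    and g :: "('m, 'n) chart \<Rightarrow> real ^ 'n \<Rightarrow> real ^ 'n ^ 'n"
    and f :: "'m \<Rightarrow> real" +
  fixes B c0 :: real
  assumes hamilton: "scal p + gip f f p + f p = c0"
    and scal_bound: "\<bar>scal p\<bar> \<le> B"
    and proper: "proper_function f"
begin

definition u :: "'m \<Rightarrow> real" where "u p = c0 - f p"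

lemma gip_f: "gip f f p = u p - scal p"
  using hamilton[of p] by (simp add: u_def)

lemma gip_nonneg: "gip f f p \<ge> 0"
proof -
  obtain c where c: "c \<in> A" "p \<in> fst c" by (rule chart_at)
  interpret metric_chart "chart_image c" "g c" by (rule metric_chart[OF c(1)])
  let ?x = "snd c p" let ?w = "N ?x *v dh c f ?x"
  have x: "?x \<in> chart_image c" using c by simp
  have "?w \<bullet> (g c ?x *v ?w) = ?w \<bullet> dh c f ?x"
    using x by (simp add: matrix_vector_mul_assoc G_N)
  then have "dh c f ?x \<bullet> ?w \<ge> 0" using metric_nonneg[OF c(1) x, of ?w] by (simp add: inner_commute)
  then show ?thesis by (simp add: gip_eq[OF C1_potential C1_potential c] gip_chart_def N_def)
qed

lemma u_lower: "u p \<ge> - B"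
  using gip_nonneg[of p] gip_f[of p] scal_bound[of p] by linarith

lemma u_continuous: "continuous_on UNIV u"
  unfolding u_def by (intro continuous_intros C1_continuous C1_potential)

lemma compact_sublevel: "compact {p. u p \<le> s}"
proof -
  \<comment> \<open>The lower bound \<open>- B\<close> of \<open>u\<close> supplies the missing end
    point of a compact interval of values of \<open>f\<close>.\<close>
  have "{p. u p \<le> s} = f -` {c0 - s..c0 + B}"
  proof -
    have "u p \<le> s \<longleftrightarrow> f p \<in> {c0 - s..c0 + B}" for p using u_lower[of p] by (auto simp: u_def)
    then show ?thesis by blast
  qed
  then show ?thesis using proper by (simp add: proper_function_def)
qed

lemma sets_sublevel: "{p. u p \<le> s} \<in> sets V"
  using borel_closed[OF compact_imp_closed[OF compact_sublevel]] by simp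

lemma integrable_sublevel:
  fixes h :: "'m \<Rightarrow> real"
  shows "continuous_on UNIV h \<Longrightarrow> (\<And>p. u p > s \<Longrightarrow> h p = 0) \<Longrightarrow> integrable V h"
  by (rule integrable_V_compact_support[OF _ compact_sublevel[of s]]) auto

lemma pos_sq_continuous: "continuous_on UNIV pos_sq"
  unfolding pos_sq_def by (intro continuous_intros)

lemma integrable_pos_sq: "integrable V (\<lambda>p. pos_sq (s - u p))"
  by (rule integrable_sublevel[of _ s])
    (auto intro!: continuous_on_compose2[OF pos_sq_continuous] continuous_intros u_continuous simp: pos_sq_simps)

lemma integrable_pos: "integrable V (\<lambda>p. max 0 (s - u p))"
  by (rule integrable_sublevel[of _ s]) (auto intro!: continuous_intros u_continuous)

section \<open>A differential inequality for a weighted volume\<close>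

definition I :: "real \<Rightarrow> real" where "I s = (\<integral>p. pos_sq (s - u p) \<partial>V)"
definition D :: "real \<Rightarrow> real" where "D s = (\<integral>p. 2 * max 0 (s - u p) \<partial>V)"

text \<open>The Taylor remainder of the integrand is at most \<open>h^2\<close> and, for
  \<open>abs h \<le> 1\<close>, vanishes outside the sublevel set of \<open>s + 1\<close>, which has
  finite volume; the error is therefore quadratic in \<open>h\<close>.\<close>

lemma I_has_derivative: "(I has_real_derivative D s) (at s)"
proof -
  let ?K = "{p. u p \<le> s + 1}"
  define m where "m = measure V ?K"
  have K: "?K \<in> sets V" "emeasure V ?K < \<infinity>"
    by (rule sets_sublevel) (rule emeasure_V_compact_finite[OF compact_sublevel])
  have bound: "\<bar>I (s + h) - I s - h * D s\<bar> \<le> h\<^sup>2 * m" if h: "\<bar>h\<bar> \<le> 1" for h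
  proof -
    let ?e = "\<lambda>p. pos_sq (s + h - u p) - pos_sq (s - u p) - h * (2 * max 0 (s - u p))"
    have i: "integrable V ?e"
      by (intro Bochner_Integration.integrable_diff integrable_pos_sq integrable_mult_right integrable_pos)
    have e: "I (s + h) - I s - h * D s = (\<integral>p. ?e p \<partial>V)"
      unfolding I_def D_def by (simp add: integrable_pos_sq integrable_pos)
    have "\<bar>I (s + h) - I s - h * D s\<bar> \<le> (\<integral>p. \<bar>?e p\<bar> \<partial>V)" unfolding e by (rule integral_abs_bound)
    also have "\<dots> \<le> (\<integral>p. h\<^sup>2 * indicator ?K p \<partial>V)"
    proof (rule integral_mono)
      show "integrable V (\<lambda>p. \<bar>?e p\<bar>)" using i by (rule integrable_abs)
      show "integrable V (\<lambda>p. h\<^sup>2 * indicator ?K p)" using K by (intro integrable_mult_right integrable_real_indicator)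
      fix p
      show "\<bar>?e p\<bar> \<le> h\<^sup>2 * indicator ?K p"
      proof (cases "p \<in> ?K")
        case True
        then show ?thesis using pos_sq_taylor[of "s - u p" h] by (simp add: algebra_simps)
      next
        case False
        then show ?thesis using h by (simp add: pos_sq_simps)
      qed
    qed
    also have "\<dots> = h\<^sup>2 * m" using K by (simp add: m_def)
    finally show ?thesis .
  qed
  have "((\<lambda>h. (I (s + h) - I s) / h - D s) \<longlongrightarrow> 0) (at 0)"
  proof (rule Lim_null_comparison)
    show "\<forall>\<^sub>F h in at 0. norm ((I (s + h) - I s) / h - D s) \<le> \<bar>h\<bar> * m"
      unfolding eventually_at
    proof (intro exI[of _ 1] conjI ballI impI)
      fix h :: real assume "h \<noteq> 0 \<and> dist h 0 < 1"
      then have h: "h \<noteq> 0" "\<bar>h\<bar> \<le> 1" by auto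
      have "(I (s + h) - I s) / h - D s = (I (s + h) - I s - h * D s) / h" using h by (simp add: field_simps)
      then have "norm ((I (s + h) - I s) / h - D s) = \<bar>I (s + h) - I s - h * D s\<bar> / \<bar>h\<bar>" by simp
      also have "\<dots> \<le> h\<^sup>2 * m / \<bar>h\<bar>" using bound[OF h(2)] by (intro divide_right_mono) auto
      also have "\<dots> = \<bar>h\<bar> * m" using h(1) by (simp add: field_simps power2_eq_square abs_if)
      finally show "norm ((I (s + h) - I s) / h - D s) \<le> \<bar>h\<bar> * m" .
    qed simp
    show "((\<lambda>h. \<bar>h\<bar> * m) \<longlongrightarrow> 0) (at 0)" by (intro tendsto_eq_intros) auto
  qed
  then show ?thesis by (simp add: DERIV_def LIM_zero_iff)
qed

lemma gronwall_inequality: "(s - B) * D s \<le> (B + real CARD('n) / 2 + 2) * I s"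
proof -
  \<comment> \<open>integration by parts against the test function \<open>(max 0 (s - u))\<^sup>2\<close>\<close>
  let ?n = "real CARD('n) / 2"
  let ?q = "\<lambda>t. pos_sq (s - c0 + t)" and ?q' = "\<lambda>t. 2 * max 0 (s - c0 + t)"
  have su: "s - c0 + f p = s - u p" for p by (simp add: u_def)
  have dq: "(?q has_real_derivative ?q' t) (at t)" for t
  proof -
    have "(?q has_real_derivative ?q' t * 1) (at t)"
      by (rule DERIV_chain2[where f = pos_sq, OF pos_sq_has_derivative]) (auto intro!: derivative_eq_intros)
    then show ?thesis by simp
  qed
  have cq: "continuous_on (range f) ?q'" by (intro continuous_intros)
  note cc = C1_compose[OF C1_potential dq cq]
  have gz: "gip (\<lambda>p. ?q (f p)) f p = 2 * max 0 (s - u p) * gip f f p" for p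
  proof -
    obtain c where c: "c \<in> A" "p \<in> fst c" by (rule chart_at)
    have "gip (\<lambda>p. ?q (f p)) f p = ?q' (f p) * gip f f p"
      by (rule gip_scale(2)[OF C1_potential cc(1) c _ C1_potential]) (use cc(2)[OF c(1), of "snd c p"] c in simp)
    then show ?thesis by (simp only: su)
  qed
  have z: "?q (f p) = 0" if "p \<notin> {p. u p \<le> s}" for p using that by (simp add: su pos_sq_simps)
  have ibp: "integrable V (\<lambda>p. pos_sq (s - u p) * laplacian f p)"
    "integrable V (\<lambda>p. 2 * max 0 (s - u p) * gip f f p)"
    "(\<integral>p. pos_sq (s - u p) * laplacian f p \<partial>V) = - (\<integral>p. 2 * max 0 (s - u p) * gip f f p \<partial>V)"
    using integration_by_parts[OF potential_smooth cc(1) compact_sublevel[of s] z, unfolded gz[abs_def], unfolded su]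
    by blast+
  have "(s - B) * D s - 2 * I s = (\<integral>p. (s - B) * (2 * max 0 (s - u p)) - 2 * pos_sq (s - u p) \<partial>V)"
    unfolding D_def I_def by (simp add: integrable_pos_sq integrable_pos)
  \<comment> \<open>On the sublevel set \<open>gip f f = u - scal\<close>, and \<open>u\<close> is
    written as \<open>s - (s - u)\<close>: the first part leads to \<open>s * D s\<close>, the
    second to \<open>- 2 * I s\<close>, and the curvature costs at most
    \<open>B * D s\<close>.\<close>
  also have "\<dots> \<le> (\<integral>p. 2 * max 0 (s - u p) * gip f f p \<partial>V)"
  proof (rule integral_mono)
    show "integrable V (\<lambda>p. (s - B) * (2 * max 0 (s - u p)) - 2 * pos_sq (s - u p))"
      by (intro Bochner_Integration.integrable_diff integrable_mult_right integrable_pos_sq integrable_pos)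
    fix p
    show "(s - B) * (2 * max 0 (s - u p)) - 2 * pos_sq (s - u p) \<le> 2 * max 0 (s - u p) * gip f f p"
    proof (cases "u p \<le> s")
      case True
      have "(s - u p) * (B - scal p) \<ge> 0" using True scal_bound[of p] by (intro mult_nonneg_nonneg) auto
      then show ?thesis using True by (simp add: pos_sq_simps gip_f power2_eq_square algebra_simps)
    qed (simp add: pos_sq_simps)
  qed (rule ibp(2))
  also have "\<dots> = (\<integral>p. - (pos_sq (s - u p) * laplacian f p) \<partial>V)" using ibp(3) by simp
  also have "\<dots> \<le> (\<integral>p. (B + ?n) * pos_sq (s - u p) \<partial>V)"
  proof (rule integral_mono)
    show "- (pos_sq (s - u p) * laplacian f p) \<le> (B + ?n) * pos_sq (s - u p)" for p
    proof -
      have "- laplacian f p \<le> B + ?n" using scal_bound[of p] by (simp add: scal_def)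
      from mult_right_mono[OF this pos_sq_simps(3)[of "s - u p"]] show ?thesis by (simp add: mult.commute)
    qed
  qed (use ibp(1) integrable_pos_sq in auto)
  also have "\<dots> = (B + ?n) * I s" by (simp add: I_def)
  finally show ?thesis by (simp add: algebra_simps)
qed

text \<open>By the differential inequality \<open>I s * (s - B) powr (- \<kappa>)\<close> does not
  increase. The starting point \<open>B + 1\<close> is where \<open>s - B\<close> equals 1, so the
  power disappears there.\<close>

lemma I_growth:
  assumes "s \<ge> B + 1"
  shows "I s \<le> I (B + 1) * (s - B) powr (B + real CARD('n) / 2 + 2)"
proof -
  define \<kappa> where "\<kappa> = B + real CARD('n) / 2 + 2"
  let ?J = "\<lambda>s. I s * (s - B) powr (- \<kappa>)"
  have "?J s \<le> ?J (B + 1)"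
  proof (rule DERIV_nonpos_imp_nonincreasing[OF assms])
    fix t assume t: "B + 1 \<le> t" "t \<le> s"
    have "(?J has_real_derivative D t * (t - B) powr (- \<kappa>) + I t * (- \<kappa> * (t - B) powr (- \<kappa> - 1))) (at t)"
      using t by (auto intro!: derivative_eq_intros I_has_derivative)
    moreover have "D t * (t - B) powr (- \<kappa>) + I t * (- \<kappa> * (t - B) powr (- \<kappa> - 1))
      = ((t - B) * D t - \<kappa> * I t) * (t - B) powr (- \<kappa> - 1)"
    proof -
      have "(t - B) powr (- \<kappa>) = (t - B) powr 1 * (t - B) powr (- \<kappa> - 1)"
        unfolding powr_add[symmetric] by simp
      then have e: "(t - B) powr (- \<kappa>) = (t - B) * (t - B) powr (- \<kappa> - 1)" using t by simp
      show ?thesis unfolding e by (simp add: algebra_simps)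
    qed
    moreover have "((t - B) * D t - \<kappa> * I t) * (t - B) powr (- \<kappa> - 1) \<le> 0"
      using gronwall_inequality[of t] by (intro mult_nonpos_nonneg) (auto simp: \<kappa>_def)
    ultimately show "\<exists>y. (?J has_real_derivative y) (at t) \<and> y \<le> 0" by auto
  qed
  then have "?J s * (s - B) powr \<kappa> \<le> I (B + 1) * (s - B) powr \<kappa>" by (intro mult_right_mono) auto
  moreover have "(s - B) powr (- \<kappa>) * (s - B) powr \<kappa> = 1" using assms by (simp add: powr_add[symmetric])
  ultimately show ?thesis by (simp add: \<kappa>_def mult.assoc)
qed

lemma I_nonneg: "I s \<ge> 0"
  unfolding I_def by (intro integral_nonneg_AE AE_I2 pos_sq_simps)

text \<open>Chebyshev's inequality at level 1: the shift by 1 makes the integrand at least 1 on the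
  sublevel set.\<close>

lemma emeasure_sublevel: "emeasure V {p. u p \<le> s} \<le> ennreal (I (s + 1))"
proof -
  have "emeasure V {p. u p \<le> s} = (\<integral>\<^sup>+p. indicator {p. u p \<le> s} p \<partial>V)" using sets_sublevel by simp
  also have "\<dots> \<le> (\<integral>\<^sup>+p. ennreal (pos_sq (s + 1 - u p)) \<partial>V)"
  proof (rule nn_integral_mono)
    fix p
    show "indicator {p. u p \<le> s} p \<le> ennreal (pos_sq (s + 1 - u p))"
    proof (cases "u p \<le> s")
      case True
      then have "pos_sq (s + 1 - u p) \<ge> 1" by (simp add: pos_sq_simps one_le_power)
      then show ?thesis using True ennreal_leI[of 1] by simp
    qed simp
  qed
  also have "\<dots> = ennreal (I (s + 1))"
    unfolding I_def using integrable_pos_sq by (intro nn_integral_eq_integral AE_I2 pos_sq_simps)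
  finally show ?thesis .
qed

lemma u_ball:
  assumes "q \<in> geodesic_ball A g p r"
  shows "u q \<le> (sqrt (u p + B + 1) + r)\<^sup>2"
proof -
  \<comment> \<open>As \<open>u\<close> is only known to be at least \<open>- B\<close>, the summand
    1 keeps the radicand positive and the root differentiable on the range of
    \<open>f\<close>.\<close>
  let ?q = "\<lambda>t. sqrt (c0 - t + B + 1)" and ?q' = "\<lambda>t. - 1 / (2 * sqrt (c0 - t + B + 1))"
  have pos: "c0 - f x + B + 1 > 0" for x using u_lower[of x] by (simp add: u_def)
  have dq: "(?q has_real_derivative ?q' t) (at t)" if "t \<in> range f" for t
  proof -
    have p: "c0 - t + B + 1 > 0" using pos that by blast
    have "(?q has_real_derivative inverse (sqrt (c0 - t + B + 1)) / 2 * (- 1)) (at t)"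
      by (rule DERIV_chain2[where f = sqrt and g = "\<lambda>t. c0 - t + B + 1" and x = t, OF DERIV_real_sqrt[OF p]]) (auto intro!: derivative_eq_intros)
    then show ?thesis by (simp add: inverse_eq_divide mult.commute)
  qed
  have cq: "continuous_on (range f) ?q'" 
  proof -
    have "2 * sqrt (c0 - t + B + 1) \<noteq> 0" if "t \<in> range f" for t
      using pos that by (auto simp: less_imp_neq[THEN not_sym])
    then show ?thesis by (intro continuous_intros) auto
  qed
  note cc = C1_compose[OF C1_potential dq cq]
  let ?w = "\<lambda>p. ?q (f p)"
  have "gip ?w ?w x \<le> 1" for x
  proof -
    obtain c where c: "c \<in> A" "x \<in> fst c" by (rule chart_at)
    have "gip ?w ?w x = (?q' (f x))\<^sup>2 * gip f f x"
      by (rule gip_scale(1)[OF C1_potential cc(1) c]) (use cc(2)[OF _ c(1), of "snd c x"] c in simp_all)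
    \<comment> \<open>The numerator is at most \<open>u x + B\<close>, so the quotient even stays
      below \<open>1/4\<close>.\<close>
    also have "\<dots> = (u x - scal x) / (4 * (u x + B + 1))"
      using pos[of x] by (simp add: gip_f power_divide power_mult_distrib u_def)
    also have "\<dots> \<le> 1" using u_lower[of x] scal_bound[of x] by (simp add: field_simps)
    finally show ?thesis .
  qed
  moreover obtain L where L: "joined p q L" "L < r" by (rule in_geodesic_ball[OF assms])
  ultimately have "?w q - ?w p \<le> L" using cc(1) lipschitz_joined by blast
  then have "sqrt (u q + B + 1) \<le> sqrt (u p + B + 1) + r" using L(2) by (simp add: u_def)
  then have "(sqrt (u q + B + 1))\<^sup>2 \<le> (sqrt (u p + B + 1) + r)\<^sup>2"
    using u_lower[of q] by (intro power_mono) auto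
  moreover have "B \<ge> 0" using scal_bound[of p] by linarith
  ultimately show ?thesis using u_lower[of q] by simp
qed

lemma polynomial_volume_growth:
  "\<exists>C k :: real. C > 0 \<and> k > 0 \<and> (\<forall>\<^sub>F r in at_top. emeasure V (geodesic_ball A g p r) \<le> ennreal (C * r powr k))"
proof -
  \<comment> \<open>The exponent of growth in \<open>s\<close>; a ball of radius \<open>r\<close>
    lies in a sublevel set of order \<open>r^2\<close>, which doubles it in the conclusion.\<close>
  define \<kappa> where "\<kappa> = B + real CARD('n) / 2 + 2"
  have B: "B \<ge> 0" using scal_bound[of p] by linarith
  have \<kappa>: "\<kappa> > 0" using B by (simp add: \<kappa>_def add_nonneg_pos)
  define a where "a = sqrt (u p + B + 1)"
  have a: "a \<ge> 0" using u_lower[of p] by (simp add: a_def)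
  \<comment> \<open>The factor 5 comes from
    \<open>(a + r)^2 + 1 - B \<le> 4 * r^2 + 1 \<le> 5 * r^2\<close>; adding 1 makes
    \<open>C\<close> positive even if \<open>I (B + 1) = 0\<close>.\<close>
  define C where "C = I (B + 1) * 5 powr \<kappa> + 1"
  \<comment> \<open>As \<open>a\<close> and \<open>B\<close> are nonnegative, the threshold yields
    \<open>r \<ge> 1\<close>, \<open>r \<ge> a\<close> and \<open>r \<ge> B\<close>
    together.\<close>
  have "emeasure V (geodesic_ball A g p r) \<le> ennreal (C * r powr (2 * \<kappa>))" if r: "r \<ge> 1 + a + B" for r
  proof -
    let ?s = "(a + r)\<^sup>2"
    have r1: "r \<ge> 1" "r \<ge> a" "r \<ge> B" using r a B by auto
    have s: "?s \<le> 4 * r\<^sup>2" using power_mono[of "a + r" "2 * r" 2] r1 a by (simp add: power_mult_distrib)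
    have "r\<^sup>2 \<ge> r" using r1 by (simp add: power2_eq_square)
    moreover have "?s \<ge> r\<^sup>2" using a r1 by (intro power_mono) auto
    ultimately have sB: "?s + 1 \<ge> B + 1" using r1 by linarith
    have "geodesic_ball A g p r \<subseteq> {q. u q \<le> ?s}" using u_ball by (auto simp: a_def)
    then have "emeasure V (geodesic_ball A g p r) \<le> emeasure V {q. u q \<le> ?s}"
      using sets_sublevel by (intro emeasure_mono) auto
    also have "\<dots> \<le> ennreal (I (?s + 1))" by (rule emeasure_sublevel)
    also have "\<dots> \<le> ennreal (C * r powr (2 * \<kappa>))"
    proof (rule ennreal_leI)
      have "I (?s + 1) \<le> I (B + 1) * (?s + 1 - B) powr \<kappa>"
        unfolding \<kappa>_def by (rule I_growth[OF sB])
      also have "\<dots> \<le> I (B + 1) * (5 * r\<^sup>2) powr \<kappa>"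
      proof (intro mult_left_mono powr_mono2 I_nonneg)
        have "r\<^sup>2 \<ge> 1" using r1 by simp
        then show "?s + 1 - B \<le> 5 * r\<^sup>2" using s B by linarith
      qed (use sB \<kappa> in auto)
      also have "(5 * r\<^sup>2) powr \<kappa> = 5 powr \<kappa> * r powr (2 * \<kappa>)"
      proof -
        have "r\<^sup>2 = r powr 2" using r1 by simp
        then have "r\<^sup>2 powr \<kappa> = r powr (2 * \<kappa>)" by (simp only: powr_powr)
        then show ?thesis using r1 by (simp add: powr_mult)
      qed
      also have "I (B + 1) * (5 powr \<kappa> * r powr (2 * \<kappa>)) \<le> C * r powr (2 * \<kappa>)"
        by (simp add: C_def algebra_simps)
      finally show "I (?s + 1) \<le> C * r powr (2 * \<kappa>)" .
    qed
    finally show ?thesis .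
  qed
  then have "\<forall>\<^sub>F r in at_top. emeasure V (geodesic_ball A g p r) \<le> ennreal (C * r powr (2 * \<kappa>))"
    unfolding eventually_at_top_linorder by blast
  moreover have "C > 0" using I_nonneg[of "B + 1"] by (simp add: C_def add_nonneg_pos)
  ultimately show ?thesis using \<kappa> by (intro exI[of _ C] exI[of _ "2 * \<kappa>"]) auto
qed

end

theorem corollary4p11:
  fixes A :: "('m::{t2_space, second_countable_topology}, 'n::finite) chart set"
    and g :: "('m, 'n) chart \<Rightarrow> real ^ 'n \<Rightarrow> real ^ 'n ^ 'n"
    and f :: "'m \<Rightarrow> real"
    and p :: 'm
  assumes "expanding_gradient_ricci_soliton A g f"
    and "complete_metric A g"
    and "\<not> compact (UNIV :: 'm set)"
    and "bounded_scalar_curvature A g"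
    and "proper_function f"
  shows "\<exists>C k :: real. C > 0 \<and> k > 0 \<and>
           (\<forall>\<^sub>F r in at_top.
              emeasure (riemannian_volume A g) (geodesic_ball A g p r) \<le> ennreal (C * r powr k))"
proof -
  interpret expanding_gradient_ricci_soliton A g f by (rule assms(1))
  obtain c0 where c0: "\<And>p. scal p + gip f f p + f p = c0" using hamilton_globally by blast
  obtain B where B: "\<And>c x. c \<in> A \<Longrightarrow> x \<in> chart_image c \<Longrightarrow> \<bar>scalar_curvature (g c) x\<bar> \<le> B"
    using assms(4) unfolding bounded_scalar_curvature_def by blast
  have scal_le: "\<bar>scal p\<bar> \<le> B" for p
  proof -
    obtain c where "c \<in> A" "p \<in> fst c" by (rule chart_at)
    then show ?thesis using B[of c "snd c p"] scal_eq by simp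
  qed
  then interpret proper_expanding_soliton A g f B c0
    by unfold_locales (rule c0 scal_le assms(5))+
  show ?thesis by (rule polynomial_volume_growth)
qed

end
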